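(* Let $E$ and $F$ be Banach spaces, $1\le p<\infty$, $\frac1p+\frac1q=1$, $m\in\mathbb N$, and $P\in\mathcal P(^mE;F)$. The following statements are equivalent. (i) $P\in\mathcal P_{K_p}(^mE;F)$. (ii) There exist a sequence $y=(y_n)_n\in\ell_p(F)$, a polynomial $Q\in\mathcal P(^mE;\ell_q/\ker\theta_y)$ and an operator $T\in\mathcal K_p(\ell_q/\ker\theta_y;F)$ such that $P=T\circ Q$. In this case $$\kappa_p(P)=\inf\{\|Q\|\,\kappa_p(T)\},$$ where the infimum is taken over all the possible factorizations of this form. (iii) There exist a sequence $y=(y_n)_n\in\ell_p(F)$, a closed subspace $M\subset\ell_1$, a polynomial $Q\in\mathcal P(^mE;\ell_q/\ker\theta_y)$ and operators $R\in\mathcal K_p(\ell_q/\ker\theta_y;\ell_1/M)$ and $S\in\mathcal K(\ell_1/M;F)$ such that $P=SRQ$. In this case $$\kappa_p(P)=\inf\{\|Q\|\,\kappa_p(R)\,\|S\|\},$$ where the infimum is taken over all the possible factorizations of this form.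
   Context: Banach spaces are complex; $B_E$ is the closed unit ball of $E$. $\mathcal P(^mE;F)$ is the space of continuous $m$-homogeneous polynomials from $E$ to $F$ with norm $\|P\|=\sup_{x\in B_E}\|P(x)\|$. $\ell_p(F)$ is the Banach space of $p$-summable sequences in $F$ with its natural norm $\|\cdot\|_p$. For $(y_n)_n\in\ell_p(F)$ put $p\text{-co}\{y_n\}=\{\sum_n\alpha_ny_n:(\alpha_n)_n\in B_{\ell_q}\}$, where $\frac1p+\frac1q=1$. A set $K\subset F$ is relatively $p$-compact if it is contained in the closure of $p\text{-co}\{y_n\}$ for some $(y_n)_n\in\ell_p(F)$, and $m_p(K)=\inf\{\|(y_n)_n\|_p:K\subset p\text{-co}\{y_n\}\}$. A polynomial $P\in\mathcal P(^mE;F)$ (or a bounded linear operator, the case $m=1$) is $p$-compact if $P(B_E)$ is relatively $p$-compact; then $\kappa_p(P)=m_p(P(B_E))$. $\mathcal P_{K_p}(^mE;F)$ denotes the space of $p$-compact $m$-homogeneous polynomials, $\mathcal K_p(E;F)$ the space of $p$-compact linear operators, and $\mathcal K(E;F)$ the space of compact linear operators. For $y=(y_n)_n\in\ell_p(F)$, $\theta_y:\ell_q\to F$ is the bounded linear operator $\theta_y((\alpha_n)_n)=\sum_n\alpha_ny_n$. *)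

theory Defs
  imports
    "HOL-Analysis.Analysis"
    "HOL-Algebra.Module"
    "HOL-Algebra.AbelCoset"
    "HOL-Algebra.Algebraic_Closure_Type"
begin

section \<open>Complex Banach spaces on explicit carriers\<close>

text \<open>
  The quotients \<open>\<ell>\<^sub>q / ker \<theta>\<^sub>y\<close> and \<open>\<ell>\<^sub>1 / M\<close> vary with the bound variables \<open>y\<close> and \<open>M\<close>, so they cannot
  be types. All spaces are therefore modules over the complex numbers in the sense of HOL-Algebra,
  extended by a norm. The fields \<open>mult\<close> and \<open>one\<close>, inherited from the library's
  record of modules, play no role.
\<close>

record 'a cnspace = "(complex, 'a) module" +
  vnorm :: "'a \<Rightarrow> real"

abbreviation complex_ring :: "complex ring" where
  "complex_ring \<equiv> ring_of_type_algebra"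

locale complex_normed_space = module complex_ring V
  for V :: "'a cnspace" (structure) +
  assumes vnorm_nonneg: "x \<in> carrier V \<Longrightarrow> 0 \<le> vnorm V x"
    and vnorm_eq_0_iff: "x \<in> carrier V \<Longrightarrow> vnorm V x = 0 \<longleftrightarrow> x = \<zero>\<^bsub>V\<^esub>"
    and vnorm_smult: "x \<in> carrier V \<Longrightarrow> vnorm V (c \<odot>\<^bsub>V\<^esub> x) = cmod c * vnorm V x"
    and vnorm_triangle:
      "\<lbrakk>x \<in> carrier V; y \<in> carrier V\<rbrakk> \<Longrightarrow> vnorm V (x \<oplus>\<^bsub>V\<^esub> y) \<le> vnorm V x + vnorm V y"

text \<open>The value outside the carrier is fixed because the library's locale of metric spaces requires
  nonnegativity and symmetry on the whole type.\<close>

definition ndist :: "'a cnspace \<Rightarrow> 'a \<Rightarrow> 'a \<Rightarrow> real" where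
  "ndist V x y = (if x \<in> carrier V \<and> y \<in> carrier V then vnorm V (x \<ominus>\<^bsub>V\<^esub> y) else 0)"

definition ntop :: "'a cnspace \<Rightarrow> 'a topology" where
  "ntop V = Metric_space.mtopology (carrier V) (ndist V)"

locale complex_banach_space = complex_normed_space +
  assumes complete: "Metric_space.mcomplete (carrier V) (ndist V)"

lemma (in complex_normed_space) Metric_space_ndist: "Metric_space (carrier V) (ndist V)"
proof
  have one: "\<one>\<^bsub>complex_ring\<^esub> = 1" and uminus: "\<ominus>\<^bsub>complex_ring\<^esub> \<one>\<^bsub>complex_ring\<^esub> = -1"
    and car: "carrier complex_ring = UNIV"
    apply (simp_all add: ring_of_type_algebra_def)
    apply (rule sym, rule R.sum_zero_eq_neg [unfolded ring_of_type_algebra_def])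
      apply (simp_all add: ring_of_type_algebra_def)
    done
  have neg: "\<ominus>\<^bsub>V\<^esub> x = (-1) \<odot>\<^bsub>V\<^esub> x" if "x \<in> carrier V" for x
    using smult_l_minus [of "\<one>\<^bsub>complex_ring\<^esub>" x] that uminus smult_one [of x] by (simp add: one car)
  have norm_neg: "vnorm V (\<ominus>\<^bsub>V\<^esub> x) = vnorm V x" if "x \<in> carrier V" for x
    using that by (simp add: neg vnorm_smult)
  show "0 \<le> ndist V x y" for x y
    by (simp add: ndist_def vnorm_nonneg)
  show "ndist V x y = ndist V y x" for x y
  proof (cases "x \<in> carrier V \<and> y \<in> carrier V")
    case True
    then have "y \<ominus>\<^bsub>V\<^esub> x = \<ominus>\<^bsub>V\<^esub> (x \<ominus>\<^bsub>V\<^esub> y)"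
      by (simp add: a_minus_def M.minus_add M.a_comm)
    then show ?thesis
      using True norm_neg [of "x \<ominus>\<^bsub>V\<^esub> y"] by (simp add: ndist_def)
  qed (auto simp: ndist_def)
  show "ndist V x y = 0 \<longleftrightarrow> x = y" if "x \<in> carrier V" "y \<in> carrier V" for x y
  proof -
    have "x = y" if "x \<ominus>\<^bsub>V\<^esub> y = \<zero>\<^bsub>V\<^esub>"
      using M.minus_equality [of x "\<ominus>\<^bsub>V\<^esub> y"] that \<open>x \<in> carrier V\<close> \<open>y \<in> carrier V\<close>
      by (simp add: a_minus_def)
    moreover have "x \<ominus>\<^bsub>V\<^esub> y = \<zero>\<^bsub>V\<^esub>" if "x = y"
      using that \<open>y \<in> carrier V\<close> by (simp add: a_minus_def M.r_neg)
    ultimately show ?thesis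
      using that by (auto simp: ndist_def vnorm_eq_0_iff)
  qed
  show "ndist V x z \<le> ndist V x y + ndist V y z"
    if "x \<in> carrier V" "y \<in> carrier V" "z \<in> carrier V" for x y z
  proof -
    have "x \<ominus>\<^bsub>V\<^esub> z = (x \<ominus>\<^bsub>V\<^esub> y) \<oplus>\<^bsub>V\<^esub> (y \<ominus>\<^bsub>V\<^esub> z)"
      using that by (simp add: a_minus_def M.a_assoc) (simp add: M.a_assoc [symmetric] M.l_neg)
    then show ?thesis
      using that vnorm_triangle [of "x \<ominus>\<^bsub>V\<^esub> y" "y \<ominus>\<^bsub>V\<^esub> z"] by (simp add: ndist_def)
  qed
qed

definition uball :: "'a cnspace \<Rightarrow> 'a set" where
  "uball V = {x \<in> carrier V. vnorm V x \<le> 1}"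

text \<open>Meaningful when the series converges in norm, since limits are unique.\<close>

definition nsuminf :: "'a cnspace \<Rightarrow> (nat \<Rightarrow> 'a) \<Rightarrow> 'a" where
  "nsuminf V f = (THE s. limitin (ntop V) (\<lambda>N. finsum V f {..<N}) s sequentially)"

section \<open>Sequence spaces and quotients\<close>

definition complex_space :: "complex cnspace" where
  "complex_space = \<lparr>carrier = UNIV, monoid.mult = (*), one = 1, zero = 0, add = (+),
     smult = (*), vnorm = cmod\<rparr>"

text \<open>\<open>\<ell>\<^sub>r(V)\<close> for \<open>1 \<le> r \<le> \<infinity>\<close>.\<close>

definition ell :: "ennreal \<Rightarrow> 'a cnspace \<Rightarrow> (nat \<Rightarrow> 'a) cnspace" where
  "ell r V =
    \<lparr>carrier = {x. (\<forall>n. x n \<in> carrier V) \<and>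
        (if r = \<infinity> then bdd_above (range (\<lambda>n. vnorm V (x n)))
         else summable (\<lambda>n. vnorm V (x n) powr enn2real r))},
     monoid.mult = undefined, one = undefined,
     zero = (\<lambda>n. \<zero>\<^bsub>V\<^esub>),
     add = (\<lambda>x y n. x n \<oplus>\<^bsub>V\<^esub> y n),
     smult = (\<lambda>c x n. c \<odot>\<^bsub>V\<^esub> x n),
     vnorm = (\<lambda>x. if r = \<infinity> then (SUP n. vnorm V (x n))
        else (\<Sum>n. vnorm V (x n) powr enn2real r) powr (1 / enn2real r))\<rparr>"

definition closed_subspace :: "'a set \<Rightarrow> 'a cnspace \<Rightarrow> bool" where
  "closed_subspace M V \<longleftrightarrow> submodule M complex_ring V \<and> closedin (ntop V) M"

text \<open>Elements of the quotient are the cosets of \<open>M\<close>. Adding \<open>M\<close> to \<open>{c a | a \<in> A}\<close> only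
  matters for \<open>c = 0\<close>, when that set is \<open>{0}\<close> rather than the coset \<open>M\<close>.\<close>

definition quotient_space :: "'a cnspace \<Rightarrow> 'a set \<Rightarrow> 'a set cnspace" where
  "quotient_space V M =
    \<lparr>carrier = a_rcosets\<^bsub>V\<^esub> M,
     monoid.mult = undefined, one = undefined,
     zero = M,
     add = (\<lambda>A B. A <+>\<^bsub>V\<^esub> B),
     smult = (\<lambda>c A. ((\<lambda>a. c \<odot>\<^bsub>V\<^esub> a) ` A) <+>\<^bsub>V\<^esub> M),
     vnorm = (\<lambda>A. INF a\<in>A. vnorm V a)\<rparr>"

section \<open>Operators and homogeneous polynomials\<close>

definition bounded_ops :: "'a cnspace \<Rightarrow> 'b cnspace \<Rightarrow> ('a \<Rightarrow> 'b) set" where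
  "bounded_ops V W = {T \<in> carrier V \<rightarrow> carrier W.
     (\<forall>u\<in>carrier V. \<forall>v\<in>carrier V. T (u \<oplus>\<^bsub>V\<^esub> v) = T u \<oplus>\<^bsub>W\<^esub> T v) \<and>
     (\<forall>c. \<forall>u\<in>carrier V. T (c \<odot>\<^bsub>V\<^esub> u) = c \<odot>\<^bsub>W\<^esub> T u) \<and>
     (\<exists>C. \<forall>u\<in>carrier V. vnorm W (T u) \<le> C * vnorm V u)}"

definition compact_ops :: "'a cnspace \<Rightarrow> 'b cnspace \<Rightarrow> ('a \<Rightarrow> 'b) set" where
  "compact_ops V W = {T \<in> bounded_ops V W.
     compactin (ntop W) (ntop W closure_of (T ` uball V))}"

text \<open>An \<open>m\<close>-tuple is a list of length \<open>m\<close>.\<close>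

definition multilinear :: "nat \<Rightarrow> 'a cnspace \<Rightarrow> 'b cnspace \<Rightarrow> ('a list \<Rightarrow> 'b) \<Rightarrow> bool" where
  "multilinear m V W A \<longleftrightarrow>
    (\<forall>xs. length xs = m \<and> set xs \<subseteq> carrier V \<longrightarrow>
      A xs \<in> carrier W \<and>
      (\<forall>i<m. \<forall>u\<in>carrier V. \<forall>v\<in>carrier V.
        A (xs[i := u \<oplus>\<^bsub>V\<^esub> v]) = A (xs[i := u]) \<oplus>\<^bsub>W\<^esub> A (xs[i := v])) \<and>
      (\<forall>i<m. \<forall>c. \<forall>u\<in>carrier V.
        A (xs[i := c \<odot>\<^bsub>V\<^esub> u]) = c \<odot>\<^bsub>W\<^esub> A (xs[i := u])))"

definition hom_polys :: "nat \<Rightarrow> 'a cnspace \<Rightarrow> 'b cnspace \<Rightarrow> ('a \<Rightarrow> 'b) set" where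
  "hom_polys m V W = {P. continuous_map (ntop V) (ntop W) P \<and>
     (\<exists>A. multilinear m V W A \<and> (\<forall>x\<in>carrier V. P x = A (replicate m x)))}"

text \<open>The norm of polynomials and of bounded linear operators alike.\<close>

definition sup_norm :: "'a cnspace \<Rightarrow> 'b cnspace \<Rightarrow> ('a \<Rightarrow> 'b) \<Rightarrow> real" where
  "sup_norm V W P = (SUP x\<in>uball V. vnorm W (P x))"

section \<open>\<open>p\<close>-compactness\<close>

text \<open>Throughout, \<open>q\<close> is the conjugate exponent of \<open>p\<close>.\<close>

definition theta :: "'b cnspace \<Rightarrow> (nat \<Rightarrow> 'b) \<Rightarrow> (nat \<Rightarrow> complex) \<Rightarrow> 'b" where
  "theta F y \<alpha> = nsuminf F (\<lambda>n. \<alpha> n \<odot>\<^bsub>F\<^esub> y n)"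

definition ker_theta :: "ennreal \<Rightarrow> 'b cnspace \<Rightarrow> (nat \<Rightarrow> 'b) \<Rightarrow> (nat \<Rightarrow> complex) set" where
  "ker_theta q F y = {\<alpha> \<in> carrier (ell q complex_space). theta F y \<alpha> = \<zero>\<^bsub>F\<^esub>}"

definition pco :: "ennreal \<Rightarrow> 'b cnspace \<Rightarrow> (nat \<Rightarrow> 'b) \<Rightarrow> 'b set" where
  "pco q F y = {nsuminf F (\<lambda>n. \<alpha> n \<odot>\<^bsub>F\<^esub> y n) |\<alpha>. \<alpha> \<in> uball (ell q complex_space)}"

definition rel_p_compact :: "ennreal \<Rightarrow> ennreal \<Rightarrow> 'b cnspace \<Rightarrow> 'b set \<Rightarrow> bool" where
  "rel_p_compact p q F K \<longleftrightarrow> K \<subseteq> carrier F \<and>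
     (\<exists>y\<in>carrier (ell p F). K \<subseteq> ntop F closure_of pco q F y)"

definition p_measure :: "ennreal \<Rightarrow> ennreal \<Rightarrow> 'b cnspace \<Rightarrow> 'b set \<Rightarrow> real" where
  "p_measure p q F K = Inf {vnorm (ell p F) y |y. y \<in> carrier (ell p F) \<and> K \<subseteq> pco q F y}"

definition p_compact_polys ::
    "ennreal \<Rightarrow> ennreal \<Rightarrow> nat \<Rightarrow> 'a cnspace \<Rightarrow> 'b cnspace \<Rightarrow> ('a \<Rightarrow> 'b) set" where
  "p_compact_polys p q m E F = {P \<in> hom_polys m E F. rel_p_compact p q F (P ` uball E)}"

definition p_compact_ops ::
    "ennreal \<Rightarrow> ennreal \<Rightarrow> 'a cnspace \<Rightarrow> 'b cnspace \<Rightarrow> ('a \<Rightarrow> 'b) set" where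
  "p_compact_ops p q E F = {T \<in> bounded_ops E F. rel_p_compact p q F (T ` uball E)}"

definition kappa ::
    "ennreal \<Rightarrow> ennreal \<Rightarrow> 'a cnspace \<Rightarrow> 'b cnspace \<Rightarrow> ('a \<Rightarrow> 'b) \<Rightarrow> real" where
  "kappa p q E F P = p_measure p q F (P ` uball E)"

definition lq_mod_ker :: "ennreal \<Rightarrow> 'b cnspace \<Rightarrow> (nat \<Rightarrow> 'b) \<Rightarrow> (nat \<Rightarrow> complex) set cnspace" where
  "lq_mod_ker q F y = quotient_space (ell q complex_space) (ker_theta q F y)"

definition l1_mod :: "(nat \<Rightarrow> complex) set \<Rightarrow> (nat \<Rightarrow> complex) set cnspace" where
  "l1_mod M = quotient_space (ell 1 complex_space) M"

text \<open>The two kinds of factorization of \<open>P\<close>. Maps matter only on the carrier of their domain,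
  so \<open>P\<close> and the composition are compared there.\<close>

definition factors_via_Q_T ::
    "ennreal \<Rightarrow> ennreal \<Rightarrow> nat \<Rightarrow> 'a cnspace \<Rightarrow> 'b cnspace \<Rightarrow> ('a \<Rightarrow> 'b) \<Rightarrow>
     (nat \<Rightarrow> 'b) \<Rightarrow> ('a \<Rightarrow> (nat \<Rightarrow> complex) set) \<Rightarrow> ((nat \<Rightarrow> complex) set \<Rightarrow> 'b) \<Rightarrow> bool" where
  "factors_via_Q_T p q m E F P y Q T \<longleftrightarrow>
     y \<in> carrier (ell p F) \<and>
     Q \<in> hom_polys m E (lq_mod_ker q F y) \<and>
     T \<in> p_compact_ops p q (lq_mod_ker q F y) F \<and>
     (\<forall>x\<in>carrier E. P x = T (Q x))"

definition factors_via_Q_R_S ::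
    "ennreal \<Rightarrow> ennreal \<Rightarrow> nat \<Rightarrow> 'a cnspace \<Rightarrow> 'b cnspace \<Rightarrow> ('a \<Rightarrow> 'b) \<Rightarrow>
     (nat \<Rightarrow> 'b) \<Rightarrow> (nat \<Rightarrow> complex) set \<Rightarrow> ('a \<Rightarrow> (nat \<Rightarrow> complex) set) \<Rightarrow>
     ((nat \<Rightarrow> complex) set \<Rightarrow> (nat \<Rightarrow> complex) set) \<Rightarrow> ((nat \<Rightarrow> complex) set \<Rightarrow> 'b) \<Rightarrow> bool" where
  "factors_via_Q_R_S p q m E F P y M Q R S \<longleftrightarrow>
     y \<in> carrier (ell p F) \<and>
     closed_subspace M (ell 1 complex_space) \<and>
     Q \<in> hom_polys m E (lq_mod_ker q F y) \<and>
     R \<in> p_compact_ops p q (lq_mod_ker q F y) (l1_mod M) \<and>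
     S \<in> compact_ops (l1_mod M) F \<and>
     (\<forall>x\<in>carrier E. P x = S (R (Q x)))"

end

theory Submission
  imports Defs
begin

text \<open>
  The set \<open>p\<close>-co\<open>{y\<^sub>n}\<close> is the image of the ball of \<open>\<ell>\<^sub>q\<close> under \<open>\<theta>\<^sub>y\<close>; that ball is compact for
  coordinatewise convergence and the tails of \<open>\<theta>\<^sub>y\<close> are uniformly small on it, so the image is compact
  and the closure in the definition of relative \<open>p\<close>-compactness can be dropped. If
  \<open>P(B\<^sub>E) \<subseteq> p\<close>-co\<open>{y\<^sub>n}\<close>, let \<open>T\<close> be the injection of \<open>\<ell>\<^sub>q / ker \<theta>\<^sub>y\<close> into \<open>F\<close> induced by \<open>\<theta>\<^sub>y\<close> and
  \<open>Q = T\<inverse> P\<close>. A linear (discontinuous) left inverse of \<open>T\<close> turns a multilinear map for \<open>P\<close> into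
  one for \<open>Q\<close>, without polarization; \<open>Q\<close> is bounded by \<open>1\<close> on the ball, and a polynomial bounded on the
  ball is continuous. For (iii), \<open>T\<close> is factored further through \<open>\<ell>\<^sub>1\<close> by moving a null sequence
  \<open>\<beta>\<close> with \<open>(y\<^sub>n / \<beta>\<^sub>n)\<close> still in \<open>\<ell>\<^sub>p(F)\<close>, of nearly the same norm, from one factor to the other.
\<close>

section \<open>Normed spaces on carriers\<close>

text \<open>Neither infimum need be attained, so each formula is proved as a bound for every
  factorization together with factorizations within any \<open>e\<close> > 0. The bounds come from
  comparing images of unit balls; the loss in the near-optimal factorizations is confined to the
  choice of \<open>y\<close> and of the weights \<beta>.

  Three obstacles shape the rest. The quotient norm is an infimum, so a unit ball downstairs need
  not be the image of the one upstairs; only a closure is obtained, and \<kappa> does not grow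
  because p-co is closed. Finally, \<open>S\<close> in (iii) comes from \<theta> of a null sequence
  on \<open>\<ell>\<^sub>1\<close>, that is from the exponents \<infinity> and 1, where tails vanish
  because of the sequence and not because of the exponent.\<close>

lemma complex_ring_simps [simp]:
  "carrier complex_ring = UNIV" "\<one>\<^bsub>complex_ring\<^esub> = 1" "\<zero>\<^bsub>complex_ring\<^esub> = 0"
  "a \<oplus>\<^bsub>complex_ring\<^esub> b = a + b" "a \<otimes>\<^bsub>complex_ring\<^esub> b = a * b"
  by (simp_all add: ring_of_type_algebra_def)

lemma submodule_complexD:
  assumes "submodule M complex_ring V" and "module complex_ring V"
  shows "M \<subseteq> carrier V" "\<zero>\<^bsub>V\<^esub> \<in> M"
    "\<And>a b. \<lbrakk>a \<in> M; b \<in> M\<rbrakk> \<Longrightarrow> a \<oplus>\<^bsub>V\<^esub> b \<in> M"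
    "\<And>c a. a \<in> M \<Longrightarrow> c \<odot>\<^bsub>V\<^esub> a \<in> M"
    "\<And>a. a \<in> M \<Longrightarrow> \<ominus>\<^bsub>V\<^esub> a \<in> M"
  using module.submoduleE[OF assms(2,1)] subgroup.one_closed[OF submodule.axioms(1)[OF assms(1)]]
  by auto

context complex_normed_space
begin

sublocale ntop: Metric_space "carrier V" "ndist V"
  by (rule Metric_space_ndist)

lemma ntop_eq: "ntop V = ntop.mtopology"
  by (simp add: ntop_def)

lemma topspace_ntop [simp]: "topspace (ntop V) = carrier V"
  by (simp add: ntop_eq)

lemma smult_add_left: "x \<in> carrier V \<Longrightarrow> (a + b) \<odot>\<^bsub>V\<^esub> x = a \<odot>\<^bsub>V\<^esub> x \<oplus>\<^bsub>V\<^esub> b \<odot>\<^bsub>V\<^esub> x"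
  using smult_l_distr[of a b x] by simp

lemma smult_add_right:
  "\<lbrakk>x \<in> carrier V; y \<in> carrier V\<rbrakk> \<Longrightarrow> c \<odot>\<^bsub>V\<^esub> (x \<oplus>\<^bsub>V\<^esub> y) = c \<odot>\<^bsub>V\<^esub> x \<oplus>\<^bsub>V\<^esub> c \<odot>\<^bsub>V\<^esub> y"
  using smult_r_distr[of c x y] by simp

lemma smult_smult [simp]: "x \<in> carrier V \<Longrightarrow> a \<odot>\<^bsub>V\<^esub> (b \<odot>\<^bsub>V\<^esub> x) = (a * b) \<odot>\<^bsub>V\<^esub> x"
  using smult_assoc1[of a b x] by simp

lemma smult_1 [simp]: "x \<in> carrier V \<Longrightarrow> 1 \<odot>\<^bsub>V\<^esub> x = x"
  using smult_one[of x] by simp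

lemma smult_0 [simp]: "x \<in> carrier V \<Longrightarrow> 0 \<odot>\<^bsub>V\<^esub> x = \<zero>\<^bsub>V\<^esub>"
  using smult_l_null[of x] by simp

lemma smult_zero [simp]: "c \<odot>\<^bsub>V\<^esub> \<zero>\<^bsub>V\<^esub> = \<zero>\<^bsub>V\<^esub>"
  using smult_r_null[of c] by simp

lemma smult_in [simp, intro]: "x \<in> carrier V \<Longrightarrow> c \<odot>\<^bsub>V\<^esub> x \<in> carrier V"
  by (simp add: smult_closed)

lemma uminus_eq: "x \<in> carrier V \<Longrightarrow> \<ominus>\<^bsub>V\<^esub> x = (-1) \<odot>\<^bsub>V\<^esub> x"
  using smult_add_left[of x "-1" 1] by (intro M.minus_equality) auto

lemma minus_eq: "\<lbrakk>x \<in> carrier V; y \<in> carrier V\<rbrakk> \<Longrightarrow> x \<ominus>\<^bsub>V\<^esub> y = x \<oplus>\<^bsub>V\<^esub> (-1) \<odot>\<^bsub>V\<^esub> y"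
  by (simp add: a_minus_def uminus_eq)

lemma vnorm_zero [simp]: "vnorm V \<zero>\<^bsub>V\<^esub> = 0"
  by (simp add: vnorm_eq_0_iff)

lemma vnorm_uminus [simp]: "x \<in> carrier V \<Longrightarrow> vnorm V (\<ominus>\<^bsub>V\<^esub> x) = vnorm V x"
  by (simp add: uminus_eq vnorm_smult)

lemma minus_in [simp, intro]: "\<lbrakk>x \<in> carrier V; y \<in> carrier V\<rbrakk> \<Longrightarrow> x \<ominus>\<^bsub>V\<^esub> y \<in> carrier V"
  by (simp add: a_minus_def)

lemma vnorm_triangle_minus:
  "\<lbrakk>x \<in> carrier V; y \<in> carrier V\<rbrakk> \<Longrightarrow> vnorm V (x \<ominus>\<^bsub>V\<^esub> y) \<le> vnorm V x + vnorm V y"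
  using vnorm_triangle[of x "\<ominus>\<^bsub>V\<^esub> y"] by (simp add: a_minus_def)

lemma ndist_eq: "\<lbrakk>x \<in> carrier V; y \<in> carrier V\<rbrakk> \<Longrightarrow> ndist V x y = vnorm V (x \<ominus>\<^bsub>V\<^esub> y)"
  by (simp add: ndist_def)

lemma vnorm_minus_commute:
  "\<lbrakk>x \<in> carrier V; y \<in> carrier V\<rbrakk> \<Longrightarrow> vnorm V (x \<ominus>\<^bsub>V\<^esub> y) = vnorm V (y \<ominus>\<^bsub>V\<^esub> x)"
  using ntop.commute[of x y] by (simp add: ndist_eq)

lemma minus_eq_zero_iff: "\<lbrakk>x \<in> carrier V; y \<in> carrier V\<rbrakk> \<Longrightarrow> x \<ominus>\<^bsub>V\<^esub> y = \<zero>\<^bsub>V\<^esub> \<longleftrightarrow> x = y"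
  using ntop.zero[of x y] by (simp add: ndist_eq vnorm_eq_0_iff)

lemma minus_zero [simp]: "x \<in> carrier V \<Longrightarrow> x \<ominus>\<^bsub>V\<^esub> \<zero>\<^bsub>V\<^esub> = x"
  by (simp add: minus_eq)

lemma add_minus_cancel [simp]: "\<lbrakk>x \<in> carrier V; y \<in> carrier V\<rbrakk> \<Longrightarrow> x \<oplus>\<^bsub>V\<^esub> (y \<ominus>\<^bsub>V\<^esub> x) = y"
  by (simp add: a_minus_def M.a_lcomm[of x y] M.r_neg)

lemma minus_add_cancel [simp]: "\<lbrakk>x \<in> carrier V; y \<in> carrier V\<rbrakk> \<Longrightarrow> (x \<oplus>\<^bsub>V\<^esub> y) \<ominus>\<^bsub>V\<^esub> x = y"
  by (simp add: a_minus_def M.a_comm[of x y] M.a_assoc M.r_neg)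

lemma add_minus_add:
  assumes "a \<in> carrier V" "b \<in> carrier V" "c \<in> carrier V" "d \<in> carrier V"
  shows "(a \<oplus>\<^bsub>V\<^esub> b) \<ominus>\<^bsub>V\<^esub> (c \<oplus>\<^bsub>V\<^esub> d) = (a \<ominus>\<^bsub>V\<^esub> c) \<oplus>\<^bsub>V\<^esub> (b \<ominus>\<^bsub>V\<^esub> d)"
  using assms by (simp add: minus_eq smult_add_right M.a_ac)

lemma minus_minus_cancel:
  assumes "a \<in> carrier V" "b \<in> carrier V" "c \<in> carrier V"
  shows "(a \<ominus>\<^bsub>V\<^esub> b) \<ominus>\<^bsub>V\<^esub> (c \<ominus>\<^bsub>V\<^esub> b) = a \<ominus>\<^bsub>V\<^esub> c"
  using add_minus_add[of a "\<ominus>\<^bsub>V\<^esub> b" c "\<ominus>\<^bsub>V\<^esub> b"] assms minus_eq_zero_iff[of "\<ominus>\<^bsub>V\<^esub> b" "\<ominus>\<^bsub>V\<^esub> b"]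
  by (simp add: a_minus_def)

lemma smult_minus:
  "\<lbrakk>x \<in> carrier V; y \<in> carrier V\<rbrakk> \<Longrightarrow> c \<odot>\<^bsub>V\<^esub> (x \<ominus>\<^bsub>V\<^esub> y) = c \<odot>\<^bsub>V\<^esub> x \<ominus>\<^bsub>V\<^esub> c \<odot>\<^bsub>V\<^esub> y"
  by (simp add: minus_eq smult_add_right)

lemma uball_iff: "x \<in> uball V \<longleftrightarrow> x \<in> carrier V \<and> vnorm V x \<le> 1"
  by (simp add: uball_def)

lemma zero_in_uball [simp]: "\<zero>\<^bsub>V\<^esub> \<in> uball V"
  by (simp add: uball_iff)

text \<open>For \<open>c = 0\<close> the witness is \<open>0\<close>, since \<open>inverse 0 = 0\<close>.\<close>

lemma scaled_uball:
  assumes "x \<in> carrier V" "vnorm V x \<le> c"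
  obtains u where "u \<in> uball V" "x = complex_of_real c \<odot>\<^bsub>V\<^esub> u"
proof
  have c: "0 \<le> c"
    using assms vnorm_nonneg[of x] by linarith
  show "complex_of_real (inverse c) \<odot>\<^bsub>V\<^esub> x \<in> uball V"
    using assms c by (auto simp: uball_iff vnorm_smult norm_inverse norm_divide divide_simps)
  show "x = complex_of_real c \<odot>\<^bsub>V\<^esub> (complex_of_real (inverse c) \<odot>\<^bsub>V\<^esub> x)"
    using assms c vnorm_nonneg[of x] vnorm_eq_0_iff[of x]
    by (cases "c = 0") (simp_all flip: of_real_mult)
qed

lemma limitin_ntop_iff:
  assumes "\<And>n. f n \<in> carrier V"
  shows "limitin (ntop V) f l sequentially \<longleftrightarrow>
    l \<in> carrier V \<and> (\<lambda>n. vnorm V (f n \<ominus>\<^bsub>V\<^esub> l)) \<longlonglongrightarrow> 0"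
  using assms by (auto simp: ntop_eq ntop.limitin_metric_dist_null ndist_eq)

lemma limitin_ntopI:
  assumes "\<And>n. f n \<in> carrier V" "l \<in> carrier V"
    and "\<And>n. vnorm V (f n \<ominus>\<^bsub>V\<^esub> l) \<le> g n" "g \<longlonglongrightarrow> 0"
  shows "limitin (ntop V) f l sequentially"
  unfolding limitin_ntop_iff[OF assms(1)]
  using assms by (auto intro!: tendsto_sandwich[OF _ _ tendsto_const assms(4)] simp: vnorm_nonneg)

lemma limitin_ntop_unique:
  "\<lbrakk>limitin (ntop V) f l sequentially; limitin (ntop V) f l' sequentially\<rbrakk> \<Longrightarrow> l = l'"
  using ntop.limitin_metric_unique[OF _ _ trivial_limit_sequentially] by (simp add: ntop_eq)

lemma limitin_ntop_add:
  assumes "\<And>n. f n \<in> carrier V" "\<And>n. g n \<in> carrier V"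
    and "limitin (ntop V) f l sequentially" "limitin (ntop V) g k sequentially"
  shows "limitin (ntop V) (\<lambda>n. f n \<oplus>\<^bsub>V\<^esub> g n) (l \<oplus>\<^bsub>V\<^esub> k) sequentially"
proof (rule limitin_ntopI)
  have lk: "l \<in> carrier V" "k \<in> carrier V"
    using assms by (auto simp: limitin_ntop_iff)
  show "vnorm V ((f n \<oplus>\<^bsub>V\<^esub> g n) \<ominus>\<^bsub>V\<^esub> (l \<oplus>\<^bsub>V\<^esub> k)) \<le> vnorm V (f n \<ominus>\<^bsub>V\<^esub> l) + vnorm V (g n \<ominus>\<^bsub>V\<^esub> k)" for n
    using assms(1,2) lk by (simp add: add_minus_add vnorm_triangle)
  show "(\<lambda>n. vnorm V (f n \<ominus>\<^bsub>V\<^esub> l) + vnorm V (g n \<ominus>\<^bsub>V\<^esub> k)) \<longlonglongrightarrow> 0"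
    using assms tendsto_add[of _ 0 sequentially _ 0] by (auto simp: limitin_ntop_iff)
qed (use assms in \<open>auto simp: limitin_ntop_iff\<close>)

lemma limitin_ntop_smult:
  assumes "\<And>n. f n \<in> carrier V" and "limitin (ntop V) f l sequentially"
  shows "limitin (ntop V) (\<lambda>n. c \<odot>\<^bsub>V\<^esub> f n) (c \<odot>\<^bsub>V\<^esub> l) sequentially"
proof (rule limitin_ntopI)
  have l: "l \<in> carrier V"
    using assms by (auto simp: limitin_ntop_iff)
  show "vnorm V (c \<odot>\<^bsub>V\<^esub> f n \<ominus>\<^bsub>V\<^esub> c \<odot>\<^bsub>V\<^esub> l) \<le> cmod c * vnorm V (f n \<ominus>\<^bsub>V\<^esub> l)" for n
    using assms(1) l by (simp add: smult_minus[symmetric] vnorm_smult)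
  show "(\<lambda>n. cmod c * vnorm V (f n \<ominus>\<^bsub>V\<^esub> l)) \<longlonglongrightarrow> 0"
    using assms by (auto simp: limitin_ntop_iff intro!: tendsto_mult_right_zero)
qed (use assms in \<open>auto simp: limitin_ntop_iff\<close>)

lemma nsuminf_eqI:
  "limitin (ntop V) (\<lambda>N. finsum V f {..<N}) s sequentially \<Longrightarrow> nsuminf V f = s"
  unfolding nsuminf_def using limitin_ntop_unique by blast

lemma in_closure_iff:
  assumes "S \<subseteq> carrier V"
  shows "x \<in> ntop V closure_of S \<longleftrightarrow> x \<in> carrier V \<and> (\<forall>r>0. \<exists>s\<in>S. vnorm V (x \<ominus>\<^bsub>V\<^esub> s) < r)"
proof -
  have "x \<in> ntop V closure_of S \<longleftrightarrow> x \<in> carrier V \<and> (\<forall>r>0. \<exists>s\<in>S. s \<in> ntop.mball x r)"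
    by (auto simp: ntop_eq ntop.metric_closure_of)
  also have "\<dots> \<longleftrightarrow> x \<in> carrier V \<and> (\<forall>r>0. \<exists>s\<in>S. vnorm V (x \<ominus>\<^bsub>V\<^esub> s) < r)"
    using assms ndist_eq[of x] by (fastforce simp: ntop.in_mball)
  finally show ?thesis .
qed

lemma finsum_lessThan_Suc:
  fixes f :: "nat \<Rightarrow> 'a"
  assumes "\<And>n. f n \<in> carrier V"
  shows "finsum V f {..<Suc n} = finsum V f {..<n} \<oplus>\<^bsub>V\<^esub> f n"
  using assms by (simp add: lessThan_Suc Pi_def M.a_comm)

lemma finsum_in: "(\<And>n. f n \<in> carrier V) \<Longrightarrow> finsum V f A \<in> carrier V"
  by (rule M.finsum_closed) auto

lemma finsum_lessThan_minus:
  fixes f :: "nat \<Rightarrow> 'a"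
  assumes "\<And>n. f n \<in> carrier V"
  shows "finsum V (\<lambda>n. f (n + k)) {..<n} = finsum V f {..<n + k} \<ominus>\<^bsub>V\<^esub> finsum V f {..<k}"
proof (induction n)
  case 0
  show ?case
    using assms by (simp add: finsum_in minus_eq_zero_iff[THEN iffD2])
next
  case (Suc n)
  have "finsum V (\<lambda>n. f (n + k)) {..<Suc n} =
      (finsum V f {..<n + k} \<ominus>\<^bsub>V\<^esub> finsum V f {..<k}) \<oplus>\<^bsub>V\<^esub> f (n + k)"
    using assms by (simp add: finsum_lessThan_Suc Suc)
  also have "\<dots> = finsum V f {..<Suc n + k} \<ominus>\<^bsub>V\<^esub> finsum V f {..<k}"
    using assms by (simp add: finsum_lessThan_Suc finsum_in minus_eq M.a_ac)
  finally show ?case .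
qed

lemma vnorm_finsum_le:
  fixes f :: "nat \<Rightarrow> 'a"
  assumes "\<And>n. f n \<in> carrier V"
  shows "vnorm V (finsum V f {..<n}) \<le> (\<Sum>i<n. vnorm V (f i))"
proof (induction n)
  case (Suc n)
  then show ?case
    using assms vnorm_triangle[of "finsum V f {..<n}" "f n"]
    by (simp add: finsum_lessThan_Suc finsum_in)
qed simp

lemma finsum_lessThan_add:
  fixes N :: nat
  assumes "\<And>n. f n \<in> carrier V" "\<And>n. g n \<in> carrier V"
  shows "finsum V (\<lambda>n. f n \<oplus>\<^bsub>V\<^esub> g n) {..<N} = finsum V f {..<N} \<oplus>\<^bsub>V\<^esub> finsum V g {..<N}"
  using assms by (intro M.finsum_addf) auto

lemma finsum_lessThan_smult:
  fixes N :: nat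
  assumes "\<And>n. f n \<in> carrier V"
  shows "finsum V (\<lambda>n. c \<odot>\<^bsub>V\<^esub> f n) {..<N} = c \<odot>\<^bsub>V\<^esub> finsum V f {..<N}"
  using assms by (subst finsum_smult_ldistr) auto

lemma vnorm_limit_le:
  assumes "\<And>n. f n \<in> carrier V" "limitin (ntop V) f l sequentially"
    and "\<And>n. n \<ge> N \<Longrightarrow> vnorm V (f n) \<le> C"
  shows "vnorm V l \<le> C"
proof -
  have l: "l \<in> carrier V" and lim: "(\<lambda>n. vnorm V (f n \<ominus>\<^bsub>V\<^esub> l)) \<longlonglongrightarrow> 0"
    using assms by (auto simp: limitin_ntop_iff)
  have "vnorm V l \<le> C + vnorm V (f n \<ominus>\<^bsub>V\<^esub> l)" if "n \<ge> N" for n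
    using vnorm_triangle[of "f n" "l \<ominus>\<^bsub>V\<^esub> f n"] assms(1)[of n] assms(3)[OF that] l
    by (simp add: vnorm_minus_commute)
  moreover have "(\<lambda>n. C + vnorm V (f n \<ominus>\<^bsub>V\<^esub> l)) \<longlonglongrightarrow> C + 0"
    by (intro tendsto_intros lim)
  ultimately show ?thesis
    by (intro LIMSEQ_le_const[of _ C "vnorm V l"]) auto
qed

end

text \<open>Completeness in the form that passes to quotients without effort.\<close>

definition abs_complete :: "'a cnspace \<Rightarrow> bool" where
  "abs_complete V \<longleftrightarrow> (\<forall>f. (\<forall>n. f n \<in> carrier V) \<and> summable (\<lambda>n. vnorm V (f n)) \<longrightarrow>
     (\<exists>s. limitin (ntop V) (\<lambda>N. finsum V f {..<N}) s sequentially))"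

lemma (in complex_banach_space) abs_complete: "abs_complete V"
  unfolding abs_complete_def
proof (intro allI impI, elim conjE)
  fix f assume f: "\<forall>n. f n \<in> carrier V" and sm: "summable (\<lambda>n. vnorm V (f n))"
  let ?S = "\<lambda>N. finsum V f {..<N}"
  have S: "?S n \<in> carrier V" for n
    using f by (simp add: finsum_in)
  have d: "ndist V (?S m) (?S n) \<le> (\<Sum>i\<in>{n..<m}. vnorm V (f i))" if "n \<le> m" for m n
  proof -
    have "ndist V (?S m) (?S n) = vnorm V (finsum V (\<lambda>i. f (i + n)) {..<m - n})"
      using f that by (simp add: ndist_eq S finsum_lessThan_minus)
    also have "\<dots> \<le> (\<Sum>i<m - n. vnorm V (f (i + n)))"
      using f by (simp add: vnorm_finsum_le)
    also have "\<dots> = (\<Sum>i\<in>{n..<m}. vnorm V (f i))"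
      using sum.shift_bounds_nat_ivl[of "\<lambda>i. vnorm V (f i)" 0 n "m - n"] that
      by (simp add: atLeast0LessThan)
    finally show ?thesis .
  qed
  have "ntop.MCauchy ?S"
    unfolding ntop.MCauchy_def
  proof (intro conjI allI impI)
    show "range ?S \<subseteq> carrier V"
      using S by auto
    fix e :: real assume "e > 0"
    then obtain N where N: "\<And>m n. m \<ge> N \<Longrightarrow> norm (\<Sum>i\<in>{m..<n}. vnorm V (f i)) < e"
      using sm unfolding summable_Cauchy by blast
    have "ndist V (?S m) (?S n) < e" if "n \<ge> N" "m \<ge> n" for m n
      using d[OF that(2)] N[of n m] that(1) by simp
    then show "\<exists>N. \<forall>n n'. N \<le> n \<longrightarrow> N \<le> n' \<longrightarrow> ndist V (?S n) (?S n') < e"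
      using ntop.commute by (metis linorder_le_cases)
  qed
  then show "\<exists>s. limitin (ntop V) ?S s sequentially"
    using complete unfolding ntop.mcomplete_def ntop_eq by blast
qed

lemma (in complex_normed_space) nsuminf_limit:
  assumes "abs_complete V" "\<And>n. f n \<in> carrier V" "summable (\<lambda>n. vnorm V (f n))"
  shows "limitin (ntop V) (\<lambda>N. finsum V f {..<N}) (nsuminf V f) sequentially"
  using assms nsuminf_eqI unfolding abs_complete_def by metis

lemma (in complex_normed_space) nsuminf_in:
  assumes "abs_complete V" "\<And>n. f n \<in> carrier V" "summable (\<lambda>n. vnorm V (f n))"
  shows "nsuminf V f \<in> carrier V"
  using nsuminf_limit[OF assms] limitin_topspace by fastforce

text \<open>Blocks of terms past \<open>N\<close> are bounded by the tail of the norm series, and a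
  norm bound survives the limit. For \<theta> this is the source of error bounds that are uniform
  over the ball of \<open>Lq\<close>.\<close>

lemma (in complex_normed_space) nsuminf_tail_le:
  assumes "abs_complete V" "\<And>n. f n \<in> carrier V" "summable (\<lambda>n. vnorm V (f n))"
  shows "vnorm V (nsuminf V f \<ominus>\<^bsub>V\<^esub> finsum V f {..<N}) \<le> (\<Sum>n. vnorm V (f (n + N)))"
proof -
  have S: "finsum V f A \<in> carrier V" for A
    using assms(2) by (rule finsum_in)
  note s = nsuminf_in[OF assms]
  have s2: "summable (\<lambda>n. vnorm V (f (n + N)))"
    using assms(3) by (simp add: summable_iff_shift[of "\<lambda>n. vnorm V (f n)"])
  have bd: "vnorm V (finsum V f {..<n + N} \<ominus>\<^bsub>V\<^esub> finsum V f {..<N}) \<le> (\<Sum>n. vnorm V (f (n + N)))" for n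
  proof -
    have "vnorm V (finsum V f {..<n + N} \<ominus>\<^bsub>V\<^esub> finsum V f {..<N}) \<le> (\<Sum>i<n. vnorm V (f (i + N)))"
      unfolding finsum_lessThan_minus[of f, OF assms(2), symmetric] using assms(2) by (rule vnorm_finsum_le)
    also have "\<dots> \<le> (\<Sum>n. vnorm V (f (n + N)))"
      using s2 assms(2) by (intro sum_le_suminf) (auto simp: vnorm_nonneg)
    finally show ?thesis .
  qed
  have lim: "limitin (ntop V) (\<lambda>n. finsum V f {..<n} \<ominus>\<^bsub>V\<^esub> finsum V f {..<N})
      (nsuminf V f \<ominus>\<^bsub>V\<^esub> finsum V f {..<N}) sequentially"
  proof (rule limitin_ntopI)
    show "vnorm V ((finsum V f {..<n} \<ominus>\<^bsub>V\<^esub> finsum V f {..<N}) \<ominus>\<^bsub>V\<^esub> (nsuminf V f \<ominus>\<^bsub>V\<^esub> finsum V f {..<N}))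
        \<le> vnorm V (finsum V f {..<n} \<ominus>\<^bsub>V\<^esub> nsuminf V f)" for n
      using S s by (simp add: minus_minus_cancel)
    show "(\<lambda>n. vnorm V (finsum V f {..<n} \<ominus>\<^bsub>V\<^esub> nsuminf V f)) \<longlonglongrightarrow> 0"
      using nsuminf_limit[OF assms] by (simp add: limitin_ntop_iff S)
  qed (use S s in auto)
  show ?thesis
  proof (rule vnorm_limit_le[OF _ lim])
    show "vnorm V (finsum V f {..<n} \<ominus>\<^bsub>V\<^esub> finsum V f {..<N}) \<le> (\<Sum>n. vnorm V (f (n + N)))" if "n \<ge> N" for n
      using bd[of "n - N"] that by simp
  qed (use S in auto)
qed

lemma (in complex_normed_space) vnorm_nsuminf_le:
  assumes "abs_complete V" "\<And>n. f n \<in> carrier V" "summable (\<lambda>n. vnorm V (f n))"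
  shows "vnorm V (nsuminf V f) \<le> (\<Sum>n. vnorm V (f n))"
  using nsuminf_tail_le[OF assms, of 0] nsuminf_in[OF assms] by simp

section \<open>The scalar spaces \<open>\<ell>\<^sub>r\<close>\<close>

text \<open>Membership in \<open>ell r V\<close> and its norm depend only on the real sequence of
  the norms of the terms. Isolating that sequence lets one set of inequalities serve scalar and
  vector-valued sequences alike.\<close>

definition lr_mem :: "ennreal \<Rightarrow> (nat \<Rightarrow> real) \<Rightarrow> bool" where
  "lr_mem r a \<longleftrightarrow> (if r = \<infinity> then bdd_above (range a) else summable (\<lambda>n. a n powr enn2real r))"

definition lr_norm :: "ennreal \<Rightarrow> (nat \<Rightarrow> real) \<Rightarrow> real" where
  "lr_norm r a = (if r = \<infinity> then (SUP n. a n) else (\<Sum>n. a n powr enn2real r) powr (1 / enn2real r))"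

lemma enn2real_ge_1: "1 \<le> r \<Longrightarrow> r \<noteq> \<infinity> \<Longrightarrow> 1 \<le> enn2real r"
  by (cases r) (auto simp: ennreal_ge_1)

lemma lr_norm_nonneg:
  assumes "\<And>n. 0 \<le> a n" "lr_mem r a"
  shows "0 \<le> lr_norm r a"
proof (cases "r = \<infinity>")
  case True
  then show ?thesis
    using assms cSUP_upper2[of a UNIV 0 0] by (auto simp: lr_mem_def lr_norm_def)
qed (simp add: lr_norm_def)

text \<open>A bound on every partial sum encodes convergence and the norm estimate at once.
  Estimates for \<open>lr_norm\<close> can then be carried out on finite sums, where limits of
  coordinates are harmless.\<close>

lemma lr_ball_iff:
  assumes "1 \<le> r" "\<And>n. 0 \<le> a n" "0 \<le> C"
  shows "lr_mem r a \<and> lr_norm r a \<le> C \<longleftrightarrow>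
    (if r = \<infinity> then \<forall>n. a n \<le> C else \<forall>N. (\<Sum>n<N. a n powr enn2real r) \<le> C powr enn2real r)"
proof (cases "r = \<infinity>")
  case True
  then show ?thesis
    by (auto simp: lr_mem_def lr_norm_def intro: cSUP_least order_trans[OF cSUP_upper])
next
  case False
  define s where "s = enn2real r"
  have s: "s \<ge> 1"
    using enn2real_ge_1 assms(1) False by (simp add: s_def)
  have nn: "0 \<le> (\<Sum>n. a n powr s)" if "summable (\<lambda>n. a n powr s)"
    using that by (intro suminf_nonneg) auto
  have eq: "(\<Sum>n. a n powr s) powr (1 / s) \<le> C \<longleftrightarrow> (\<Sum>n. a n powr s) \<le> C powr s"
    if "summable (\<lambda>n. a n powr s)"
  proof
    assume "(\<Sum>n. a n powr s) powr (1 / s) \<le> C"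
    then have "((\<Sum>n. a n powr s) powr (1 / s)) powr s \<le> C powr s"
      using s by (intro powr_mono2) auto
    then show "(\<Sum>n. a n powr s) \<le> C powr s"
      using nn[OF that] s by (simp add: powr_powr)
  next
    assume "(\<Sum>n. a n powr s) \<le> C powr s"
    then have "(\<Sum>n. a n powr s) powr (1 / s) \<le> (C powr s) powr (1 / s)"
      using nn[OF that] s by (intro powr_mono2) auto
    then show "(\<Sum>n. a n powr s) powr (1 / s) \<le> C"
      using assms(3) s by (simp add: powr_powr)
  qed
  have "summable (\<lambda>n. a n powr s) \<and> (\<Sum>n. a n powr s) \<le> C powr s \<longleftrightarrow> (\<forall>N. (\<Sum>n<N. a n powr s) \<le> C powr s)"
  proof (intro iffI conjI allI)
    fix N
    assume "summable (\<lambda>n. a n powr s) \<and> (\<Sum>n. a n powr s) \<le> C powr s"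
    then show "(\<Sum>n<N. a n powr s) \<le> C powr s"
      using sum_le_suminf[of "\<lambda>n. a n powr s" "{..<N}"] by fastforce
  next
    assume *: "\<forall>N. (\<Sum>n<N. a n powr s) \<le> C powr s"
    then show sm: "summable (\<lambda>n. a n powr s)"
      by (intro summableI_nonneg_bounded) auto
    show "(\<Sum>n. a n powr s) \<le> C powr s"
      using * sm by (intro suminf_le_const) auto
  qed
  then show ?thesis
    using False eq by (auto simp: lr_mem_def lr_norm_def s_def)
qed

lemma lr_ballD:
  assumes "1 \<le> r" "\<And>n. 0 \<le> a n" "lr_mem r a"
  shows "if r = \<infinity> then \<forall>n. a n \<le> lr_norm r a
    else \<forall>N. (\<Sum>n<N. a n powr enn2real r) \<le> lr_norm r a powr enn2real r"
  using lr_ball_iff[of r a "lr_norm r a"] assms lr_norm_nonneg[of a r] by simp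

lemma lr_coord_le:
  assumes "1 \<le> r" "\<And>n. 0 \<le> a n" "lr_mem r a"
  shows "a n \<le> lr_norm r a"
proof (cases "r = \<infinity>")
  case True
  then show ?thesis
    using lr_ballD[OF assms] by simp
next
  case False
  have "a n powr enn2real r \<le> (\<Sum>i<Suc n. a i powr enn2real r)"
    by (simp add: sum_nonneg)
  also have "\<dots> \<le> lr_norm r a powr enn2real r"
    using lr_ballD[OF assms] False by (simp del: sum.lessThan_Suc)
  finally show ?thesis
    using enn2real_ge_1[OF assms(1) False] lr_norm_nonneg[OF assms(2,3)] assms(2)[of n]
    by (metis linorder_not_le order_less_le_trans powr_less_mono2 zero_less_one)
qed

lemma lr_mono:
  assumes "1 \<le> r" "\<And>n. 0 \<le> a n" "\<And>n. a n \<le> b n" "lr_mem r b"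
  shows "lr_mem r a \<and> lr_norm r a \<le> lr_norm r b"
proof -
  have b: "0 \<le> b n" for n
    using assms(2,3)[of n] by simp
  show ?thesis
  proof (cases "r = \<infinity>")
    case True
    then show ?thesis
      using lr_ballD[OF assms(1) b assms(4)] lr_ball_iff[OF assms(1,2) lr_norm_nonneg[OF b assms(4)]]
      by (auto intro: order_trans[OF assms(3)])
  next
    case False
    have "(\<Sum>n<N. a n powr enn2real r) \<le> lr_norm r b powr enn2real r" for N
    proof -
      have "(\<Sum>n<N. a n powr enn2real r) \<le> (\<Sum>n<N. b n powr enn2real r)"
        using assms by (intro sum_mono powr_mono2) auto
      then show ?thesis
        using lr_ballD[OF assms(1) b assms(4)] False by (auto intro: order_trans)
    qed
    then show ?thesis
      using lr_ball_iff[OF assms(1,2) lr_norm_nonneg[OF b assms(4)]] False by simp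
  qed
qed

lemma lr_zero: "1 \<le> r \<Longrightarrow> lr_mem r (\<lambda>n. 0) \<and> lr_norm r (\<lambda>n. 0) = 0"
  by (auto simp: lr_mem_def lr_norm_def)

lemma lr_scale:
  assumes "1 \<le> r" "\<And>n. 0 \<le> a n" "lr_mem r a" "0 \<le> c"
  shows "lr_mem r (\<lambda>n. c * a n) \<and> lr_norm r (\<lambda>n. c * a n) = c * lr_norm r a"
proof -
  have *: "lr_mem r (\<lambda>n. c * a n) \<and> lr_norm r (\<lambda>n. c * a n) \<le> c * lr_norm r a"
    if "\<And>n. 0 \<le> a n" "lr_mem r a" "0 \<le> c" for a c
  proof -
    have "if r = \<infinity> then \<forall>n. c * a n \<le> c * lr_norm r a
      else \<forall>N. (\<Sum>n<N. (c * a n) powr enn2real r) \<le> (c * lr_norm r a) powr enn2real r"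
      using lr_ballD[OF assms(1) that(1,2)] that lr_norm_nonneg[OF that(1,2)]
      by (auto simp: powr_mult sum_distrib_left[symmetric] intro!: mult_left_mono split: if_splits)
    then show ?thesis
      using that lr_norm_nonneg[OF that(1,2)] assms(1) by (subst lr_ball_iff) auto
  qed
  show ?thesis
  proof (cases "c = 0")
    case True
    then show ?thesis
      using lr_zero[OF assms(1)] by simp
  next
    case False
    \<comment> \<open>The converse inequality is the bound just proved, used for the scaled sequence
      and the factor \<open>inverse c\<close>.\<close>
    have "lr_norm r (\<lambda>n. inverse c * (c * a n)) \<le> inverse c * lr_norm r (\<lambda>n. c * a n)"
      using *[of "\<lambda>n. c * a n" "inverse c"] *[OF assms(2-4)] assms by auto
    then have "c * lr_norm r a \<le> lr_norm r (\<lambda>n. c * a n)"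
      using False assms(4) by (simp add: field_simps)
    then show ?thesis
      using *[OF assms(2-4)] by auto
  qed
qed

text \<open>For positive \<open>x\<close> and \<open>y\<close> this is convexity on the open
  half-line. If one of them is 0, it reduces to \<open>u powr s \<le> u\<close> for \<open>u\<close>
  in the unit interval.\<close>

lemma powr_convex_nonneg:
  fixes s x y t :: real
  assumes "1 \<le> s" "0 \<le> x" "0 \<le> y" "0 \<le> t" "t \<le> 1"
  shows "(t * x + (1 - t) * y) powr s \<le> t * x powr s + (1 - t) * y powr s"
proof -
  have scale: "(u * z) powr s \<le> u * z powr s" if "0 \<le> u" "u \<le> 1" "0 \<le> z" for u z :: real
  proof -
    have "u powr s \<le> u"
      using powr_mono'[of 1 s u] that assms(1) by simp
    then show ?thesis
      using that by (simp add: powr_mult mult_right_mono)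
  qed
  show ?thesis
  proof (cases "x = 0 \<or> y = 0")
    case True
    then show ?thesis
      using scale[of t x] scale[of "1 - t" y] assms by auto
  next
    case False
    then show ?thesis
      using convex_onD[OF powr_convex[OF assms(1)], of t y x] assms by (simp add: algebra_simps)
  qed
qed

text \<open>Minkowski's inequality by convexity: \<open>a n + b n\<close> is \<open>A + B\<close>
  times the average of \<open>a n / A\<close> and \<open>b n / B\<close> with weights
  \<open>A / (A + B)\<close> and \<open>B / (A + B)\<close>. After taking powers and summing, what
  remains is \<open>t + (1 - t) = 1\<close>.\<close>

lemma lr_add:
  assumes "1 \<le> r" "\<And>n. 0 \<le> a n" "lr_mem r a" "\<And>n. 0 \<le> b n" "lr_mem r b"
  shows "lr_mem r (\<lambda>n. a n + b n) \<and> lr_norm r (\<lambda>n. a n + b n) \<le> lr_norm r a + lr_norm r b"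
proof -
  define A where "A = lr_norm r a"
  define B where "B = lr_norm r b"
  define s where "s = enn2real r"
  note aD = lr_ballD[OF assms(1-3), folded A_def s_def] and bD = lr_ballD[OF assms(1,4,5), folded B_def s_def]
  have A0: "0 \<le> A" and B0: "0 \<le> B"
    using lr_norm_nonneg assms by (auto simp: A_def B_def)
  have "\<forall>N. (\<Sum>n<N. (a n + b n) powr s) \<le> (A + B) powr s" if r: "r \<noteq> \<infinity>"
  proof
    fix N
    have s: "s \<ge> 1"
      using enn2real_ge_1 assms(1) r by (simp add: s_def)
    \<comment> \<open>The normalisation divides by \<open>A\<close> and \<open>B\<close>, so
      vanishing norms are set aside; they force the whole sequence to vanish.\<close>
    have az: "a n = 0" if "A = 0" for n
      using lr_coord_le[OF assms(1-3), of n] assms(2)[of n] that by (simp add: A_def)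
    have bz: "b n = 0" if "B = 0" for n
      using lr_coord_le[OF assms(1,4,5), of n] assms(4)[of n] that by (simp add: B_def)
    show "(\<Sum>n<N. (a n + b n) powr s) \<le> (A + B) powr s"
    proof (cases "A = 0 \<or> B = 0")
      case True
      then show ?thesis
        using az bz aD bD r by auto
    next
      case False
      then have AB: "0 < A" "0 < B"
        using A0 B0 by auto
      define t where "t = A / (A + B)"
      have t: "0 \<le> t" "t \<le> 1" "1 - t = B / (A + B)"
        using AB by (auto simp: t_def field_simps)
      have "(a n + b n) powr s \<le> (A + B) powr s * (t * (a n powr s / A powr s) + (1 - t) * (b n powr s / B powr s))" for n
      proof -
        have "a n + b n = (A + B) * (t * (a n / A) + (1 - t) * (b n / B))"
          unfolding t(3) distrib_left using AB by (simp add: t_def)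
        then have "(a n + b n) powr s = (A + B) powr s * (t * (a n / A) + (1 - t) * (b n / B)) powr s"
          using AB assms(2,4)[of n] t(1,2) by (simp add: powr_mult)
        also have "\<dots> \<le> (A + B) powr s * (t * (a n / A) powr s + (1 - t) * (b n / B) powr s)"
          using AB assms(2,4)[of n] t(1,2) s by (intro mult_left_mono powr_convex_nonneg) auto
        finally show ?thesis
          using AB assms(2,4)[of n] by (simp add: powr_divide)
      qed
      then have "(\<Sum>n<N. (a n + b n) powr s) \<le>
          (\<Sum>n<N. (A + B) powr s * (t * (a n powr s / A powr s) + (1 - t) * (b n powr s / B powr s)))"
        by (intro sum_mono) auto
      also have "\<dots> = (A + B) powr s *
          (t * ((\<Sum>n<N. a n powr s) / A powr s) + (1 - t) * ((\<Sum>n<N. b n powr s) / B powr s))"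
        by (simp add: sum_distrib_left sum_divide_distrib sum.distrib distrib_left)
      also have "\<dots> \<le> (A + B) powr s * (t * 1 + (1 - t) * 1)"
        using aD bD r t(1,2) AB by (intro mult_left_mono add_mono) (auto simp: divide_le_eq_1)
      finally show ?thesis
        by simp
    qed
  qed
  moreover have "\<forall>n. a n + b n \<le> A + B" if "r = \<infinity>"
    using aD bD that by (auto intro: add_mono)
  ultimately show ?thesis
    using lr_ball_iff[of r "\<lambda>n. a n + b n" "A + B"] assms A0 B0 by (simp add: A_def B_def s_def)
qed

text \<open>A Fatou property: the norm bound constrains finitely many coordinates at a time, so it
  passes to coordinatewise limits. It keeps the limit of a subsequence inside the ball of
  \<open>ell q complex_space\<close>.\<close>

lemma lr_limit:
  assumes "1 \<le> r" "\<And>k n. 0 \<le> a k n" "\<And>k. lr_mem r (a k)" "\<And>k. lr_norm r (a k) \<le> C"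
    and "\<And>n. (\<lambda>k. a k n) \<longlonglongrightarrow> b n"
  shows "lr_mem r b \<and> lr_norm r b \<le> C"
proof -
  have C: "0 \<le> C"
    using lr_norm_nonneg[of "a 0" r] assms(2)[of 0] assms(3,4)[of 0] by simp
  have b: "0 \<le> b n" for n
    using assms(5)[of n] assms(2) by (auto intro: LIMSEQ_le_const)
  note D = lr_ball_iff[OF assms(1) assms(2) C, THEN iffD1, OF conjI[OF assms(3,4)]]
  have "b n \<le> C" if "r = \<infinity>" for n
    using LIMSEQ_le_const2[OF assms(5)[of n], of C] D that by auto
  moreover have "(\<Sum>n<N. b n powr enn2real r) \<le> C powr enn2real r" if "r \<noteq> \<infinity>" for N
  proof (rule LIMSEQ_le_const2)
    show "(\<lambda>k. \<Sum>n<N. a k n powr enn2real r) \<longlonglongrightarrow> (\<Sum>n<N. b n powr enn2real r)"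
      using enn2real_ge_1[OF assms(1) that] assms(2)
      by (intro tendsto_sum tendsto_powr' assms(5) tendsto_const) auto
    show "\<exists>M. \<forall>k\<ge>M. (\<Sum>n<N. a k n powr enn2real r) \<le> C powr enn2real r"
      using D that by auto
  qed
  ultimately show ?thesis
    using lr_ball_iff[OF assms(1) b C] by simp
qed

text \<open>The tail of the series of powers tends to 0, and so does its root. Constant sequences
  show that this fails for \<open>r = \<infinity>\<close>; there the decay has to come from the
  sequence itself.\<close>

lemma lr_tail:
  assumes "1 \<le> r" "r \<noteq> \<infinity>" "\<And>n. 0 \<le> a n" "lr_mem r a"
  shows "(\<lambda>N. lr_norm r (\<lambda>n. if n < N then 0 else a n)) \<longlonglongrightarrow> 0"
proof -
  define s where "s = enn2real r"
  have s: "s \<ge> 1"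
    using enn2real_ge_1[OF assms(1,2)] by (simp add: s_def)
  have sm: "summable (\<lambda>n. a n powr s)"
    using assms by (simp add: lr_mem_def s_def)
  have eq: "(\<Sum>n. (if n < N then 0 else a n) powr s) = (\<Sum>n. a n powr s) - (\<Sum>n<N. a n powr s)" for N
  proof -
    have "summable (\<lambda>n. (if n < N then 0 else a n) powr s)"
      using s by (intro summable_comparison_test'[OF sm, of 0]) auto
    then have "(\<Sum>n. (if n < N then 0 else a n) powr s) =
        (\<Sum>n. (if n + N < N then 0 else a (n + N)) powr s) + (\<Sum>n<N. (if n < N then 0 else a n) powr s)"
      by (rule suminf_split_initial_segment)
    then show ?thesis
      using suminf_minus_initial_segment[OF sm, of N] by simp
  qed
  have "(\<lambda>N. ((\<Sum>n. a n powr s) - (\<Sum>n<N. a n powr s)) powr (1 / s)) \<longlonglongrightarrow> 0 powr (1 / s)"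
  proof (rule tendsto_powr')
    show "(\<lambda>N. (\<Sum>n. a n powr s) - (\<Sum>n<N. a n powr s)) \<longlonglongrightarrow> 0"
      using tendsto_diff[OF tendsto_const[of "\<Sum>n. a n powr s"] summable_LIMSEQ[OF sm]] by simp
    show "(\<lambda>N. 1 / s) \<longlonglongrightarrow> 1 / s"
      by simp
    show "0 \<noteq> (0::real) \<or> 0 < 1 / s \<and> (\<forall>\<^sub>F N in sequentially. 0 \<le> (\<Sum>n. a n powr s) - (\<Sum>n<N. a n powr s))"
      using s sum_le_suminf[OF sm] by auto
  qed
  then show ?thesis
    using s assms(2) by (simp add: lr_norm_def eq flip: s_def)
qed

text \<open>In \<open>ennreal\<close>, \<open>1 / \<infinity> = 0\<close> and
  \<open>1 / 0 = \<infinity>\<close>, so the exponent 0 is excluded and \<infinity> pairs only with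
  1. The last case hands over real exponents, the form in which Young's inequality applies.\<close>

lemma conjugate_cases:
  fixes p q :: ennreal
  assumes "1 / p + 1 / q = 1"
  obtains "p = 1" "q = \<infinity>" | "p = \<infinity>" "q = 1"
    | "p \<noteq> \<infinity>" "q \<noteq> \<infinity>" "1 < enn2real p" "1 < enn2real q" "1 / enn2real p + 1 / enn2real q = 1"
proof -
  have inv: "1 / ennreal c = ennreal (1 / c)" if "0 < c" for c
    using divide_ennreal[of 1 c] that by simp
  have one: "r = 1" if "1 / r = 1" for r :: ennreal
  proof (cases r)
    case (real c)
    then have "0 < c"
      using that by (auto simp: less_le)
    then show ?thesis
      using that real inv[of c] by (auto simp: ennreal_eq_1)
  qed (use that in \<open>auto simp: divide_ennreal_def\<close>)
  show ?thesis
  proof (cases "p = \<infinity> \<or> q = \<infinity>")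
    case True
    then show ?thesis
      using assms that one by (auto simp: divide_ennreal_def)
  next
    case False
    then obtain a b where ab: "p = ennreal a" "q = ennreal b" "0 \<le> a" "0 \<le> b"
      by (metis ennreal_cases infinity_ennreal_def)
    have pos: "0 < a" "0 < b"
      using assms ab by (auto simp: less_le)
    have "ennreal (1 / a + 1 / b) = ennreal 1"
      using assms ab pos by (simp add: inv)
    then have "1 / a + 1 / b = 1"
      using pos by (subst (asm) ennreal_inj) auto
    moreover have "0 < 1 / a" "0 < 1 / b"
      using pos by auto
    ultimately have "1 / a < 1" "1 / b < 1"
      by linarith+
    then show ?thesis
      using that(3) ab pos \<open>1 / a + 1 / b = 1\<close> by (auto simp: divide_less_eq_1)
  qed
qed

lemma conjugate_ge_1:
  fixes p q :: ennreal
  assumes "1 / p + 1 / q = 1"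
  shows "1 \<le> p" "1 \<le> q"
proof -
  have *: "1 \<le> r" if "r \<noteq> \<infinity>" "1 < enn2real r" for r :: ennreal
    using that by (cases r) (auto simp: ennreal_ge_1)
  show "1 \<le> p" "1 \<le> q"
    using assms by (rule conjugate_cases; use * in auto)+
qed

lemma lr_holder_one_infinity:
  assumes "\<And>n. 0 \<le> a n" "lr_mem \<infinity> a" "\<And>n. 0 \<le> b n" "lr_mem 1 b"
  shows "summable (\<lambda>n. a n * b n) \<and> (\<Sum>n. a n * b n) \<le> lr_norm \<infinity> a * lr_norm 1 b"
proof -
  have b: "summable b" "lr_norm 1 b = suminf b"
    using assms by (simp_all add: lr_mem_def lr_norm_def suminf_nonneg)
  have le: "a n * b n \<le> lr_norm \<infinity> a * b n" for n
    using lr_coord_le[OF _ assms(1,2), of n] assms(3) by (intro mult_right_mono) auto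
  have sm: "summable (\<lambda>n. a n * b n)"
  proof (rule summable_comparison_test')
    show "summable (\<lambda>n. lr_norm \<infinity> a * b n)"
      using b(1) by (rule summable_mult)
    show "norm (a n * b n) \<le> lr_norm \<infinity> a * b n" if "n \<ge> 0" for n
      using le[of n] assms(1)[of n] assms(3)[of n] by simp
  qed
  then have "(\<Sum>n. a n * b n) \<le> (\<Sum>n. lr_norm \<infinity> a * b n)"
    using le b(1) by (intro suminf_le summable_mult)
  then show ?thesis
    using sm b suminf_mult[OF b(1), of "lr_norm \<infinity> a"] by simp
qed

text \<open>Away from the endpoint exponents, Young's inequality is applied to the normalised terms
  \<open>a n / A\<close> and \<open>b n / B\<close>. Their sums of powers are at most 1, so the
  total is at most \<open>A * B * (1 / t + 1 / s)\<close>.\<close>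

lemma lr_holder:
  fixes p q :: ennreal
  assumes "1 / p + 1 / q = 1" "\<And>n. 0 \<le> a n" "lr_mem q a" "\<And>n. 0 \<le> b n" "lr_mem p b"
  shows "summable (\<lambda>n. a n * b n) \<and> (\<Sum>n. a n * b n) \<le> lr_norm q a * lr_norm p b"
  using assms(1)
proof (cases rule: conjugate_cases)
  case 1
  then show ?thesis
    using lr_holder_one_infinity[of a b] assms by simp
next
  case 2
  then show ?thesis
    using lr_holder_one_infinity[of b a] assms by (simp add: mult.commute)
next
  case 3
  define s t where "s = enn2real p" and "t = enn2real q"
  define A B where "A = lr_norm q a" and "B = lr_norm p b"
  note ge = conjugate_ge_1[OF assms(1)]
  have A0: "0 \<le> A" and B0: "0 \<le> B"
    using lr_norm_nonneg assms by (auto simp: A_def B_def)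
  have st: "s > 1" "t > 1" "1 / t + 1 / s = 1"
    using 3 by (auto simp: s_def t_def)
  have az: "a n = 0" if "A = 0" for n
    using lr_coord_le[OF ge(2) assms(2,3), of n] assms(2)[of n] that by (simp add: A_def)
  have bz: "b n = 0" if "B = 0" for n
    using lr_coord_le[OF ge(1) assms(4,5), of n] assms(4)[of n] that by (simp add: B_def)
  have bound: "(\<Sum>n<N. a n * b n) \<le> A * B" for N
  proof (cases "A = 0 \<or> B = 0")
    case True
    then show ?thesis
      using az bz by auto
  next
    case False
    then have AB: "0 < A" "0 < B"
      using A0 B0 by auto
    have "a n * b n \<le> A * B * ((a n powr t / A powr t) / t + (b n powr s / B powr s) / s)" for n
    proof -
      have "a n * b n = A * B * ((a n / A) * (b n / B))"
        using AB by simp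
      also have "\<dots> \<le> A * B * ((a n / A) powr t / t + (b n / B) powr s / s)"
        using AB assms(2,4)[of n] st by (intro mult_left_mono Youngs_inequality) auto
      finally show ?thesis
        using AB assms(2,4)[of n] by (simp add: powr_divide)
    qed
    then have "(\<Sum>n<N. a n * b n) \<le> (\<Sum>n<N. A * B * ((a n powr t / A powr t) / t + (b n powr s / B powr s) / s))"
      by (intro sum_mono) auto
    also have "\<dots> = A * B * (((\<Sum>n<N. a n powr t) / A powr t) / t + ((\<Sum>n<N. b n powr s) / B powr s) / s)"
      by (simp add: sum_distrib_left sum_divide_distrib sum.distrib distrib_left)
    also have "\<dots> \<le> A * B * (1 / t + 1 / s)"
      using lr_ballD[OF ge(2) assms(2,3)] lr_ballD[OF ge(1) assms(4,5)] 3 AB st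
      by (intro mult_left_mono add_mono divide_right_mono) (auto simp: divide_le_eq_1 A_def B_def s_def t_def)
    finally show ?thesis
      using st by simp
  qed
  have sm: "summable (\<lambda>n. a n * b n)"
    using assms bound by (intro summableI_nonneg_bounded) auto
  show ?thesis
    using sm bound suminf_le_const[OF sm, of "A * B"] by (simp add: A_def B_def)
qed

section \<open>Vector-valued sequences, operators and quotients\<close>

lemma (in complex_normed_space) minus_minus:
  assumes "a \<in> carrier V" "b \<in> carrier V"
  shows "a \<ominus>\<^bsub>V\<^esub> (a \<ominus>\<^bsub>V\<^esub> b) = b"
proof -
  have "(a \<ominus>\<^bsub>V\<^esub> b) \<oplus>\<^bsub>V\<^esub> b = a"
    using assms add_minus_cancel[of b a] M.a_comm[of "a \<ominus>\<^bsub>V\<^esub> b" b] by simp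
  then show ?thesis
    using assms minus_add_cancel[of "a \<ominus>\<^bsub>V\<^esub> b" b] by simp
qed

text \<open>Negatives are obtained as \<open>(-1) \<odot> x\<close>, and the norm of zero from
  homogeneity at \<open>c = 0\<close>. Both rest on \<open>0 \<odot> x = \<zero>\<close>, which is
  therefore assumed outright.\<close>

lemma complex_normed_spaceI:
  fixes V :: "'a cnspace" (structure)
  assumes "\<And>x y. \<lbrakk>x \<in> carrier V; y \<in> carrier V\<rbrakk> \<Longrightarrow> x \<oplus> y \<in> carrier V"
    and "\<zero> \<in> carrier V"
    and "\<And>c x. x \<in> carrier V \<Longrightarrow> c \<odot> x \<in> carrier V"
    and "\<And>x y z. \<lbrakk>x \<in> carrier V; y \<in> carrier V; z \<in> carrier V\<rbrakk> \<Longrightarrow> (x \<oplus> y) \<oplus> z = x \<oplus> (y \<oplus> z)"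
    and "\<And>x y. \<lbrakk>x \<in> carrier V; y \<in> carrier V\<rbrakk> \<Longrightarrow> x \<oplus> y = y \<oplus> x"
    and "\<And>x. x \<in> carrier V \<Longrightarrow> \<zero> \<oplus> x = x"
    and distl: "\<And>a b x. x \<in> carrier V \<Longrightarrow> (a + b) \<odot> x = a \<odot> x \<oplus> b \<odot> x"
    and "\<And>c x y. \<lbrakk>x \<in> carrier V; y \<in> carrier V\<rbrakk> \<Longrightarrow> c \<odot> (x \<oplus> y) = c \<odot> x \<oplus> c \<odot> y"
    and "\<And>a b x. x \<in> carrier V \<Longrightarrow> (a * b) \<odot> x = a \<odot> (b \<odot> x)"
    and "\<And>x. x \<in> carrier V \<Longrightarrow> 1 \<odot> x = x"
    and zero: "\<And>x. x \<in> carrier V \<Longrightarrow> 0 \<odot> x = \<zero>"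
    and nonneg: "\<And>x. x \<in> carrier V \<Longrightarrow> 0 \<le> vnorm V x"
    and eq0: "\<And>x. \<lbrakk>x \<in> carrier V; vnorm V x = 0\<rbrakk> \<Longrightarrow> x = \<zero>"
    and smult: "\<And>c x. x \<in> carrier V \<Longrightarrow> vnorm V (c \<odot> x) = cmod c * vnorm V x"
    and "\<And>x y. \<lbrakk>x \<in> carrier V; y \<in> carrier V\<rbrakk> \<Longrightarrow> vnorm V (x \<oplus> y) \<le> vnorm V x + vnorm V y"
  shows "complex_normed_space V"
proof -
  have neg: "\<exists>y\<in>carrier V. y \<oplus> x = \<zero>" if "x \<in> carrier V" for x
  proof
    show "(-1) \<odot> x \<oplus> x = \<zero>"
      using distl[OF that, of "-1" 1] assms(10)[OF that] zero[OF that] by simp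
  qed (rule assms(3)[OF that])
  have "abelian_group V"
    by (rule abelian_groupI) (fact assms(1,2,4,5,6) neg)+
  then have "module complex_ring V"
    by (rule moduleI[OF cring_from_type_algebra])
       (simp_all only: complex_ring_simps UNIV_I True_implies_equals, (rule assms; assumption)+)
  moreover have "vnorm V \<zero> = 0"
    using smult[OF assms(2), of 0] zero[OF assms(2)] by simp
  then have "vnorm V x = 0 \<longleftrightarrow> x = \<zero>" if "x \<in> carrier V" for x
    using eq0[OF that] by blast
  ultimately show ?thesis
    unfolding complex_normed_space_def complex_normed_space_axioms_def
    using nonneg smult assms(15) by blast
qed

lemma complex_normed_space_complex: "complex_normed_space complex_space"
  by (rule complex_normed_spaceI)
     (auto simp: complex_space_def algebra_simps norm_mult norm_triangle_ineq)

lemma complex_space_simps [simp]: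
  "carrier complex_space = UNIV" "vnorm complex_space = cmod" "smult complex_space = (*)"
  "add complex_space = (+)" "\<zero>\<^bsub>complex_space\<^esub> = 0"
  by (simp_all add: complex_space_def)

lemma carrier_ell: "x \<in> carrier (ell r V) \<longleftrightarrow> (\<forall>n. x n \<in> carrier V) \<and> lr_mem r (\<lambda>n. vnorm V (x n))"
  by (simp add: ell_def lr_mem_def)

lemma vnorm_ell: "vnorm (ell r V) x = lr_norm r (\<lambda>n. vnorm V (x n))"
  by (simp add: ell_def lr_norm_def)

lemma ell_ops [simp]:
  "x \<oplus>\<^bsub>ell r V\<^esub> y = (\<lambda>n. x n \<oplus>\<^bsub>V\<^esub> y n)" "c \<odot>\<^bsub>ell r V\<^esub> x = (\<lambda>n. c \<odot>\<^bsub>V\<^esub> x n)" "\<zero>\<^bsub>ell r V\<^esub> = (\<lambda>n. \<zero>\<^bsub>V\<^esub>)"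
  by (simp_all add: ell_def)

lemma (in complex_normed_space) complex_normed_space_ell:
  assumes "1 \<le> r"
  shows "complex_normed_space (ell r V)"
proof (rule complex_normed_spaceI)
  fix x assume x: "x \<in> carrier (ell r V)"
  then have xn: "x n \<in> carrier V" "0 \<le> vnorm V (x n)" for n
    by (auto simp: carrier_ell vnorm_nonneg)
  have xm: "lr_mem r (\<lambda>n. vnorm V (x n))"
    using x by (simp add: carrier_ell)
  show "1 \<odot>\<^bsub>ell r V\<^esub> x = x" "0 \<odot>\<^bsub>ell r V\<^esub> x = \<zero>\<^bsub>ell r V\<^esub>" "\<zero>\<^bsub>ell r V\<^esub> \<oplus>\<^bsub>ell r V\<^esub> x = x"
    "(a * b) \<odot>\<^bsub>ell r V\<^esub> x = a \<odot>\<^bsub>ell r V\<^esub> (b \<odot>\<^bsub>ell r V\<^esub> x)"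
    "(a + b) \<odot>\<^bsub>ell r V\<^esub> x = a \<odot>\<^bsub>ell r V\<^esub> x \<oplus>\<^bsub>ell r V\<^esub> b \<odot>\<^bsub>ell r V\<^esub> x" for a b
    using xn by (auto simp: smult_add_left)
  note sc = lr_scale[OF assms xn(2) xm]
  show "c \<odot>\<^bsub>ell r V\<^esub> x \<in> carrier (ell r V)" for c
    using xn sc[of "cmod c"] by (auto simp: carrier_ell vnorm_smult)
  show "vnorm (ell r V) (c \<odot>\<^bsub>ell r V\<^esub> x) = cmod c * vnorm (ell r V) x" for c
    using xn sc[of "cmod c"] by (auto simp: vnorm_ell vnorm_smult)
  show "0 \<le> vnorm (ell r V) x"
    using lr_norm_nonneg[OF xn(2) xm] by (simp add: vnorm_ell)
  show "x = \<zero>\<^bsub>ell r V\<^esub>" if "vnorm (ell r V) x = 0"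
  proof
    fix n
    have "vnorm V (x n) \<le> 0"
      using lr_coord_le[OF assms xn(2) xm, of n] that by (simp add: vnorm_ell)
    then show "x n = \<zero>\<^bsub>ell r V\<^esub> n"
      using xn[of n] vnorm_eq_0_iff[of "x n"] by simp
  qed
  fix y assume y: "y \<in> carrier (ell r V)"
  then have yn: "y n \<in> carrier V" "0 \<le> vnorm V (y n)" for n
    by (auto simp: carrier_ell vnorm_nonneg)
  have ym: "lr_mem r (\<lambda>n. vnorm V (y n))"
    using y by (simp add: carrier_ell)
  have sum: "lr_mem r (\<lambda>n. vnorm V (x n \<oplus>\<^bsub>V\<^esub> y n)) \<and>
      lr_norm r (\<lambda>n. vnorm V (x n \<oplus>\<^bsub>V\<^esub> y n)) \<le> lr_norm r (\<lambda>n. vnorm V (x n) + vnorm V (y n))"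
    using xn yn lr_add[OF assms xn(2) xm yn(2) ym]
    by (intro lr_mono[OF assms]) (auto simp: vnorm_triangle vnorm_nonneg)
  then show "x \<oplus>\<^bsub>ell r V\<^esub> y \<in> carrier (ell r V)"
    using xn yn by (simp add: carrier_ell)
  show "vnorm (ell r V) (x \<oplus>\<^bsub>ell r V\<^esub> y) \<le> vnorm (ell r V) x + vnorm (ell r V) y"
    using sum lr_add[OF assms xn(2) xm yn(2) ym] by (simp add: vnorm_ell)
  show "x \<oplus>\<^bsub>ell r V\<^esub> y = y \<oplus>\<^bsub>ell r V\<^esub> x" "c \<odot>\<^bsub>ell r V\<^esub> (x \<oplus>\<^bsub>ell r V\<^esub> y) = c \<odot>\<^bsub>ell r V\<^esub> x \<oplus>\<^bsub>ell r V\<^esub> c \<odot>\<^bsub>ell r V\<^esub> y" for c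
    using xn yn by (auto simp: M.a_comm smult_add_right)
next
  show "\<zero>\<^bsub>ell r V\<^esub> \<in> carrier (ell r V)"
    using lr_zero[OF assms] by (simp add: carrier_ell)
  show "(x \<oplus>\<^bsub>ell r V\<^esub> y) \<oplus>\<^bsub>ell r V\<^esub> z = x \<oplus>\<^bsub>ell r V\<^esub> (y \<oplus>\<^bsub>ell r V\<^esub> z)"
    if "x \<in> carrier (ell r V)" "y \<in> carrier (ell r V)" "z \<in> carrier (ell r V)" for x y z
    using that by (auto simp: carrier_ell M.a_assoc)
qed

section \<open>Bounded linear operators between carriers\<close>

locale bounded_op = V: complex_normed_space V + W: complex_normed_space W
  for V :: "'a cnspace" and W :: "'b cnspace" +
  fixes T :: "'a \<Rightarrow> 'b"
  assumes in_bounded_ops: "T \<in> bounded_ops V W"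
begin

lemma op_in [simp, intro]: "x \<in> carrier V \<Longrightarrow> T x \<in> carrier W"
  using in_bounded_ops by (auto simp: bounded_ops_def)

lemma op_add: "\<lbrakk>x \<in> carrier V; y \<in> carrier V\<rbrakk> \<Longrightarrow> T (x \<oplus>\<^bsub>V\<^esub> y) = T x \<oplus>\<^bsub>W\<^esub> T y"
  using in_bounded_ops by (auto simp: bounded_ops_def)

lemma op_smult: "x \<in> carrier V \<Longrightarrow> T (c \<odot>\<^bsub>V\<^esub> x) = c \<odot>\<^bsub>W\<^esub> T x"
  using in_bounded_ops by (auto simp: bounded_ops_def)

lemma op_zero [simp]: "T \<zero>\<^bsub>V\<^esub> = \<zero>\<^bsub>W\<^esub>"
  using op_smult[of "\<zero>\<^bsub>V\<^esub>" 0] by simp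

lemma op_minus: "\<lbrakk>x \<in> carrier V; y \<in> carrier V\<rbrakk> \<Longrightarrow> T (x \<ominus>\<^bsub>V\<^esub> y) = T x \<ominus>\<^bsub>W\<^esub> T y"
  by (simp add: V.minus_eq W.minus_eq op_add op_smult)

lemma op_bound: obtains C where "0 \<le> C" "\<And>x. x \<in> carrier V \<Longrightarrow> vnorm W (T x) \<le> C * vnorm V x"
proof -
  obtain C where C: "\<And>x. x \<in> carrier V \<Longrightarrow> vnorm W (T x) \<le> C * vnorm V x"
    using in_bounded_ops unfolding bounded_ops_def by blast
  have "vnorm W (T x) \<le> max C 0 * vnorm V x" if "x \<in> carrier V" for x
    using C[OF that] mult_right_mono[of C "max C 0" "vnorm V x"] V.vnorm_nonneg[OF that] by simp
  then show ?thesis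
    using that[of "max C 0"] by simp
qed

lemma vnorm_op_le_sup_norm:
  assumes "x \<in> carrier V"
  shows "vnorm W (T x) \<le> sup_norm V W T * vnorm V x"
proof -
  obtain C where C: "0 \<le> C" "\<And>x. x \<in> carrier V \<Longrightarrow> vnorm W (T x) \<le> C * vnorm V x"
    using op_bound by metis
  have bdd: "bdd_above ((\<lambda>x. vnorm W (T x)) ` uball V)"
    using C by (intro bdd_aboveI2[of _ _ C]) (auto simp: V.uball_iff intro: order_trans mult_left_le)
  obtain u where u: "u \<in> uball V" "x = complex_of_real (vnorm V x) \<odot>\<^bsub>V\<^esub> u"
    using V.scaled_uball[OF assms order_refl] by blast
  have uV: "u \<in> carrier V"
    using u by (simp add: V.uball_iff)
  have "vnorm W (T x) = vnorm V x * vnorm W (T u)"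
    using V.vnorm_nonneg[OF assms] uV by (subst u(2)) (simp add: op_smult W.vnorm_smult)
  also have "\<dots> \<le> vnorm V x * sup_norm V W T"
    using u(1) bdd V.vnorm_nonneg[OF assms] unfolding sup_norm_def
    by (intro mult_left_mono cSUP_upper)
  finally show ?thesis
    by (simp add: mult.commute)
qed

lemma sup_norm_nonneg: "0 \<le> sup_norm V W T"
proof -
  obtain C where C: "0 \<le> C" "\<And>x. x \<in> carrier V \<Longrightarrow> vnorm W (T x) \<le> C * vnorm V x"
    using op_bound by metis
  have "bdd_above ((\<lambda>x. vnorm W (T x)) ` uball V)"
    using C by (intro bdd_aboveI2[of _ _ C]) (auto simp: V.uball_iff intro: order_trans mult_left_le)
  then show ?thesis
    unfolding sup_norm_def by (rule cSUP_upper2[of _ _ "\<zero>\<^bsub>V\<^esub>"]) auto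
qed

lemma op_finsum:
  fixes f :: "nat \<Rightarrow> 'a"
  assumes "\<And>n. f n \<in> carrier V"
  shows "T (finsum V f {..<N}) = finsum W (\<lambda>n. T (f n)) {..<N}"
  using assms by (induction N) (simp_all add: V.finsum_lessThan_Suc W.finsum_lessThan_Suc V.finsum_in op_add)

lemma op_limit:
  assumes "\<And>n. f n \<in> carrier V" "limitin (ntop V) f l sequentially"
  shows "limitin (ntop W) (\<lambda>n. T (f n)) (T l) sequentially"
proof -
  obtain C where C: "0 \<le> C" "\<And>x. x \<in> carrier V \<Longrightarrow> vnorm W (T x) \<le> C * vnorm V x"
    using op_bound by metis
  have l: "l \<in> carrier V" and lim: "(\<lambda>n. vnorm V (f n \<ominus>\<^bsub>V\<^esub> l)) \<longlonglongrightarrow> 0"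
    using assms by (simp_all add: V.limitin_ntop_iff)
  show ?thesis
  proof (rule W.limitin_ntopI)
    show "vnorm W (T (f n) \<ominus>\<^bsub>W\<^esub> T l) \<le> C * vnorm V (f n \<ominus>\<^bsub>V\<^esub> l)" for n
      using C(2)[of "f n \<ominus>\<^bsub>V\<^esub> l"] assms(1) l by (simp add: op_minus)
    show "(\<lambda>n. C * vnorm V (f n \<ominus>\<^bsub>V\<^esub> l)) \<longlonglongrightarrow> 0"
      using lim by (rule tendsto_mult_right_zero)
  qed (use assms l in auto)
qed

lemma op_nsuminf:
  assumes "abs_complete V" "\<And>n. f n \<in> carrier V" "summable (\<lambda>n. vnorm V (f n))"
  shows "T (nsuminf V f) = nsuminf W (\<lambda>n. T (f n))"
proof -
  have "limitin (ntop W) (\<lambda>N. T (finsum V f {..<N})) (T (nsuminf V f)) sequentially"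
    using V.nsuminf_limit[OF assms] assms(2) by (intro op_limit) (auto simp: V.finsum_in)
  then show ?thesis
    using W.nsuminf_eqI by (simp add: op_finsum assms(2))
qed

lemma op_continuous: "continuous_map (ntop V) (ntop W) T"
proof -
  obtain C where C: "0 \<le> C" "\<And>x. x \<in> carrier V \<Longrightarrow> vnorm W (T x) \<le> C * vnorm V x"
    using op_bound by metis
  have "\<exists>d>0. \<forall>x. x \<in> carrier V \<and> ndist V a x < d \<longrightarrow> ndist W (T a) (T x) < e"
    if "a \<in> carrier V" "0 < e" for a e
  proof (intro exI[of _ "e / (C + 1)"] conjI allI impI)
    show "0 < e / (C + 1)"
      using C that by simp
    fix x assume x: "x \<in> carrier V \<and> ndist V a x < e / (C + 1)"
    have "ndist W (T a) (T x) \<le> C * ndist V a x"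
      using C(2)[of "a \<ominus>\<^bsub>V\<^esub> x"] x that by (simp add: V.ndist_eq W.ndist_eq op_minus)
    also have "\<dots> \<le> (C + 1) * ndist V a x"
      using V.ntop.nonneg by (intro mult_right_mono) auto
    also have "\<dots> < e"
      using x C by (simp add: field_simps)
    finally show "ndist W (T a) (T x) < e" .
  qed
  then show ?thesis
    unfolding V.ntop_eq W.ntop_eq V.ntop.metric_continuous_map[OF W.Metric_space_ndist] by auto
qed

text \<open>The subspaces divided out in the constructions are all kernels, so this supplies the
  closedness that a quotient norm requires.\<close>

lemma closed_subspace_kernel: "closed_subspace {x \<in> carrier V. T x = \<zero>\<^bsub>W\<^esub>} V"
proof -
  have "submodule {x \<in> carrier V. T x = \<zero>\<^bsub>W\<^esub>} complex_ring V"
    by (rule V.submoduleI) (auto simp: op_add op_smult V.uminus_eq)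
  moreover have "closedin (ntop V) {x \<in> topspace (ntop V). T x \<in> {\<zero>\<^bsub>W\<^esub>}}"
    using W.ntop.t1_space_mtopology
    by (intro closedin_continuous_map_preimage[OF op_continuous] closedin_t1_singleton) (auto simp: W.ntop_eq)
  ultimately show ?thesis
    by (simp add: closed_subspace_def)
qed

end

section \<open>Quotients by closed subspaces\<close>

locale quotient_normed_space = complex_normed_space V for V :: "'a cnspace" (structure) +
  fixes M :: "'a set"
  assumes closed_subspace: "closed_subspace M V"
begin

lemma submodule: "submodule M complex_ring V"
  using closed_subspace by (simp add: closed_subspace_def)

lemmas M_simps = submodule_complexD[OF submodule module_axioms]

lemma M_in: "m \<in> M \<Longrightarrow> m \<in> carrier V"
  using M_simps(1) by auto

abbreviation coset ("\<pi>") where "\<pi> a \<equiv> M +>\<^bsub>V\<^esub> a"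

abbreviation VM where "VM \<equiv> quotient_space V M"

lemma in_coset_iff:
  assumes "a \<in> carrier V"
  shows "x \<in> \<pi> a \<longleftrightarrow> x \<in> carrier V \<and> x \<ominus>\<^bsub>V\<^esub> a \<in> M"
proof
  assume "x \<in> \<pi> a"
  then obtain m where "m \<in> M" "x = m \<oplus>\<^bsub>V\<^esub> a"
    by (auto simp: a_r_coset_def')
  then show "x \<in> carrier V \<and> x \<ominus>\<^bsub>V\<^esub> a \<in> M"
    using assms M_in[of m] by (simp add: M.a_comm[of m a])
next
  assume x: "x \<in> carrier V \<and> x \<ominus>\<^bsub>V\<^esub> a \<in> M"
  then have "x = (x \<ominus>\<^bsub>V\<^esub> a) \<oplus>\<^bsub>V\<^esub> a"
    using assms add_minus_cancel[of a x] by (simp add: M.a_comm)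
  then show "x \<in> \<pi> a"
    using x by (auto simp: a_r_coset_def')
qed

lemma coset_eq_iff:
  assumes "a \<in> carrier V" "b \<in> carrier V"
  shows "\<pi> a = \<pi> b \<longleftrightarrow> a \<ominus>\<^bsub>V\<^esub> b \<in> M"
proof
  assume "\<pi> a = \<pi> b"
  moreover have "a \<in> \<pi> a"
    using assms M_simps(2) by (simp add: in_coset_iff minus_eq_zero_iff[THEN iffD2])
  ultimately show "a \<ominus>\<^bsub>V\<^esub> b \<in> M"
    using assms by (simp add: in_coset_iff)
next
  have sub: "\<pi> a \<subseteq> \<pi> b" if "a \<in> carrier V" "b \<in> carrier V" "a \<ominus>\<^bsub>V\<^esub> b \<in> M" for a b
  proof
    fix x assume x: "x \<in> \<pi> a"
    then have xV: "x \<in> carrier V"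
      using that by (simp add: in_coset_iff)
    have "(x \<ominus>\<^bsub>V\<^esub> a) \<oplus>\<^bsub>V\<^esub> (a \<ominus>\<^bsub>V\<^esub> b) = x \<ominus>\<^bsub>V\<^esub> b"
      using that xV add_minus_cancel[of a "x \<ominus>\<^bsub>V\<^esub> b"] by (simp add: minus_eq M.a_ac)
    then show "x \<in> \<pi> b"
      using M_simps(3)[of "x \<ominus>\<^bsub>V\<^esub> a" "a \<ominus>\<^bsub>V\<^esub> b"] x that by (auto simp: in_coset_iff)
  qed
  assume "a \<ominus>\<^bsub>V\<^esub> b \<in> M"
  moreover from this have "b \<ominus>\<^bsub>V\<^esub> a \<in> M"
    using M_simps(4)[of "a \<ominus>\<^bsub>V\<^esub> b" "-1"] assms by (simp add: minus_eq smult_add_right M.a_comm)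
  ultimately show "\<pi> a = \<pi> b"
    using assms sub by blast
qed

lemma coset_eq_iff_mem: "\<lbrakk>a \<in> carrier V; b \<in> carrier V\<rbrakk> \<Longrightarrow> \<pi> a = \<pi> b \<longleftrightarrow> a \<in> \<pi> b"
  by (simp add: coset_eq_iff in_coset_iff)

lemma carrier_quotient: "carrier VM = \<pi> ` carrier V"
  by (auto simp: quotient_space_def A_RCOSETS_def')

lemma coset_zero: "\<pi> \<zero>\<^bsub>V\<^esub> = M"
  using M_simps(1) by (auto simp: in_coset_iff)

lemma quotient_zero: "\<zero>\<^bsub>VM\<^esub> = \<pi> \<zero>\<^bsub>V\<^esub>"
  by (simp add: coset_zero) (simp add: quotient_space_def)

lemma quotient_add:
  assumes "a \<in> carrier V" "b \<in> carrier V"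
  shows "\<pi> a \<oplus>\<^bsub>VM\<^esub> \<pi> b = \<pi> (a \<oplus>\<^bsub>V\<^esub> b)"
proof -
  have "additive_subgroup M V"
    using submodule by (simp add: additive_subgroup_def submodule_def)
  then have "abelian_subgroup M V"
    by (rule abelian_subgroupI3) unfold_locales
  then show ?thesis
    using abelian_subgroup.a_rcos_sum[of M V a b] assms by (simp add: quotient_space_def)
qed

lemma quotient_smult:
  assumes "a \<in> carrier V"
  shows "c \<odot>\<^bsub>VM\<^esub> \<pi> a = \<pi> (c \<odot>\<^bsub>V\<^esub> a)"
proof -
  have "(\<lambda>a. c \<odot>\<^bsub>V\<^esub> a) ` \<pi> a <+>\<^bsub>V\<^esub> M = \<pi> (c \<odot>\<^bsub>V\<^esub> a)"
  proof (intro equalityI subsetI)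
    fix x assume "x \<in> (\<lambda>a. c \<odot>\<^bsub>V\<^esub> a) ` \<pi> a <+>\<^bsub>V\<^esub> M"
    then obtain b m where b: "b \<in> \<pi> a" "m \<in> M" "x = c \<odot>\<^bsub>V\<^esub> b \<oplus>\<^bsub>V\<^esub> m"
      by (auto simp: set_add_def')
    then have bV: "b \<in> carrier V" "m \<in> carrier V"
      using assms M_in by (auto simp: in_coset_iff)
    have "x \<ominus>\<^bsub>V\<^esub> c \<odot>\<^bsub>V\<^esub> a = c \<odot>\<^bsub>V\<^esub> (b \<ominus>\<^bsub>V\<^esub> a) \<oplus>\<^bsub>V\<^esub> m"
      using bV assms by (simp add: b(3) minus_eq smult_add_right M.a_ac)
    then show "x \<in> \<pi> (c \<odot>\<^bsub>V\<^esub> a)"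
      using b bV assms M_simps(3,4) by (auto simp: in_coset_iff)
  next
    fix x assume x: "x \<in> \<pi> (c \<odot>\<^bsub>V\<^esub> a)"
    have "a \<in> \<pi> a"
      using coset_eq_iff_mem[of a a] assms by simp
    moreover have "x = c \<odot>\<^bsub>V\<^esub> a \<oplus>\<^bsub>V\<^esub> (x \<ominus>\<^bsub>V\<^esub> c \<odot>\<^bsub>V\<^esub> a)"
      using x assms by (simp add: in_coset_iff)
    moreover have "x \<ominus>\<^bsub>V\<^esub> c \<odot>\<^bsub>V\<^esub> a \<in> M"
      using x assms by (simp add: in_coset_iff)
    ultimately show "x \<in> (\<lambda>a. c \<odot>\<^bsub>V\<^esub> a) ` \<pi> a <+>\<^bsub>V\<^esub> M"
      unfolding set_add_def' by blast
  qed
  then show ?thesis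
    by (simp add: quotient_space_def)
qed

lemma bdd_below_coset: "a \<in> carrier V \<Longrightarrow> bdd_below (vnorm V ` \<pi> a)"
  by (rule bdd_belowI2[of _ 0]) (auto simp: in_coset_iff vnorm_nonneg)

lemma vnorm_quotient: "vnorm VM A = (INF a\<in>A. vnorm V a)"
  by (simp add: quotient_space_def)

lemma vnorm_coset_le: "a \<in> carrier V \<Longrightarrow> vnorm VM (\<pi> a) \<le> vnorm V a"
  unfolding vnorm_quotient using coset_eq_iff_mem[of a a] by (auto intro!: cINF_lower bdd_below_coset)

text \<open>The infimum defining the quotient norm need not be attained; the slack \<open>e\<close>
  is carried through the estimates and removed at their end.\<close>

lemma coset_representative:
  assumes "A \<in> carrier VM" "0 < e"
  obtains a where "a \<in> carrier V" "A = \<pi> a" "vnorm V a < vnorm VM A + e"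
proof -
  obtain b where b: "b \<in> carrier V" "A = \<pi> b"
    using assms by (auto simp: carrier_quotient)
  have "A \<noteq> {}"
    using b coset_eq_iff_mem[of b b] by auto
  moreover have "(INF a\<in>A. vnorm V a) < vnorm VM A + e"
    using assms by (simp add: vnorm_quotient)
  ultimately obtain a where "a \<in> A" "vnorm V a < vnorm VM A + e"
    using cINF_less_iff[of A "vnorm V"] bdd_below_coset b by auto
  moreover have "a \<in> carrier V" "A = \<pi> a"
    using \<open>a \<in> A\<close> b coset_eq_iff_mem[of a b] by (auto simp: in_coset_iff)
  ultimately show ?thesis
    using that by blast
qed

lemma coset_nonempty: "a \<in> carrier V \<Longrightarrow> \<pi> a \<noteq> {}"
  using coset_eq_iff_mem[of a a] by auto

lemma vnorm_quotient_nonneg: "A \<in> carrier VM \<Longrightarrow> 0 \<le> vnorm VM A"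
  unfolding carrier_quotient vnorm_quotient
  by (auto intro!: cINF_greatest simp: coset_nonempty in_coset_iff vnorm_nonneg)

lemma complex_normed_space_quotient: "complex_normed_space VM"
proof (rule complex_normed_spaceI)
  fix A assume A: "A \<in> carrier VM"
  \<comment> \<open>Only one inequality is proved, but for all scalars and cosets; equality for
    \<open>c \<noteq> 0\<close> follows by applying it to \<open>inverse c\<close>.\<close>
  have le: "vnorm VM (c \<odot>\<^bsub>VM\<^esub> A) \<le> cmod c * vnorm VM A" if A: "A \<in> carrier VM" for c A
  proof (rule field_le_epsilon)
    fix e :: real assume "0 < e"
    \<comment> \<open>The added 1 covers \<open>c = 0\<close>.\<close>
    then have "0 < e / (cmod c + 1)"
      by (simp add: add_nonneg_pos)
    then obtain a where a: "a \<in> carrier V" "A = \<pi> a" "vnorm V a < vnorm VM A + e / (cmod c + 1)"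
      using coset_representative[OF A] by blast
    have "vnorm VM (c \<odot>\<^bsub>VM\<^esub> A) \<le> cmod c * vnorm V a"
      using vnorm_coset_le[of "c \<odot>\<^bsub>V\<^esub> a"] a by (simp add: quotient_smult vnorm_smult)
    also have "\<dots> \<le> cmod c * (vnorm VM A + e / (cmod c + 1))"
      using a by (intro mult_left_mono) auto
    also have "\<dots> \<le> cmod c * vnorm VM A + e"
      using \<open>0 < e\<close> by (simp add: distrib_left divide_le_eq add_nonneg_pos mult.commute)
    finally show "vnorm VM (c \<odot>\<^bsub>VM\<^esub> A) \<le> cmod c * vnorm VM A + e" .
  qed
  show cA: "c \<odot>\<^bsub>VM\<^esub> A \<in> carrier VM" for c
    using A by (auto simp: carrier_quotient quotient_smult)
  show nonneg: "0 \<le> vnorm VM A"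
    using A by (rule vnorm_quotient_nonneg)
  show sm: "(a * b) \<odot>\<^bsub>VM\<^esub> A = a \<odot>\<^bsub>VM\<^esub> (b \<odot>\<^bsub>VM\<^esub> A)" for a b
    using A by (auto simp: carrier_quotient quotient_smult)
  show one: "1 \<odot>\<^bsub>VM\<^esub> A = A" and zero: "0 \<odot>\<^bsub>VM\<^esub> A = \<zero>\<^bsub>VM\<^esub>"
    and "(a + b) \<odot>\<^bsub>VM\<^esub> A = a \<odot>\<^bsub>VM\<^esub> A \<oplus>\<^bsub>VM\<^esub> b \<odot>\<^bsub>VM\<^esub> A"
    and "\<zero>\<^bsub>VM\<^esub> \<oplus>\<^bsub>VM\<^esub> A = A" for a b
    using A by (auto simp: carrier_quotient quotient_smult quotient_add quotient_zero smult_add_left)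
  show "vnorm VM (c \<odot>\<^bsub>VM\<^esub> A) = cmod c * vnorm VM A" for c
  proof (cases "c = 0")
    case True
    then show ?thesis
      using le[OF A, of 0] vnorm_quotient_nonneg[OF cA, of 0] by simp
  next
    case False
    have "vnorm VM A \<le> cmod (inverse c) * vnorm VM (c \<odot>\<^bsub>VM\<^esub> A)"
      using le[OF cA, of "inverse c" c] sm[of "inverse c" c] one False by simp
    then show ?thesis
      using le[OF A, of c] False by (simp add: norm_inverse norm_divide field_simps)
  qed
  \<comment> \<open>Closedness of \<open>M\<close> enters here: a coset of norm 0 contains
    arbitrarily short elements, so its representative \<open>a\<close> lies in the closure of
    \<open>M\<close>.\<close>
  show "A = \<zero>\<^bsub>VM\<^esub>" if "vnorm VM A = 0"
  proof -
    obtain a where a: "a \<in> carrier V" "A = \<pi> a"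
      using A by (auto simp: carrier_quotient)
    have "\<exists>m\<in>M. vnorm V (a \<ominus>\<^bsub>V\<^esub> m) < r" if "0 < r" for r
    proof -
      obtain b where b: "b \<in> carrier V" "A = \<pi> b" "vnorm V b < r"
        using coset_representative[OF A \<open>0 < r\<close>] \<open>vnorm VM A = 0\<close> by (metis add_0)
      have "a \<ominus>\<^bsub>V\<^esub> b \<in> M"
        using a b coset_eq_iff[of a b] by metis
      moreover have "a \<ominus>\<^bsub>V\<^esub> (a \<ominus>\<^bsub>V\<^esub> b) = b"
        using a b by (simp add: minus_minus)
      ultimately show ?thesis
        using b by (intro bexI[of _ "a \<ominus>\<^bsub>V\<^esub> b"]) auto
    qed
    then have "a \<in> ntop V closure_of M"
      using a M_simps(1) by (simp add: in_closure_iff)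
    then have "a \<in> M"
      using closed_subspace closure_of_closedin by (auto simp: closed_subspace_def)
    then show ?thesis
      using a by (simp add: quotient_zero coset_eq_iff)
  qed
  fix B assume B: "B \<in> carrier VM"
  show "A \<oplus>\<^bsub>VM\<^esub> B \<in> carrier VM" "A \<oplus>\<^bsub>VM\<^esub> B = B \<oplus>\<^bsub>VM\<^esub> A"
    "c \<odot>\<^bsub>VM\<^esub> (A \<oplus>\<^bsub>VM\<^esub> B) = c \<odot>\<^bsub>VM\<^esub> A \<oplus>\<^bsub>VM\<^esub> c \<odot>\<^bsub>VM\<^esub> B" for c
    using A B by (auto simp: carrier_quotient quotient_add quotient_smult smult_add_right M.a_comm)
  show "vnorm VM (A \<oplus>\<^bsub>VM\<^esub> B) \<le> vnorm VM A + vnorm VM B"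
  proof (rule field_le_epsilon)
    fix e :: real assume "0 < e"
    then obtain a b where "a \<in> carrier V" "A = \<pi> a" "vnorm V a < vnorm VM A + e / 2"
      and "b \<in> carrier V" "B = \<pi> b" "vnorm V b < vnorm VM B + e / 2"
      using coset_representative[OF A, of "e / 2"] coset_representative[OF B, of "e / 2"] by (metis half_gt_zero)
    then show "vnorm VM (A \<oplus>\<^bsub>VM\<^esub> B) \<le> vnorm VM A + vnorm VM B + e"
      using vnorm_coset_le[of "a \<oplus>\<^bsub>V\<^esub> b"] vnorm_triangle[of a b] by (simp add: quotient_add)
  qed
next
  show "\<zero>\<^bsub>VM\<^esub> \<in> carrier VM"
    by (auto simp: carrier_quotient quotient_zero)
  show "(A \<oplus>\<^bsub>VM\<^esub> B) \<oplus>\<^bsub>VM\<^esub> C = A \<oplus>\<^bsub>VM\<^esub> (B \<oplus>\<^bsub>VM\<^esub> C)"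
    if "A \<in> carrier VM" "B \<in> carrier VM" "C \<in> carrier VM" for A B C
    using that by (auto simp: carrier_quotient quotient_add M.a_assoc)
qed

lemma bounded_op_coset: "bounded_op V VM \<pi>"
  unfolding bounded_op_def bounded_op_axioms_def
proof (intro conjI complex_normed_space_quotient complex_normed_space_axioms)
  show "\<pi> \<in> bounded_ops V VM"
    unfolding bounded_ops_def using vnorm_coset_le
    by (auto simp: carrier_quotient quotient_add quotient_smult intro!: exI[of _ 1])
qed

text \<open>Representatives whose norms exceed those of the cosets by at most
  \<open>(1 / 2) ^ n\<close> still form an absolutely summable series. Its sum in \<open>V\<close>
  is carried down by the continuous coset map.\<close>

lemma abs_complete_quotient:
  assumes "abs_complete V"
  shows "abs_complete VM"
  unfolding abs_complete_def
proof (intro allI impI, elim conjE)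
  fix f assume f: "\<forall>n. f n \<in> carrier VM" and sm: "summable (\<lambda>n. vnorm VM (f n))"
  have "\<exists>a. a \<in> carrier V \<and> f n = \<pi> a \<and> vnorm V a < vnorm VM (f n) + (1 / 2) ^ n" for n
    using coset_representative[of "f n" "(1 / 2) ^ n"] f by (metis zero_less_divide_1_iff zero_less_numeral zero_less_power)
  then obtain a where a: "\<And>n. a n \<in> carrier V" "\<And>n. f n = \<pi> (a n)"
      "\<And>n. vnorm V (a n) < vnorm VM (f n) + (1 / 2) ^ n"
    by metis
  have "summable (\<lambda>n. vnorm VM (f n) + (1 / 2) ^ n)"
    using sm by (intro summable_add summable_geometric) auto
  then have "summable (\<lambda>n. vnorm V (a n))"
    using a by (elim summable_comparison_test'[where N = 0]) (simp add: vnorm_nonneg less_imp_le)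
  then obtain s where s: "limitin (ntop V) (\<lambda>N. finsum V a {..<N}) s sequentially"
    using assms a(1) unfolding abs_complete_def by blast
  interpret q: bounded_op V VM \<pi>
    by (rule bounded_op_coset)
  have "limitin (ntop VM) (\<lambda>N. \<pi> (finsum V a {..<N})) (\<pi> s) sequentially"
    using s a(1) by (intro q.op_limit) (auto simp: finsum_in)
  moreover have "(\<lambda>n. \<pi> (a n)) = f"
    using a(2) by auto
  ultimately show "\<exists>s. limitin (ntop VM) (\<lambda>N. finsum VM f {..<N}) s sequentially"
    by (auto simp: q.op_finsum a(1))
qed

text \<open>All representatives give the same value since \<open>T\<close> vanishes on
  \<open>M\<close>. The bound of \<open>T\<close> is inherited because it holds for every
  representative, including those of nearly minimal norm.\<close>

lemma quotient_lift:
  assumes "bounded_op V W T" "\<And>m. m \<in> M \<Longrightarrow> T m = \<zero>\<^bsub>W\<^esub>"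
  obtains T' where "bounded_op VM W T'" "\<And>a. a \<in> carrier V \<Longrightarrow> T' (\<pi> a) = T a"
proof -
  interpret T: bounded_op V W T
    by (rule assms)
  define T' where "T' A = T (SOME a. a \<in> carrier V \<and> A = \<pi> a)" for A
  have T': "T' (\<pi> a) = T a" if a: "a \<in> carrier V" for a
  proof -
    define b where "b = (SOME b. b \<in> carrier V \<and> \<pi> a = \<pi> b)"
    have b: "b \<in> carrier V \<and> \<pi> a = \<pi> b"
      unfolding b_def by (rule someI[of _ a]) (use a in auto)
    then have "T (a \<ominus>\<^bsub>V\<^esub> b) = \<zero>\<^bsub>W\<^esub>"
      using a b coset_eq_iff[of a b] by (intro assms(2)) auto
    then have "T a = T b"
      using a b by (simp add: T.op_minus T.W.minus_eq_zero_iff)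
    then show ?thesis
      by (simp add: T'_def b_def)
  qed
  obtain C where C: "0 \<le> C" "\<And>x. x \<in> carrier V \<Longrightarrow> vnorm W (T x) \<le> C * vnorm V x"
    using T.op_bound by metis
  have bd: "vnorm W (T' A) \<le> C * vnorm VM A" if A: "A \<in> carrier VM" for A
  proof (rule field_le_epsilon)
    fix e :: real assume "0 < e"
    then have "0 < e / (C + 1)"
      using C by (simp add: add_nonneg_pos)
    then obtain a where a: "a \<in> carrier V" "A = \<pi> a" "vnorm V a < vnorm VM A + e / (C + 1)"
      using coset_representative[OF A] by blast
    have "vnorm W (T' A) \<le> C * vnorm V a"
      using C a by (simp add: T')
    also have "\<dots> \<le> C * (vnorm VM A + e / (C + 1))"
      using a C by (intro mult_left_mono) auto
    also have "\<dots> \<le> C * vnorm VM A + e"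
      using \<open>0 < e\<close> C by (simp add: distrib_left divide_le_eq add_nonneg_pos mult.commute)
    finally show "vnorm W (T' A) \<le> C * vnorm VM A + e" .
  qed
  have "\<exists>C. \<forall>A\<in>carrier VM. vnorm W (T' A) \<le> C * vnorm VM A"
    using bd by blast
  then have "T' \<in> bounded_ops VM W"
    unfolding bounded_ops_def
    by (auto simp: carrier_quotient quotient_add quotient_smult T' T.op_add T.op_smult)
  then show ?thesis
    using that[of T'] T' complex_normed_space_quotient T.W.complex_normed_space_axioms
    by (simp add: bounded_op_def bounded_op_axioms_def)
qed

text \<open>A coset in the closed ball may have no representative in the closed ball of
  \<open>V\<close>, but it has one of norm below \<open>1 + d\<close>; shrinking it by
  \<open>1 / (1 + d)\<close> moves the image by at most \<open>d * vnorm W (T' A)\<close>. The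
  closure is absorbed wherever the image of the ball of \<open>V\<close> is closed.\<close>

lemma lift_uball_subset_closure:
  assumes "bounded_op VM W T'"
  shows "T' ` uball VM \<subseteq> ntop W closure_of ((\<lambda>a. T' (\<pi> a)) ` uball V)"
proof (rule image_subsetI)
  interpret T': bounded_op VM W T'
    by (rule assms)
  fix A assume "A \<in> uball VM"
  then have A: "A \<in> carrier VM" "vnorm VM A \<le> 1"
    by (auto simp: uball_def)
  have "\<exists>u\<in>uball V. vnorm W (T' A \<ominus>\<^bsub>W\<^esub> T' (\<pi> u)) < r" if "0 < r" for r
  proof -
    \<comment> \<open>This choice makes \<open>d * vnorm W (T' A)\<close> smaller than
      \<open>r\<close>; the added 1 covers \<open>T' A\<close> of norm 0.\<close>
    define d where "d = r / (vnorm W (T' A) + 1)"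
    have n: "0 \<le> vnorm W (T' A)"
      using A by (simp add: T'.W.vnorm_nonneg)
    then have d: "0 < d"
      using that by (simp add: d_def add_nonneg_pos)
    obtain a where a: "a \<in> carrier V" "A = \<pi> a" "vnorm V a < vnorm VM A + d"
      using coset_representative[OF A(1) d] by blast
    define u where "u = complex_of_real (1 / (1 + d)) \<odot>\<^bsub>V\<^esub> a"
    have "vnorm V u = \<bar>1 / (1 + d)\<bar> * vnorm V a"
      unfolding u_def using a(1) by (simp only: vnorm_smult norm_of_real)
    also have "\<dots> \<le> 1"
      using a A d by (simp add: divide_simps)
    finally have u: "u \<in> uball V"
      using a(1) by (simp add: uball_iff u_def)
    have "T' A \<ominus>\<^bsub>W\<^esub> T' (\<pi> u) = T' A \<ominus>\<^bsub>W\<^esub> complex_of_real (1 / (1 + d)) \<odot>\<^bsub>W\<^esub> T' A"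
      using a A(1) T'.op_smult[of A] by (simp add: u_def quotient_smult[symmetric] del: of_real_divide)
    also have "\<dots> = (1 + (- 1) * complex_of_real (1 / (1 + d))) \<odot>\<^bsub>W\<^esub> T' A"
      using A T'.W.smult_add_left[of "T' A" 1 "(- 1) * complex_of_real (1 / (1 + d))"]
      by (simp add: T'.W.minus_eq del: of_real_divide)
    also have "1 + (- 1) * complex_of_real (1 / (1 + d)) = complex_of_real (d / (1 + d))"
    proof -
      have "1 + (- 1) * complex_of_real (1 / (1 + d)) = complex_of_real (1 - 1 / (1 + d))"
        by simp
      also have "1 - 1 / (1 + d) = d / (1 + d)"
        using d by (simp add: field_simps)
      finally show ?thesis .
    qed
    finally have "vnorm W (T' A \<ominus>\<^bsub>W\<^esub> T' (\<pi> u)) = \<bar>d / (1 + d)\<bar> * vnorm W (T' A)"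
      using A(1) by (simp only: T'.W.vnorm_smult norm_of_real T'.op_in)
    also have "\<dots> \<le> d * vnorm W (T' A)"
      using d n by (intro mult_right_mono) (auto simp: divide_simps)
    also have "\<dots> < d * (vnorm W (T' A) + 1)"
      using d by simp
    also have "\<dots> = r"
      using n by (simp add: d_def)
    finally show ?thesis
      using u by blast
  qed
  moreover have "(\<lambda>a. T' (\<pi> a)) ` uball V \<subseteq> carrier W"
    by (auto simp: uball_def carrier_quotient)
  ultimately show "T' A \<in> ntop W closure_of ((\<lambda>a. T' (\<pi> a)) ` uball V)"
    using A by (auto simp: T'.W.in_closure_iff)
qed

end

section \<open>The operators \<open>\<theta>\<^sub>y\<close>\<close>

lemma (in bounded_op) ell_map:
  assumes "1 \<le> r" "y \<in> carrier (ell r V)"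
    and "0 \<le> C" "\<And>x. x \<in> carrier V \<Longrightarrow> vnorm W (T x) \<le> C * vnorm V x"
  shows "(\<lambda>n. T (y n)) \<in> carrier (ell r W)" "vnorm (ell r W) (\<lambda>n. T (y n)) \<le> C * vnorm (ell r V) y"
proof -
  have y: "\<And>n. y n \<in> carrier V" "lr_mem r (\<lambda>n. vnorm V (y n))"
    using assms(2) by (auto simp: carrier_ell)
  have *: "lr_mem r (\<lambda>n. C * vnorm V (y n)) \<and> lr_norm r (\<lambda>n. C * vnorm V (y n)) = C * lr_norm r (\<lambda>n. vnorm V (y n))"
    using y assms by (intro lr_scale) (auto simp: V.vnorm_nonneg)
  have "lr_mem r (\<lambda>n. vnorm W (T (y n))) \<and> lr_norm r (\<lambda>n. vnorm W (T (y n))) \<le> lr_norm r (\<lambda>n. C * vnorm V (y n))"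
    using y assms * by (intro lr_mono) (auto simp: W.vnorm_nonneg)
  then show "(\<lambda>n. T (y n)) \<in> carrier (ell r W)" "vnorm (ell r W) (\<lambda>n. T (y n)) \<le> C * vnorm (ell r V) y"
    using * y by (auto simp: carrier_ell vnorm_ell)
qed

lemma (in complex_normed_space) ell_minus:
  assumes "1 \<le> r" "x \<in> carrier (ell r V)" "y \<in> carrier (ell r V)"
  shows "x \<ominus>\<^bsub>ell r V\<^esub> y = (\<lambda>n. x n \<ominus>\<^bsub>V\<^esub> y n)"
proof -
  interpret l: complex_normed_space "ell r V"
    by (rule complex_normed_space_ell) (rule assms)
  show ?thesis
    using assms by (auto simp: l.minus_eq minus_eq carrier_ell)
qed

lemma complex_space_minus [simp]: "x \<ominus>\<^bsub>complex_space\<^esub> y = x - y"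
  using complex_normed_space.minus_eq[OF complex_normed_space_complex, of x y] by simp

text \<open>Tychonoff's theorem for a countable product of closed discs; the product is metrizable,
  so compactness yields subsequences. Coordinatewise convergence is weak enough to work for every
  \<open>q\<close>, including 1 and \<infinity>.\<close>

lemma pointwise_convergent_subseq:
  fixes \<alpha> :: "nat \<Rightarrow> nat \<Rightarrow> complex"
  assumes "\<And>k n. cmod (\<alpha> k n) \<le> 1"
  obtains l r where "strict_mono r" "\<And>n. (\<lambda>k. \<alpha> (r k) n) \<longlonglongrightarrow> l n"
proof -
  let ?B = "PiE UNIV (\<lambda>_::nat. cball (0::complex) 1)"
  have "compactin (product_topology (\<lambda>_. euclidean) UNIV) ?B"
    by (simp add: compactin_PiE)
  then have "seq_compact ?B"
    by (simp add: euclidean_product_topology compact_eq_seq_compact_metric)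
  moreover have "\<forall>k. \<alpha> k \<in> ?B"
    using assms by auto
  ultimately obtain l r where r: "strict_mono r" "(\<alpha> \<circ> r) \<longlonglongrightarrow> l"
    unfolding seq_compact_def by blast
  have "(\<lambda>k. (\<alpha> \<circ> r) k n) \<longlonglongrightarrow> l n" for n
    by (rule continuous_on_tendsto_compose[OF continuous_on_product_coordinates r(2)]) auto
  then show ?thesis
    using that[of r l] r(1) by simp
qed

text \<open>Needed because the series that define \<open>theta\<close> must also converge in
  \<open>l1_mod M\<close>. The candidate for the sum is formed coordinate by coordinate.\<close>

lemma abs_complete_ell1: "abs_complete (ell 1 complex_space)"
  unfolding abs_complete_def
proof (intro allI impI, elim conjE)
  let ?L = "ell 1 complex_space"
  interpret l: complex_normed_space ?L
    using complex_normed_space.complex_normed_space_ell[OF complex_normed_space_complex] by simp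
  fix f assume f: "\<forall>n. f n \<in> carrier ?L" and sm: "summable (\<lambda>n. vnorm ?L (f n))"
  have fm: "lr_mem 1 (\<lambda>k. cmod (f n k))" for n
    using f by (simp add: carrier_ell)
  have vn: "vnorm ?L (f n) = lr_norm 1 (\<lambda>k. cmod (f n k))" for n
    by (simp add: vnorm_ell)
  have coord: "cmod (f n k) \<le> vnorm ?L (f n)" for n k
    using lr_coord_le[OF _ _ fm] by (simp add: vn)
  have smk: "summable (\<lambda>n. cmod (f n k))" for k
    using coord sm by (intro summable_comparison_test'[OF sm, of 0]) auto
  define s where "s k = (\<Sum>n. f n k)" for k
  define t where "t N = (\<Sum>n. vnorm ?L (f (n + N)))" for N
  have smN: "summable (\<lambda>n. vnorm ?L (f (n + N)))" for N
    using sm by (simp add: summable_iff_shift[of "\<lambda>n. vnorm ?L (f n)"])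
  have smkN: "summable (\<lambda>n. cmod (f (n + N) k))" for N k
    using smk[of k] by (simp add: summable_iff_shift[of "\<lambda>n. cmod (f n k)"])
  have t0: "0 \<le> t N" for N
    unfolding t_def using smN f by (intro suminf_nonneg) (auto simp: l.vnorm_nonneg)
  have bd: "lr_mem 1 (\<lambda>k. cmod ((\<Sum>n<N. f n k) - s k)) \<and> lr_norm 1 (\<lambda>k. cmod ((\<Sum>n<N. f n k) - s k)) \<le> t N" for N
  proof -
    \<comment> \<open>With only \<open>K\<close> coordinates, the exchange of sums is one of a
      finite sum with a series; the bound \<open>t N\<close> does not depend on
      \<open>K\<close>.\<close>
    have "(\<Sum>k<K. cmod ((\<Sum>n<N. f n k) - s k)) \<le> t N" for K
    proof -
      have "cmod ((\<Sum>n<N. f n k) - s k) \<le> (\<Sum>n. cmod (f (n + N) k))" for k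
      proof -
        have "s k = (\<Sum>n. f (n + N) k) + (\<Sum>n<N. f n k)"
          unfolding s_def using smk[of k] by (intro suminf_split_initial_segment) (rule summable_norm_cancel)
        then show ?thesis
          using summable_norm[OF smkN[of N k]] by simp
      qed
      then have "(\<Sum>k<K. cmod ((\<Sum>n<N. f n k) - s k)) \<le> (\<Sum>k<K. \<Sum>n. cmod (f (n + N) k))"
        by (intro sum_mono) auto
      also have "\<dots> = (\<Sum>n. \<Sum>k<K. cmod (f (n + N) k))"
        using smkN by (intro suminf_sum[symmetric]) auto
      also have "\<dots> \<le> t N"
        unfolding t_def
      proof (intro suminf_le smN summable_sum smkN)
        show "(\<Sum>k<K. cmod (f (n + N) k)) \<le> vnorm ?L (f (n + N))" for n
          using lr_ballD[OF _ _ fm[of "n + N"]] f l.vnorm_nonneg[of "f (n + N)"] by (simp add: vn)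
      qed
      finally show ?thesis .
    qed
    then show ?thesis
      using t0 by (subst lr_ball_iff) auto
  qed
  have "lr_mem 1 (\<lambda>k. cmod (s k))"
    using bd[of 0] by simp
  then have sL: "s \<in> carrier ?L"
    by (simp add: carrier_ell)
  have fs: "finsum ?L f {..<N} = (\<lambda>k. \<Sum>n<N. f n k)" for N
    using f by (induction N) (auto simp: l.finsum_lessThan_Suc)
  have fL: "finsum ?L f {..<N} \<in> carrier ?L" for N
    using f by (simp add: l.finsum_in)
  have "limitin (ntop ?L) (\<lambda>N. finsum ?L f {..<N}) s sequentially"
  proof (rule l.limitin_ntopI)
    show "vnorm ?L (finsum ?L f {..<N} \<ominus>\<^bsub>?L\<^esub> s) \<le> t N" for N
      using fL sL bd by (simp add: complex_normed_space.ell_minus[OF complex_normed_space_complex] vnorm_ell fs)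
    show "t \<longlonglongrightarrow> 0"
    proof -
      have "t = (\<lambda>N. (\<Sum>n. vnorm ?L (f n)) - (\<Sum>n<N. vnorm ?L (f n)))"
        unfolding t_def using sm by (intro ext suminf_minus_initial_segment)
      then show ?thesis
        using tendsto_diff[OF tendsto_const[of "\<Sum>n. vnorm ?L (f n)"] summable_LIMSEQ[OF sm]]
        by simp
    qed
  qed (use fL sL in auto)
  then show "\<exists>s. limitin (ntop ?L) (\<lambda>N. finsum ?L f {..<N}) s sequentially"
    by blast
qed

locale conjugate_sequences = complex_normed_space V for V :: "'a cnspace" (structure) +
  fixes p q :: ennreal
  assumes abs_complete: "abs_complete V" and conjugate: "1 / p + 1 / q = 1"
begin

abbreviation Lq where "Lq \<equiv> ell q complex_space"

lemmas p_ge_1 = conjugate_ge_1(1)[OF conjugate] and q_ge_1 = conjugate_ge_1(2)[OF conjugate]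

sublocale Lq: complex_normed_space Lq
  by (rule complex_normed_space.complex_normed_space_ell[OF complex_normed_space_complex q_ge_1])

sublocale Lp: complex_normed_space "ell p V"
  by (rule complex_normed_space_ell[OF p_ge_1])

context
  fixes y assumes y: "y \<in> carrier (ell p V)"
begin

lemma y_in: "y n \<in> carrier V"
  using y by (simp add: carrier_ell)

lemma terms_in: "\<alpha> n \<odot>\<^bsub>V\<^esub> y n \<in> carrier V"
  by (simp add: y_in)

lemma holder:
  assumes "\<alpha> \<in> carrier Lq"
  shows "summable (\<lambda>n. vnorm V (\<alpha> n \<odot>\<^bsub>V\<^esub> y n))"
    and "(\<Sum>n. vnorm V (\<alpha> n \<odot>\<^bsub>V\<^esub> y n)) \<le> vnorm Lq \<alpha> * vnorm (ell p V) y"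
  using lr_holder[OF conjugate, of "\<lambda>n. cmod (\<alpha> n)" "\<lambda>n. vnorm V (y n)"] assms y
  by (auto simp: carrier_ell vnorm_ell vnorm_smult vnorm_nonneg)

lemma theta_limit:
  assumes "\<alpha> \<in> carrier Lq"
  shows "limitin (ntop V) (\<lambda>N. finsum V (\<lambda>n. \<alpha> n \<odot>\<^bsub>V\<^esub> y n) {..<N}) (theta V y \<alpha>) sequentially"
  unfolding theta_def using abs_complete terms_in holder(1)[OF assms] by (rule nsuminf_limit)

lemma theta_in: "\<alpha> \<in> carrier Lq \<Longrightarrow> theta V y \<alpha> \<in> carrier V"
  using limitin_topspace[OF theta_limit] by simp

lemma vnorm_theta_le: "\<alpha> \<in> carrier Lq \<Longrightarrow> vnorm V (theta V y \<alpha>) \<le> vnorm Lq \<alpha> * vnorm (ell p V) y"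
  unfolding theta_def
  using order_trans[OF vnorm_nsuminf_le[of "\<lambda>n. \<alpha> n \<odot>\<^bsub>V\<^esub> y n"] holder(2)] abs_complete terms_in holder(1) by simp

lemma bounded_op_theta: "bounded_op Lq V (theta V y)"
proof -
  have "theta V y (\<alpha> \<oplus>\<^bsub>Lq\<^esub> \<beta>) = theta V y \<alpha> \<oplus>\<^bsub>V\<^esub> theta V y \<beta>"
    if "\<alpha> \<in> carrier Lq" "\<beta> \<in> carrier Lq" for \<alpha> \<beta>
  proof (rule limitin_ntop_unique[OF theta_limit])
    show "limitin (ntop V) (\<lambda>N. finsum V (\<lambda>n. (\<alpha> \<oplus>\<^bsub>Lq\<^esub> \<beta>) n \<odot>\<^bsub>V\<^esub> y n) {..<N})
        (theta V y \<alpha> \<oplus>\<^bsub>V\<^esub> theta V y \<beta>) sequentially"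
      using limitin_ntop_add[OF _ _ theta_limit[OF that(1)] theta_limit[OF that(2)]]
      by (simp add: smult_add_left y_in finsum_lessThan_add finsum_in)
  qed (use that Lq.M.a_closed in blast)
  moreover have "theta V y (c \<odot>\<^bsub>Lq\<^esub> \<alpha>) = c \<odot>\<^bsub>V\<^esub> theta V y \<alpha>" if "\<alpha> \<in> carrier Lq" for c \<alpha>
  proof (rule limitin_ntop_unique[OF theta_limit])
    show "limitin (ntop V) (\<lambda>N. finsum V (\<lambda>n. (c \<odot>\<^bsub>Lq\<^esub> \<alpha>) n \<odot>\<^bsub>V\<^esub> y n) {..<N})
        (c \<odot>\<^bsub>V\<^esub> theta V y \<alpha>) sequentially"
    proof -
      have "(c * a) \<odot>\<^bsub>V\<^esub> y n = c \<odot>\<^bsub>V\<^esub> (a \<odot>\<^bsub>V\<^esub> y n)" for a n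
        by (simp add: y_in)
      then show ?thesis
        using limitin_ntop_smult[OF _ theta_limit[OF that], of c] finsum_lessThan_smult[of "\<lambda>n. \<alpha> n \<odot>\<^bsub>V\<^esub> y n" c]
        by (simp add: finsum_in y_in del: smult_smult)
    qed
  qed (use that Lq.smult_in in blast)
  moreover have "\<exists>C. \<forall>\<alpha>\<in>carrier Lq. vnorm V (theta V y \<alpha>) \<le> C * vnorm Lq \<alpha>"
    using vnorm_theta_le by (intro exI[of _ "vnorm (ell p V) y"]) (simp add: mult.commute)
  ultimately have "theta V y \<in> bounded_ops Lq V"
    unfolding bounded_ops_def using theta_in by simp
  then show ?thesis
    by (simp add: bounded_op_def bounded_op_axioms_def Lq.complex_normed_space_axioms complex_normed_space_axioms)
qed

text \<open>Hoelder's inequality for \<open>y\<close> with its first \<open>N\<close> entries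
  replaced by 0. The second factor does not involve \<alpha>, so the truncation error is uniform on
  the ball.\<close>

lemma vnorm_theta_tail_le:
  assumes "\<alpha> \<in> carrier Lq"
  shows "vnorm V (theta V y \<alpha> \<ominus>\<^bsub>V\<^esub> finsum V (\<lambda>n. \<alpha> n \<odot>\<^bsub>V\<^esub> y n) {..<N}) \<le>
    vnorm Lq \<alpha> * lr_norm p (\<lambda>n. if n < N then 0 else vnorm V (y n))"
proof -
  let ?b = "\<lambda>n. if n < N then 0 else vnorm V (y n)"
  have mem: "lr_mem p ?b"
    using lr_mono[OF p_ge_1, of ?b "\<lambda>n. vnorm V (y n)"] y by (auto simp: carrier_ell vnorm_nonneg)
  have h: "summable (\<lambda>n. cmod (\<alpha> n) * ?b n)"
      "(\<Sum>n. cmod (\<alpha> n) * ?b n) \<le> vnorm Lq \<alpha> * lr_norm p ?b"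
    using lr_holder[OF conjugate, of "\<lambda>n. cmod (\<alpha> n)" ?b] mem assms
    by (auto simp: carrier_ell vnorm_ell vnorm_nonneg y_in)
  have "vnorm V (theta V y \<alpha> \<ominus>\<^bsub>V\<^esub> finsum V (\<lambda>n. \<alpha> n \<odot>\<^bsub>V\<^esub> y n) {..<N}) \<le>
      (\<Sum>n. vnorm V (\<alpha> (n + N) \<odot>\<^bsub>V\<^esub> y (n + N)))"
    unfolding theta_def using abs_complete terms_in holder(1)[OF assms] by (rule nsuminf_tail_le)
  also have "\<dots> = (\<Sum>n. cmod (\<alpha> (n + N)) * ?b (n + N))"
    by (simp add: vnorm_smult y_in)
  also have "\<dots> = (\<Sum>n. cmod (\<alpha> n) * ?b n)"
    using suminf_split_initial_segment[OF h(1), of N] by simp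
  also note h(2)
  finally show ?thesis .
qed

lemma pco_eq: "pco q V y = theta V y ` uball Lq"
  by (auto simp: pco_def theta_def)

lemma pco_subset: "pco q V y \<subseteq> carrier V"
  by (auto simp: pco_eq uball_def theta_in)

text \<open>For large \<open>N\<close> the tail is small uniformly in \<open>k\<close>; for that
  fixed \<open>N\<close> the remaining finite sum tends to 0 by convergence of the
  coordinates.\<close>

lemma theta_tendsto:
  assumes tail: "(\<lambda>N. lr_norm p (\<lambda>n. if n < N then 0 else vnorm V (y n))) \<longlonglongrightarrow> 0"
    and "\<And>k. \<alpha> k \<in> uball Lq" "\<beta> \<in> uball Lq" "\<And>n. (\<lambda>k. \<alpha> k n) \<longlonglongrightarrow> \<beta> n"
  shows "limitin (ntop V) (\<lambda>k. theta V y (\<alpha> k)) (theta V y \<beta>) sequentially"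
proof -
  interpret th: bounded_op Lq V "theta V y"
    by (rule bounded_op_theta)
  have in_Lq: "\<alpha> k \<in> carrier Lq" "\<beta> \<in> carrier Lq" for k
    using assms by (auto simp: uball_def)
  define t where "t N = lr_norm p (\<lambda>n. if n < N then 0 else vnorm V (y n))" for N
  have bound: "vnorm V (theta V y (\<alpha> k) \<ominus>\<^bsub>V\<^esub> theta V y \<beta>) \<le>
      (\<Sum>n<N. cmod (\<alpha> k n - \<beta> n) * vnorm V (y n)) + 2 * t N" for k N
  proof -
    let ?d = "\<alpha> k \<ominus>\<^bsub>Lq\<^esub> \<beta>"
    let ?s = "finsum V (\<lambda>n. ?d n \<odot>\<^bsub>V\<^esub> y n) {..<N}"
    have t0: "0 \<le> t N"
      unfolding t_def using lr_mono[OF p_ge_1, of "\<lambda>n. if n < N then 0 else vnorm V (y n)" "\<lambda>n. vnorm V (y n)"] y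
      by (intro lr_norm_nonneg) (auto simp: carrier_ell vnorm_nonneg)
    have d: "?d \<in> carrier Lq" "vnorm Lq ?d \<le> 2" "?d = (\<lambda>n. \<alpha> k n - \<beta> n)"
      using Lq.minus_in[OF in_Lq(1)[of k] in_Lq(2)] Lq.vnorm_triangle_minus[of "\<alpha> k" \<beta>]
        assms(2)[of k] assms(3)
      by (auto simp: uball_def complex_normed_space.ell_minus[OF complex_normed_space_complex q_ge_1])
    have "vnorm V (theta V y ?d) \<le> vnorm V ?s + vnorm V (theta V y ?d \<ominus>\<^bsub>V\<^esub> ?s)"
      using vnorm_triangle[of ?s "theta V y ?d \<ominus>\<^bsub>V\<^esub> ?s"] d(1) terms_in by (simp add: theta_in finsum_in)
    also have "vnorm V ?s \<le> (\<Sum>n<N. vnorm V (?d n \<odot>\<^bsub>V\<^esub> y n))"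
      by (rule vnorm_finsum_le) (rule terms_in)
    also have "vnorm V (theta V y ?d \<ominus>\<^bsub>V\<^esub> ?s) \<le> vnorm Lq ?d * t N"
      unfolding t_def by (rule vnorm_theta_tail_le) (rule d)
    also have "\<dots> \<le> 2 * t N"
      using d(2) t0 by (rule mult_right_mono)
    finally show ?thesis
      using in_Lq by (simp add: th.op_minus[symmetric]) (simp add: d(3) vnorm_smult y_in)
  qed
  show ?thesis
    unfolding limitin_ntop_iff[of "\<lambda>k. theta V y (\<alpha> k)", OF th.op_in[OF in_Lq(1)]]
  proof (intro conjI th.op_in in_Lq(2) LIMSEQ_I)
    fix e :: real assume "0 < e"
    \<comment> \<open>The differences of elements of the ball have norm at most 2, so the tail
      counts twice; a quarter leaves \<open>e / 2\<close> for the finite sum.\<close>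
    then have "\<forall>\<^sub>F N in sequentially. t N < e / 4"
      using tail unfolding t_def by (intro order_tendstoD(2)) auto
    then obtain N where N: "t N < e / 4"
      using eventually_happens'[OF sequentially_bot] by blast
    have "(\<lambda>k. \<Sum>n<N. cmod (\<alpha> k n - \<beta> n) * vnorm V (y n)) \<longlonglongrightarrow> (\<Sum>n<N. cmod (\<beta> n - \<beta> n) * vnorm V (y n))"
      by (intro tendsto_intros assms)
    then have "\<forall>\<^sub>F k in sequentially. (\<Sum>n<N. cmod (\<alpha> k n - \<beta> n) * vnorm V (y n)) < e / 2"
      using \<open>0 < e\<close> by (intro order_tendstoD(2)) auto
    then obtain K where K: "\<And>k. k \<ge> K \<Longrightarrow> (\<Sum>n<N. cmod (\<alpha> k n - \<beta> n) * vnorm V (y n)) < e / 2"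
      unfolding eventually_sequentially by blast
    have "vnorm V (theta V y (\<alpha> k) \<ominus>\<^bsub>V\<^esub> theta V y \<beta>) < e" if "k \<ge> K" for k
      using bound[of k N] K[OF that] N by linarith
    then show "\<exists>K. \<forall>k\<ge>K. norm (vnorm V (theta V y (\<alpha> k) \<ominus>\<^bsub>V\<^esub> theta V y \<beta>) - 0) < e"
      using in_Lq by (auto simp: vnorm_nonneg)
  qed
qed

text \<open>The decay of the tails is a hypothesis rather than derived from
  \<open>p \<noteq> \<infinity>\<close>, because the statement is also applied to a null sequence
  with \<open>p = \<infinity>\<close>. There it yields the compactness of \<open>S\<close> in
  (iii).\<close>

lemma compactin_pco:
  assumes tail: "(\<lambda>N. lr_norm p (\<lambda>n. if n < N then 0 else vnorm V (y n))) \<longlonglongrightarrow> 0"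
  shows "compactin (ntop V) (pco q V y)"
  unfolding ntop_eq ntop.compactin_sequentially
proof (intro conjI allI impI pco_subset)
  fix \<sigma> :: "nat \<Rightarrow> 'a" assume "range \<sigma> \<subseteq> pco q V y"
  then have "\<forall>k. \<exists>\<alpha>. \<alpha> \<in> uball Lq \<and> \<sigma> k = theta V y \<alpha>"
    unfolding pco_eq by blast
  then obtain \<alpha> where \<alpha>: "\<And>k. \<alpha> k \<in> uball Lq" "\<And>k. \<sigma> k = theta V y (\<alpha> k)"
    by metis
  have mem: "lr_mem q (\<lambda>n. cmod (\<alpha> k n))" "lr_norm q (\<lambda>n. cmod (\<alpha> k n)) \<le> 1" for k
    using \<alpha>(1)[of k] by (auto simp: uball_def carrier_ell vnorm_ell)
  have "cmod (\<alpha> k n) \<le> 1" for k n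
    using lr_coord_le[OF q_ge_1 _ mem(1)[of k], of n] mem(2)[of k] by simp
  then obtain l r where lr: "strict_mono r" "\<And>n. (\<lambda>k. \<alpha> (r k) n) \<longlonglongrightarrow> l n"
    using pointwise_convergent_subseq[of \<alpha>] by blast
  have "lr_mem q (\<lambda>n. cmod (l n)) \<and> lr_norm q (\<lambda>n. cmod (l n)) \<le> 1"
    using mem lr(2) by (intro lr_limit[OF q_ge_1, of "\<lambda>k n. cmod (\<alpha> (r k) n)"]) (auto intro: tendsto_norm)
  then have l: "l \<in> uball Lq"
    by (simp add: uball_def carrier_ell vnorm_ell)
  have "limitin (ntop V) (\<lambda>k. theta V y (\<alpha> (r k))) (theta V y l) sequentially"
    using tail \<alpha>(1) l lr(2) by (rule theta_tendsto)
  then show "\<exists>l r. l \<in> pco q V y \<and> strict_mono r \<and> limitin ntop.mtopology (\<sigma> \<circ> r) l sequentially"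
    using lr(1) l \<alpha>(2) unfolding pco_eq ntop_eq o_def by auto
qed

lemma closure_pco:
  assumes "(\<lambda>N. lr_norm p (\<lambda>n. if n < N then 0 else vnorm V (y n))) \<longlonglongrightarrow> 0"
  shows "ntop V closure_of pco q V y = pco q V y"
  using compactin_pco[OF assms] ntop.Hausdorff_space_mtopology
  by (intro closure_of_closedin compactin_imp_closedin) (auto simp: ntop_eq)

lemma tail_tendsto_0:
  assumes "p \<noteq> \<infinity>"
  shows "(\<lambda>N. lr_norm p (\<lambda>n. if n < N then 0 else vnorm V (y n))) \<longlonglongrightarrow> 0"
  using y by (intro lr_tail[OF p_ge_1 assms]) (auto simp: carrier_ell vnorm_nonneg)

end

lemma pco_image:
  assumes "bounded_op V W T" "abs_complete W" "y \<in> carrier (ell p V)"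
  shows "T ` pco q V y = pco q W (\<lambda>n. T (y n))"
proof -
  interpret T: bounded_op V W T
    by (rule assms)
  have "T (nsuminf V (\<lambda>n. \<alpha> n \<odot>\<^bsub>V\<^esub> y n)) = nsuminf W (\<lambda>n. \<alpha> n \<odot>\<^bsub>W\<^esub> T (y n))" if "\<alpha> \<in> uball Lq" for \<alpha>
    using T.op_nsuminf[of "\<lambda>n. \<alpha> n \<odot>\<^bsub>V\<^esub> y n"] abs_complete holder(1)[OF assms(3)] that
    by (simp add: T.op_smult y_in[OF assms(3)] uball_def)
  then show ?thesis
    unfolding pco_def setcompr_eq_image image_image by (intro image_cong) auto
qed

end

section \<open>Homogeneous polynomials\<close>

text \<open>Zorn's lemma gives a submodule \<open>N\<close> maximal among those that meet the range
  only in 0. The complement is purely algebraic: nothing is claimed about continuity of the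
  projection along it.\<close>

lemma (in bounded_op) submodule_range_complement:
  obtains N where "submodule N complex_ring W" "N \<inter> T ` carrier V \<subseteq> {\<zero>\<^bsub>W\<^esub>}"
    "\<And>w. w \<in> carrier W \<Longrightarrow> \<exists>x\<in>carrier V. w \<ominus>\<^bsub>W\<^esub> T x \<in> N"
proof -
  let ?A = "{H. submodule H complex_ring W \<and> H \<inter> T ` carrier V \<subseteq> {\<zero>\<^bsub>W\<^esub>}}"
  note sm = submodule_complexD[OF _ W.module_axioms]
  have "submodule {\<zero>\<^bsub>W\<^esub>} complex_ring W"
    by (rule W.submoduleI) auto
  then have "?A \<noteq> {}"
    by auto
  moreover have "\<Union>\<C> \<in> ?A" if "\<C> \<noteq> {}" and chain: "subset.chain ?A \<C>" for \<C>
  proof -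
    have H: "submodule H complex_ring W" "H \<inter> T ` carrier V \<subseteq> {\<zero>\<^bsub>W\<^esub>}" if "H \<in> \<C>" for H
      using chain that by (auto simp: subset.chain_def)
    have "submodule (\<Union>\<C>) complex_ring W"
    proof (rule W.submoduleI)
      fix a b assume "a \<in> \<Union>\<C>" "b \<in> \<Union>\<C>"
      then obtain H K where HK: "H \<in> \<C>" "K \<in> \<C>" "a \<in> H" "b \<in> K"
        by auto
      then have "H \<subseteq> K \<or> K \<subseteq> H"
        using chain unfolding subset_chain_def by blast
      then show "a \<oplus>\<^bsub>W\<^esub> b \<in> \<Union>\<C>"
        using HK sm(3)[OF H(1)] by blast
    next
      show "\<Union>\<C> \<subseteq> carrier W" "\<zero>\<^bsub>W\<^esub> \<in> \<Union>\<C>"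
        using sm(1,2)[OF H(1)] \<open>\<C> \<noteq> {}\<close> by auto
      show "\<ominus>\<^bsub>W\<^esub> a \<in> \<Union>\<C>" if "a \<in> \<Union>\<C>" for a
        using sm(5)[OF H(1)] that by auto
      show "c \<odot>\<^bsub>W\<^esub> a \<in> \<Union>\<C>" if "a \<in> \<Union>\<C>" for a c
        using sm(4)[OF H(1)] that by auto
    qed
    then show ?thesis
      using H(2) by auto
  qed
  ultimately obtain N where N: "submodule N complex_ring W" "N \<inter> T ` carrier V \<subseteq> {\<zero>\<^bsub>W\<^esub>}"
    and max: "\<And>H. \<lbrakk>submodule H complex_ring W; H \<inter> T ` carrier V \<subseteq> {\<zero>\<^bsub>W\<^esub>}; N \<subseteq> H\<rbrakk> \<Longrightarrow> H = N"
    using subset_Zorn_nonempty[of ?A] by auto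
  note Nsm = sm[OF N(1)]
  have NW: "n \<in> carrier W" if "n \<in> N" for n
    using Nsm(1) that by auto
  have "\<exists>x\<in>carrier V. w \<ominus>\<^bsub>W\<^esub> T x \<in> N" if w: "w \<in> carrier W" for w
  proof (rule ccontr)
    assume no: "\<not> (\<exists>x\<in>carrier V. w \<ominus>\<^bsub>W\<^esub> T x \<in> N)"
    \<comment> \<open>The span of \<open>N\<close> and \<open>w\<close> contradicts maximality: an
      element of the range of the form \<open>n\<close> plus \<open>c\<close> times \<open>w\<close>
      with \<open>c \<noteq> 0\<close> would put \<open>w\<close> into the range plus
      \<open>N\<close>, against \<open>no\<close>.\<close>
    let ?H = "{n \<oplus>\<^bsub>W\<^esub> c \<odot>\<^bsub>W\<^esub> w |n c. n \<in> N}"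
    have "submodule ?H complex_ring W"
    proof (rule W.submoduleI)
      show "?H \<subseteq> carrier W"
        using NW w by auto
      have "\<zero>\<^bsub>W\<^esub> = \<zero>\<^bsub>W\<^esub> \<oplus>\<^bsub>W\<^esub> 0 \<odot>\<^bsub>W\<^esub> w"
        using w by simp
      then show "\<zero>\<^bsub>W\<^esub> \<in> ?H"
        using Nsm(2) by blast
      fix a assume "a \<in> ?H"
      then obtain n c where a: "n \<in> N" "a = n \<oplus>\<^bsub>W\<^esub> c \<odot>\<^bsub>W\<^esub> w"
        by auto
      have smult: "k \<odot>\<^bsub>W\<^esub> a \<in> ?H" for k
      proof -
        have "k \<odot>\<^bsub>W\<^esub> a = k \<odot>\<^bsub>W\<^esub> n \<oplus>\<^bsub>W\<^esub> (k * c) \<odot>\<^bsub>W\<^esub> w"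
          using a NW w by (simp add: W.smult_add_right)
        then show ?thesis
          using Nsm(4)[OF a(1)] by blast
      qed
      then show "k \<odot>\<^bsub>W\<^esub> a \<in> ?H" for k .
      show "\<ominus>\<^bsub>W\<^esub> a \<in> ?H"
        using smult[of "-1"] a NW w by (simp add: W.uminus_eq)
      fix b assume "b \<in> ?H"
      then obtain n' c' where b: "n' \<in> N" "b = n' \<oplus>\<^bsub>W\<^esub> c' \<odot>\<^bsub>W\<^esub> w"
        by auto
      have "a \<oplus>\<^bsub>W\<^esub> b = (n \<oplus>\<^bsub>W\<^esub> n') \<oplus>\<^bsub>W\<^esub> (c + c') \<odot>\<^bsub>W\<^esub> w"
        using a b NW w by (simp add: W.smult_add_left W.M.a_ac)
      then show "a \<oplus>\<^bsub>W\<^esub> b \<in> ?H"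
        using Nsm(3)[OF a(1) b(1)] by blast
    qed
    moreover have "?H \<inter> T ` carrier V \<subseteq> {\<zero>\<^bsub>W\<^esub>}"
    proof
      fix z assume "z \<in> ?H \<inter> T ` carrier V"
      then obtain n c x where z: "n \<in> N" "z = n \<oplus>\<^bsub>W\<^esub> c \<odot>\<^bsub>W\<^esub> w" "x \<in> carrier V" "z = T x"
        by auto
      have "c = 0"
      proof (rule ccontr)
        assume "c \<noteq> 0"
        have n: "n \<in> carrier W"
          using z(1) by (rule NW)
        have "T (inverse c \<odot>\<^bsub>V\<^esub> x) = inverse c \<odot>\<^bsub>W\<^esub> (n \<oplus>\<^bsub>W\<^esub> c \<odot>\<^bsub>W\<^esub> w)"
          using op_smult[OF z(3)] z(2,4) by simp
        also have "\<dots> = w \<oplus>\<^bsub>W\<^esub> inverse c \<odot>\<^bsub>W\<^esub> n"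
          using n w \<open>c \<noteq> 0\<close> by (simp add: W.smult_add_right W.M.a_comm)
        finally have "w \<ominus>\<^bsub>W\<^esub> T (inverse c \<odot>\<^bsub>V\<^esub> x) = (- inverse c) \<odot>\<^bsub>W\<^esub> n"
          using n w W.add_minus_cancel[of w "(- inverse c) \<odot>\<^bsub>W\<^esub> n"]
          by (simp add: W.smult_add_right W.minus_eq W.M.a_comm)
        then show False
          using no V.smult_in[OF z(3)] Nsm(4)[OF z(1), of "- inverse c"] by metis
      qed
      then show "z \<in> {\<zero>\<^bsub>W\<^esub>}"
        using N(2) z w NW[OF z(1)] by auto
    qed
    moreover have "N \<subseteq> ?H"
    proof
      fix n assume "n \<in> N"
      moreover from this have "n = n \<oplus>\<^bsub>W\<^esub> 0 \<odot>\<^bsub>W\<^esub> w"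
        using w NW by simp
      ultimately show "n \<in> ?H"
        by blast
    qed
    ultimately have "?H = N"
      by (rule max)
    moreover have "w = \<zero>\<^bsub>W\<^esub> \<oplus>\<^bsub>W\<^esub> 1 \<odot>\<^bsub>W\<^esub> w"
      using w by simp
    then have "w \<in> ?H"
      using Nsm(2) by blast
    ultimately have "w \<ominus>\<^bsub>W\<^esub> T \<zero>\<^bsub>V\<^esub> \<in> N"
      using w by simp
    then show False
      using no by blast
  qed
  then show ?thesis
    using that N by blast
qed

text \<open>Send \<open>w\<close> to the \<open>x\<close> for which \<open>w\<close> minus
  \<open>T x\<close> lies in the complement \<open>N\<close>. For two such \<open>x\<close>,
  \<open>T\<close> maps the difference into both the range and \<open>N\<close>, hence to 0.
  Additivity and homogeneity follow from this uniqueness.\<close>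

lemma (in bounded_op) linear_left_inverse:
  assumes inj: "\<And>x. \<lbrakk>x \<in> carrier V; T x = \<zero>\<^bsub>W\<^esub>\<rbrakk> \<Longrightarrow> x = \<zero>\<^bsub>V\<^esub>"
  obtains g where "\<And>w. w \<in> carrier W \<Longrightarrow> g w \<in> carrier V"
    "\<And>w z. \<lbrakk>w \<in> carrier W; z \<in> carrier W\<rbrakk> \<Longrightarrow> g (w \<oplus>\<^bsub>W\<^esub> z) = g w \<oplus>\<^bsub>V\<^esub> g z"
    "\<And>c w. w \<in> carrier W \<Longrightarrow> g (c \<odot>\<^bsub>W\<^esub> w) = c \<odot>\<^bsub>V\<^esub> g w"
    "\<And>x. x \<in> carrier V \<Longrightarrow> g (T x) = x"
proof -
  obtain N where N: "submodule N complex_ring W" "N \<inter> T ` carrier V \<subseteq> {\<zero>\<^bsub>W\<^esub>}"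
    and ex: "\<And>w. w \<in> carrier W \<Longrightarrow> \<exists>x\<in>carrier V. w \<ominus>\<^bsub>W\<^esub> T x \<in> N"
    using submodule_range_complement by metis
  note Nsm = submodule_complexD[OF N(1) W.module_axioms]
  define g where "g w = (SOME x. x \<in> carrier V \<and> w \<ominus>\<^bsub>W\<^esub> T x \<in> N)" for w
  have g: "g w \<in> carrier V" "w \<ominus>\<^bsub>W\<^esub> T (g w) \<in> N" if "w \<in> carrier W" for w
    using someI_ex[of "\<lambda>x. x \<in> carrier V \<and> w \<ominus>\<^bsub>W\<^esub> T x \<in> N"] ex[OF that] by (auto simp: g_def)
  have uniq: "g w = x" if "w \<in> carrier W" "x \<in> carrier V" "w \<ominus>\<^bsub>W\<^esub> T x \<in> N" for w x
  proof -
    have "(w \<ominus>\<^bsub>W\<^esub> T x) \<oplus>\<^bsub>W\<^esub> (-1) \<odot>\<^bsub>W\<^esub> (w \<ominus>\<^bsub>W\<^esub> T (g w)) = (w \<ominus>\<^bsub>W\<^esub> T x) \<ominus>\<^bsub>W\<^esub> (w \<ominus>\<^bsub>W\<^esub> T (g w))"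
      using that g(1)[OF that(1)] by (simp add: W.minus_eq)
    also have "\<dots> = T (g w \<ominus>\<^bsub>V\<^esub> x)"
      using that g(1)[OF that(1)] W.minus_minus_cancel[of "w \<ominus>\<^bsub>W\<^esub> T x" "w \<ominus>\<^bsub>W\<^esub> T (g w)" "\<zero>\<^bsub>W\<^esub>"]
        W.add_minus_add[of w "(-1) \<odot>\<^bsub>W\<^esub> T x" w "(-1) \<odot>\<^bsub>W\<^esub> T (g w)"] W.minus_eq_zero_iff[of w w]
      by (simp add: op_minus W.minus_eq W.smult_add_right W.M.a_comm)
    finally have "T (g w \<ominus>\<^bsub>V\<^esub> x) \<in> N"
      using Nsm(3)[OF that(3) Nsm(4)[OF g(2)[OF that(1)], of "-1"]] by simp
    then have "T (g w \<ominus>\<^bsub>V\<^esub> x) = \<zero>\<^bsub>W\<^esub>"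
      using N(2) that g(1)[OF that(1)] by auto
    then show ?thesis
      using inj[of "g w \<ominus>\<^bsub>V\<^esub> x"] that g(1)[OF that(1)] by (simp add: V.minus_eq_zero_iff)
  qed
  show ?thesis
  proof (rule that[OF g(1)])
    fix w z assume wz: "w \<in> carrier W" "z \<in> carrier W"
    show "g (w \<oplus>\<^bsub>W\<^esub> z) = g w \<oplus>\<^bsub>V\<^esub> g z"
      using wz g Nsm(3)[OF g(2)[OF wz(1)] g(2)[OF wz(2)]]
      by (intro uniq) (simp_all add: op_add W.add_minus_add)
  next
    fix w c assume w: "w \<in> carrier W"
    show "g (c \<odot>\<^bsub>W\<^esub> w) = c \<odot>\<^bsub>V\<^esub> g w"
      using w g Nsm(4)[OF g(2)[OF w], of c]
      by (intro uniq) (simp_all add: op_smult W.smult_minus)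
  next
    fix x assume "x \<in> carrier V"
    then show "g (T x) = x"
      using Nsm(2) by (intro uniq) (simp_all add: W.minus_eq_zero_iff[THEN iffD2])
  qed
qed

text \<open>Vector-valued polynomials of degree at most \<open>d\<close> in Horner form. Dividing \<open>f t - f b\<close> by \<open>t - b\<close>
  lowers the degree, so bounds propagate from a subinterval to \<open>[0, 1]\<close> by induction on \<open>d\<close>; this
  replaces Cauchy estimates.\<close>

primrec vpoly :: "'a cnspace \<Rightarrow> nat \<Rightarrow> (real \<Rightarrow> 'a) \<Rightarrow> bool" where
  "vpoly V 0 f \<longleftrightarrow> (\<exists>c\<in>carrier V. \<forall>t. f t = c)"
| "vpoly V (Suc d) f \<longleftrightarrow>
    (\<exists>c\<in>carrier V. \<exists>g. vpoly V d g \<and> (\<forall>t. f t = c \<oplus>\<^bsub>V\<^esub> complex_of_real t \<odot>\<^bsub>V\<^esub> g t))"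

context complex_normed_space
begin

lemma vpoly_in: "vpoly V d f \<Longrightarrow> f t \<in> carrier V"
  by (induction d arbitrary: f) auto

lemma vpoly_Suc: "vpoly V d f \<Longrightarrow> vpoly V (Suc d) f"
proof (induction d arbitrary: f)
  case 0
  then obtain c where "c \<in> carrier V" "\<And>t. f t = c"
    by auto
  then show ?case
    unfolding vpoly.simps by (intro bexI[of _ c] exI[of _ "\<lambda>t. \<zero>\<^bsub>V\<^esub>"]) auto
next
  case (Suc d)
  then obtain c g where "c \<in> carrier V" "vpoly V d g" "\<And>t. f t = c \<oplus>\<^bsub>V\<^esub> complex_of_real t \<odot>\<^bsub>V\<^esub> g t"
    by auto
  then show ?case
    using Suc.IH[of g] by (subst vpoly.simps(2)) blast
qed

lemma vpoly_add:
  "\<lbrakk>vpoly V d f; vpoly V d g\<rbrakk> \<Longrightarrow> vpoly V d (\<lambda>t. f t \<oplus>\<^bsub>V\<^esub> g t)"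
proof (induction d arbitrary: f g)
  case (Suc d)
  then obtain c f' k g' where *: "c \<in> carrier V" "vpoly V d f'" "\<And>t. f t = c \<oplus>\<^bsub>V\<^esub> complex_of_real t \<odot>\<^bsub>V\<^esub> f' t"
    "k \<in> carrier V" "vpoly V d g'" "\<And>t. g t = k \<oplus>\<^bsub>V\<^esub> complex_of_real t \<odot>\<^bsub>V\<^esub> g' t"
    by auto
  have "f t \<oplus>\<^bsub>V\<^esub> g t = (c \<oplus>\<^bsub>V\<^esub> k) \<oplus>\<^bsub>V\<^esub> complex_of_real t \<odot>\<^bsub>V\<^esub> (f' t \<oplus>\<^bsub>V\<^esub> g' t)" for t
    using * vpoly_in[OF *(2), of t] vpoly_in[OF *(5), of t] by (simp add: smult_add_right M.a_ac)
  then show ?case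
    using * Suc.IH[of f' g'] by auto
qed auto

lemma vpoly_add_mult:
  assumes "vpoly V d f" "vpoly V d g"
  shows "vpoly V (Suc d) (\<lambda>t. f t \<oplus>\<^bsub>V\<^esub> complex_of_real t \<odot>\<^bsub>V\<^esub> g t)"
proof (rule vpoly_add[OF vpoly_Suc[OF assms(1)]])
  show "vpoly V (Suc d) (\<lambda>t. complex_of_real t \<odot>\<^bsub>V\<^esub> g t)"
    using assms(2) vpoly_in[OF assms(2)] by (auto intro!: bexI[of _ "\<zero>\<^bsub>V\<^esub>"])
qed

text \<open>Synthetic division: from \<open>f t = c + t g(t)\<close> and
  \<open>g t = g(b) + (t - b) h(t)\<close> one gets
  \<open>f t = f(b) + (t - b) (g(b) + t h(t))\<close>, and the new quotient is again in Horner
  form.\<close>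

lemma vpoly_factor:
  "vpoly V (Suc d) f \<Longrightarrow>
    \<exists>g. vpoly V d g \<and> (\<forall>t. f t = f b \<oplus>\<^bsub>V\<^esub> complex_of_real (t - b) \<odot>\<^bsub>V\<^esub> g t)"
proof (induction d arbitrary: f)
  case 0
  then obtain c k where *: "c \<in> carrier V" "k \<in> carrier V" "\<And>t. f t = c \<oplus>\<^bsub>V\<^esub> complex_of_real t \<odot>\<^bsub>V\<^esub> k"
    by auto
  have "f t = f b \<oplus>\<^bsub>V\<^esub> complex_of_real (t - b) \<odot>\<^bsub>V\<^esub> k" for t
    using * smult_add_left[of k "complex_of_real b" "complex_of_real (t - b)"] by (simp add: M.a_assoc)
  moreover have "vpoly V 0 (\<lambda>t. k)"
    using *(2) by simp
  ultimately show ?case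
    by blast
next
  case (Suc d)
  then obtain c g where *: "c \<in> carrier V" "vpoly V (Suc d) g" "\<And>t. f t = c \<oplus>\<^bsub>V\<^esub> complex_of_real t \<odot>\<^bsub>V\<^esub> g t"
    by auto
  obtain h where h: "vpoly V d h" "\<And>t. g t = g b \<oplus>\<^bsub>V\<^esub> complex_of_real (t - b) \<odot>\<^bsub>V\<^esub> h t"
    using Suc.IH[OF *(2)] by blast
  let ?g = "\<lambda>t. g b \<oplus>\<^bsub>V\<^esub> complex_of_real t \<odot>\<^bsub>V\<^esub> h t"
  have "f t = f b \<oplus>\<^bsub>V\<^esub> complex_of_real (t - b) \<odot>\<^bsub>V\<^esub> ?g t" for t
  proof -
    have in_V: "g b \<in> carrier V" "h t \<in> carrier V"
      using vpoly_in *(2) h(1) by auto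
    have "f t = c \<oplus>\<^bsub>V\<^esub> complex_of_real (b + (t - b)) \<odot>\<^bsub>V\<^esub> g b \<oplus>\<^bsub>V\<^esub> complex_of_real (t * (t - b)) \<odot>\<^bsub>V\<^esub> h t"
      using * in_V by (subst *(3), subst h(2)) (simp add: smult_add_right M.a_assoc)
    also have "\<dots> = f b \<oplus>\<^bsub>V\<^esub> complex_of_real (t - b) \<odot>\<^bsub>V\<^esub> ?g t"
      unfolding of_real_add smult_add_left[OF in_V(1)] *(3)[of b]
      using * in_V by (simp add: smult_add_right M.a_assoc mult.commute)
    finally show ?thesis .
  qed
  moreover have "vpoly V (Suc d) ?g"
    using h(1) vpoly_in[OF *(2), of b] by auto
  ultimately show ?case
    by blast
qed

text \<open>\<open>K\<close> depends on the interval and the degree but not on \<open>f\<close>.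
  Passing to the left half \<open>[a, m]\<close> keeps \<open>t - b\<close> away from 0, so the
  quotient \<open>g\<close> is controlled there, and the induction hypothesis spreads its bound to
  \<open>[0, 1]\<close>.\<close>

lemma vpoly_bound:
  "\<lbrakk>0 < a; a < b; b \<le> 1\<rbrakk> \<Longrightarrow> \<exists>K\<ge>0. \<forall>f C. vpoly V d f \<and> (\<forall>t\<in>{a..b}. vnorm V (f t) \<le> C) \<longrightarrow>
    (\<forall>t\<in>{0..1}. vnorm V (f t) \<le> K * C)"
proof (induction d arbitrary: b)
  case 0
  then show ?case
    by (intro exI[of _ 1]) fastforce
next
  case (Suc d)
  define m where "m = (a + b) / 2"
  have m: "a < m" "m < b" "b - m = (b - a) / 2"
    using Suc.prems by (auto simp: m_def field_simps)
  obtain K where K: "0 \<le> K"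
    "\<And>f C t. \<lbrakk>vpoly V d f; \<forall>t\<in>{a..m}. vnorm V (f t) \<le> C; t \<in> {0..1}\<rbrakk> \<Longrightarrow> vnorm V (f t) \<le> K * C"
    using Suc.IH[of m] Suc.prems m by fastforce
  \<comment> \<open>On \<open>[a, m]\<close> the divisor has modulus at least
    \<open>(b - a) / 2\<close> and the numerator norm at most \<open>2 * C\<close>, whence
    \<open>4 * C / (b - a)\<close> for \<open>g\<close>; on \<open>[0, 1]\<close> the factor
    \<open>t - b\<close> has modulus at most 1.\<close>
  have "vnorm V (f t) \<le> (1 + 4 * K / (b - a)) * C"
    if f: "vpoly V (Suc d) f" "\<forall>t\<in>{a..b}. vnorm V (f t) \<le> C" and t: "t \<in> {0..1}" for f C t
  proof -
    obtain g where g: "vpoly V d g" "\<And>t. f t = f b \<oplus>\<^bsub>V\<^esub> complex_of_real (t - b) \<odot>\<^bsub>V\<^esub> g t"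
      using vpoly_factor[OF f(1)] by blast
    note in_V = vpoly_in[OF f(1)] vpoly_in[OF g(1)]
    have fb: "vnorm V (f b) \<le> C" and C: "0 \<le> C"
      using f(2) Suc.prems vnorm_nonneg[OF in_V(1)[of b]] by (auto intro: order_trans)
    have "vnorm V (g s) \<le> 4 * C / (b - a)" if s: "s \<in> {a..m}" for s
    proof -
      have "complex_of_real (s - b) \<odot>\<^bsub>V\<^esub> g s = f s \<ominus>\<^bsub>V\<^esub> f b"
        using g(2)[of s] minus_add_cancel[OF in_V(1)[of b] smult_in[OF in_V(2)[of s], of "complex_of_real (s - b)"]] by simp
      then have "\<bar>s - b\<bar> * vnorm V (g s) = vnorm V (f s \<ominus>\<^bsub>V\<^esub> f b)"
        using vnorm_smult[OF in_V(2)[of s], of "complex_of_real (s - b)"] by (simp only: norm_of_real)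
      also have "\<dots> \<le> 2 * C"
      proof -
        have "vnorm V (f s) \<le> C"
          using f(2) s m by auto
        then show ?thesis
          using vnorm_triangle_minus[OF in_V(1)[of s] in_V(1)[of b]] fb by linarith
      qed
      finally have "\<bar>s - b\<bar> * vnorm V (g s) \<le> 2 * C" .
      moreover have "(b - a) / 2 * vnorm V (g s) \<le> \<bar>s - b\<bar> * vnorm V (g s)"
        using s m vnorm_nonneg[OF in_V(2)[of s]] by (intro mult_right_mono) auto
      ultimately show ?thesis
        using Suc.prems by (simp add: field_simps)
    qed
    then have "vnorm V (g t) \<le> K * (4 * C / (b - a))"
      using K(2)[OF g(1)] t by blast
    moreover have "vnorm V (complex_of_real (t - b) \<odot>\<^bsub>V\<^esub> g t) \<le> vnorm V (g t)"
    proof -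
      have "\<bar>t - b\<bar> \<le> 1"
        using t Suc.prems by auto
      then show ?thesis
        unfolding vnorm_smult[OF in_V(2)] norm_of_real
        using vnorm_nonneg[OF in_V(2)[of t]] by (rule mult_left_le_one_le[OF _ abs_ge_zero, rotated 1])
    qed
    ultimately have "vnorm V (f t) \<le> C + K * (4 * C / (b - a))"
      using vnorm_triangle[OF in_V(1)[of b] smult_in[OF in_V(2)[of t], of "complex_of_real (t - b)"]] fb
      by (subst g(2)) linarith
    then show ?thesis
      by (simp add: algebra_simps)
  qed
  moreover have "0 \<le> 1 + 4 * K / (b - a)"
    using K(1) Suc.prems by simp
  ultimately show ?case
    by blast
qed

text \<open>The difference quotient at 0 has lower degree and is bounded by \<open>4 * C\<close> on
  \<open>[1/2, 1]\<close>, where the divisor is at least 1/2; \<open>vpoly_bound\<close> spreads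
  this to \<open>[0, 1]\<close>. As \<open>K\<close> is independent of \<open>f\<close>, one
  constant serves all segments at once.\<close>

lemma vpoly_lipschitz_at_0:
  "\<exists>K\<ge>0. \<forall>f C t. vpoly V d f \<and> (\<forall>t\<in>{0..1}. vnorm V (f t) \<le> C) \<and> t \<in> {0..1} \<longrightarrow>
    vnorm V (f t \<ominus>\<^bsub>V\<^esub> f 0) \<le> K * C * t"
proof (cases d)
  case 0
  then show ?thesis
    by (intro exI[of _ 0]) (auto simp: minus_eq_zero_iff[THEN iffD2])
next
  case (Suc e)
  obtain K where K: "0 \<le> K"
    "\<And>f C t. \<lbrakk>vpoly V e f; \<forall>t\<in>{1/2..1}. vnorm V (f t) \<le> C; t \<in> {0..1}\<rbrakk> \<Longrightarrow> vnorm V (f t) \<le> K * C"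
    using vpoly_bound[of "1/2" 1 e] by fastforce
  have "vnorm V (f t \<ominus>\<^bsub>V\<^esub> f 0) \<le> 4 * K * C * t"
    if f: "vpoly V (Suc e) f" "\<forall>t\<in>{0..1}. vnorm V (f t) \<le> C" and t: "t \<in> {0..1}" for f C t
  proof -
    obtain g where g: "vpoly V e g" "\<And>t. f t = f 0 \<oplus>\<^bsub>V\<^esub> complex_of_real (t - 0) \<odot>\<^bsub>V\<^esub> g t"
      using vpoly_factor[OF f(1), of 0] by blast
    note in_V = vpoly_in[OF f(1)] vpoly_in[OF g(1)]
    have diff: "vnorm V (f s \<ominus>\<^bsub>V\<^esub> f 0) = \<bar>s\<bar> * vnorm V (g s)" for s
      using g(2)[of s] minus_add_cancel[OF in_V(1)[of 0] smult_in[OF in_V(2)[of s], of "complex_of_real s"]]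
        vnorm_smult[OF in_V(2)[of s], of "complex_of_real s"] by simp
    have "vnorm V (g s) \<le> 4 * C" if s: "s \<in> {1/2..1}" for s
    proof -
      have "1 / 2 * vnorm V (g s) \<le> \<bar>s\<bar> * vnorm V (g s)"
        using s vnorm_nonneg[OF in_V(2)[of s]] by (intro mult_right_mono) auto
      also have "\<dots> \<le> vnorm V (f s) + vnorm V (f 0)"
        using vnorm_triangle_minus[OF in_V(1)[of s] in_V(1)[of 0]] by (simp add: diff)
      also have "\<dots> \<le> 2 * C"
        using f(2)[rule_format, of s] f(2)[rule_format, of 0] s by simp
      finally show ?thesis
        by simp
    qed
    then have "vnorm V (g t) \<le> K * (4 * C)"
      using K(2)[OF g(1)] t by blast
    then have "t * vnorm V (g t) \<le> t * (K * (4 * C))"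
      using t by (intro mult_left_mono) auto
    then show ?thesis
      using t by (simp add: diff mult_ac)
  qed
  then show ?thesis
    using K(1) Suc by (intro exI[of _ "4 * K"]) auto
qed

end

text \<open>The prefix \<open>xs\<close> is there for the induction: the entries of the constant
  block are moved into it one at a time, and linearity in that slot yields one factor
  \<open>c\<close>.\<close>

lemma multilinear_replicate_smult:
  assumes "complex_normed_space V" "complex_normed_space W" "multilinear m V W A" "x \<in> carrier V"
  shows "\<lbrakk>set xs \<subseteq> carrier V; length xs + j = m\<rbrakk> \<Longrightarrow>
    A (xs @ replicate j (c \<odot>\<^bsub>V\<^esub> x)) = c ^ j \<odot>\<^bsub>W\<^esub> A (xs @ replicate j x)"
proof (induction j arbitrary: xs)
  interpret V: complex_normed_space V by (rule assms)
  interpret W: complex_normed_space W by (rule assms)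
  have A: "A ys \<in> carrier W" if "set ys \<subseteq> carrier V" "length ys = m" for ys
    using assms(3) that unfolding multilinear_def by blast
  case 0
  then show ?case
    using A[of xs] by simp
next
  interpret V: complex_normed_space V by (rule assms)
  interpret W: complex_normed_space W by (rule assms)
  have A: "A ys \<in> carrier W" if "set ys \<subseteq> carrier V" "length ys = m" for ys
    using assms(3) that unfolding multilinear_def by blast
  case (Suc j)
  let ?ys = "xs @ x # replicate j (c \<odot>\<^bsub>V\<^esub> x)"
  have ys: "set ?ys \<subseteq> carrier V" "length ?ys = m"
    using Suc.prems assms(4) by auto
  have "length xs < m"
    using Suc.prems(2) by simp
  then have "A (?ys[length xs := c \<odot>\<^bsub>V\<^esub> x]) = c \<odot>\<^bsub>W\<^esub> A (?ys[length xs := x])"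
    using assms(3,4) ys unfolding multilinear_def by blast
  also have "A (?ys[length xs := x]) = A ((xs @ [x]) @ replicate j (c \<odot>\<^bsub>V\<^esub> x))"
    by simp
  also have "\<dots> = c ^ j \<odot>\<^bsub>W\<^esub> A ((xs @ [x]) @ replicate j x)"
    using Suc.prems assms(4) by (intro Suc.IH) auto
  finally show ?case
    using A[of "(xs @ [x]) @ replicate j x"] Suc.prems assms(4) by (auto simp: set_replicate_conv_if)
qed

text \<open>Expanding the first slot of the block gives a value at \<open>a\<close> plus
  \<open>t\<close> times a value at \<open>h\<close>, each with a block shorter by one. The degree
  thus grows by one per slot.\<close>

lemma multilinear_replicate_vpoly:
  assumes "complex_normed_space V" "complex_normed_space W" "multilinear m V W A"
    and "a \<in> carrier V" "h \<in> carrier V"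
  shows "\<lbrakk>set xs \<subseteq> carrier V; length xs + j = m\<rbrakk> \<Longrightarrow>
    vpoly W j (\<lambda>t. A (xs @ replicate j (a \<oplus>\<^bsub>V\<^esub> complex_of_real t \<odot>\<^bsub>V\<^esub> h)))"
proof (induction j arbitrary: xs)
  case 0
  then show ?case
    using assms(3) unfolding multilinear_def by auto
next
  interpret V: complex_normed_space V by (rule assms)
  interpret W: complex_normed_space W by (rule assms)
  case (Suc j)
  let ?z = "\<lambda>t. a \<oplus>\<^bsub>V\<^esub> complex_of_real t \<odot>\<^bsub>V\<^esub> h"
  have "A (xs @ replicate (Suc j) (?z t)) =
    A ((xs @ [a]) @ replicate j (?z t)) \<oplus>\<^bsub>W\<^esub> complex_of_real t \<odot>\<^bsub>W\<^esub> A ((xs @ [h]) @ replicate j (?z t))" for t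
  proof -
    let ?ys = "xs @ a # replicate j (?z t)"
    have ys: "length ?ys = m \<and> set ?ys \<subseteq> carrier V" and i: "length xs < m"
      using Suc.prems assms(4,5) by auto
    have lin: "A (?ys[length xs := u \<oplus>\<^bsub>V\<^esub> v]) = A (?ys[length xs := u]) \<oplus>\<^bsub>W\<^esub> A (?ys[length xs := v])"
      "A (?ys[length xs := c \<odot>\<^bsub>V\<^esub> u]) = c \<odot>\<^bsub>W\<^esub> A (?ys[length xs := u])"
      if "u \<in> carrier V" "v \<in> carrier V" for u v c
      using assms(3) ys i that unfolding multilinear_def by blast+
    show ?thesis
      using lin(1)[of a "complex_of_real t \<odot>\<^bsub>V\<^esub> h"] lin(2)[of h h "complex_of_real t"] assms(4,5) by simp
  qed
  moreover have "vpoly W j (\<lambda>t. A ((xs @ [a]) @ replicate j (?z t)))" "vpoly W j (\<lambda>t. A ((xs @ [h]) @ replicate j (?z t)))"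
    using Suc.prems assms(4,5) by (auto intro!: Suc.IH simp del: append_assoc)
  ultimately show ?case
    using W.vpoly_add_mult by simp
qed

lemma continuous_map_ntop_iff:
  assumes "complex_normed_space V" "complex_normed_space W"
  shows "continuous_map (ntop V) (ntop W) f \<longleftrightarrow> f ` carrier V \<subseteq> carrier W \<and>
    (\<forall>a\<in>carrier V. \<forall>e>0. \<exists>d>0. \<forall>x\<in>carrier V. vnorm V (x \<ominus>\<^bsub>V\<^esub> a) < d \<longrightarrow> vnorm W (f x \<ominus>\<^bsub>W\<^esub> f a) < e)"
proof -
  interpret V: complex_normed_space V by (rule assms)
  interpret W: complex_normed_space W by (rule assms)
  have V: "ndist V a x = vnorm V (x \<ominus>\<^bsub>V\<^esub> a)" if "a \<in> carrier V" "x \<in> carrier V" for a x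
    using that V.vnorm_minus_commute[of a x] by (simp add: V.ndist_eq)
  have W: "ndist W (f a) (f x) = vnorm W (f x \<ominus>\<^bsub>W\<^esub> f a)"
    if "f ` carrier V \<subseteq> carrier W" "a \<in> carrier V" "x \<in> carrier V" for a x
    using that W.vnorm_minus_commute[of "f a" "f x"] by (simp add: W.ndist_eq image_subset_iff)
  show ?thesis
    unfolding V.ntop_eq W.ntop_eq V.ntop.metric_continuous_map[OF W.Metric_space_ndist]
    by (simp add: Ball_def imp_conjL V W cong: imp_cong conj_cong)
qed

text \<open>Since \<open>A\<close> itself may be discontinuous, \<open>P\<close> is only restricted
  to segments of length at most 1 starting at \<open>a\<close>. There it is a vector polynomial of
  degree at most \<open>m\<close> with a known bound, which gives a Lipschitz estimate at
  \<open>a\<close>.\<close>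

lemma multilinear_imp_hom_poly:
  assumes "complex_normed_space V" "complex_normed_space W" "multilinear m V W A"
    and P: "\<And>x. x \<in> carrier V \<Longrightarrow> P x = A (replicate m x)"
    and C: "\<And>x. x \<in> uball V \<Longrightarrow> vnorm W (P x) \<le> C"
  shows "P \<in> hom_polys m V W"
proof -
  interpret V: complex_normed_space V by (rule assms)
  interpret W: complex_normed_space W by (rule assms)
  have PW: "P x \<in> carrier W" if "x \<in> carrier V" for x
    using assms(3) that P unfolding multilinear_def by (auto simp: set_replicate_conv_if)
  have hom: "P (c \<odot>\<^bsub>V\<^esub> x) = c ^ m \<odot>\<^bsub>W\<^esub> P x" if "x \<in> carrier V" for c x
    using multilinear_replicate_smult[OF assms(1-3) that, of "[]" m c] that P by simp
  have bound: "vnorm W (P x) \<le> r ^ m * C" if x: "x \<in> carrier V" "vnorm V x \<le> r" for x r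
  proof -
    obtain u where u: "u \<in> uball V" "x = complex_of_real r \<odot>\<^bsub>V\<^esub> u"
      using V.scaled_uball[OF x] by metis
    have r: "0 \<le> r"
      using V.vnorm_nonneg[OF x(1)] x(2) by simp
    have "vnorm W (P x) = r ^ m * vnorm W (P u)"
      using u r hom[of u] PW[of u] by (simp add: V.uball_iff W.vnorm_smult norm_power)
    then show ?thesis
      using C[OF u(1)] r by (simp add: mult_left_mono)
  qed
  obtain K where K: "0 \<le> K"
    "\<And>f C t. \<lbrakk>vpoly W m f; \<forall>t\<in>{0..1}. vnorm W (f t) \<le> C; t \<in> {0..1}\<rbrakk> \<Longrightarrow> vnorm W (f t \<ominus>\<^bsub>W\<^esub> f 0) \<le> K * C * t"
    using W.vpoly_lipschitz_at_0[of m] by blast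
  \<comment> \<open>The points of the segment have norm at most \<open>vnorm V a + 1\<close>, so
    homogeneity bounds \<open>P\<close> there by \<open>(vnorm V a + 1) ^ m * C\<close>.\<close>
  have lip: "vnorm W (P x \<ominus>\<^bsub>W\<^esub> P a) \<le> K * ((vnorm V a + 1) ^ m * C) * vnorm V (x \<ominus>\<^bsub>V\<^esub> a)"
    if a: "a \<in> carrier V" and x: "x \<in> carrier V" and le: "vnorm V (x \<ominus>\<^bsub>V\<^esub> a) \<le> 1" for a x
  proof -
    obtain h where h: "h \<in> uball V" "x \<ominus>\<^bsub>V\<^esub> a = complex_of_real (vnorm V (x \<ominus>\<^bsub>V\<^esub> a)) \<odot>\<^bsub>V\<^esub> h"
      using V.scaled_uball[of "x \<ominus>\<^bsub>V\<^esub> a", OF _ order_refl] a x by (metis V.minus_in)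
    have hV: "h \<in> carrier V" "vnorm V h \<le> 1"
      using h(1) by (auto simp: V.uball_iff)
    let ?f = "\<lambda>t. P (a \<oplus>\<^bsub>V\<^esub> complex_of_real t \<odot>\<^bsub>V\<^esub> h)"
    have "vpoly W m ?f"
      using multilinear_replicate_vpoly[OF assms(1-3) a hV(1), of "[]" m] a hV P by simp
    moreover have "\<forall>t\<in>{0..1}. vnorm W (?f t) \<le> (vnorm V a + 1) ^ m * C"
    proof
      fix t :: real assume t: "t \<in> {0..1}"
      have "vnorm V (complex_of_real t \<odot>\<^bsub>V\<^esub> h) \<le> 1"
        using t hV V.vnorm_nonneg[of h] by (simp add: V.vnorm_smult mult_le_one)
      then show "vnorm W (?f t) \<le> (vnorm V a + 1) ^ m * C"
        using a hV V.vnorm_triangle[of a "complex_of_real t \<odot>\<^bsub>V\<^esub> h"] by (intro bound) auto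
    qed
    moreover have "vnorm V (x \<ominus>\<^bsub>V\<^esub> a) \<in> {0..1}"
      using le a x V.vnorm_nonneg by auto
    ultimately have "vnorm W (?f (vnorm V (x \<ominus>\<^bsub>V\<^esub> a)) \<ominus>\<^bsub>W\<^esub> ?f 0) \<le> K * ((vnorm V a + 1) ^ m * C) * vnorm V (x \<ominus>\<^bsub>V\<^esub> a)"
      by (rule K(2))
    then show ?thesis
      using h(2)[symmetric] a x hV by simp
  qed
  have "continuous_map (ntop V) (ntop W) P"
    unfolding continuous_map_ntop_iff[OF assms(1,2)]
  proof (intro conjI ballI allI impI)
    fix a e assume a: "a \<in> carrier V" and e: "0 < (e::real)"
    define L where "L = K * ((vnorm V a + 1) ^ m * C)"
    have "0 \<le> C"
      using C[of "\<zero>\<^bsub>V\<^esub>"] W.vnorm_nonneg[OF PW[of "\<zero>\<^bsub>V\<^esub>"]] by simp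
    then have L: "0 \<le> L"
      using K(1) V.vnorm_nonneg[OF a] by (simp add: L_def)
    show "\<exists>d>0. \<forall>x\<in>carrier V. vnorm V (x \<ominus>\<^bsub>V\<^esub> a) < d \<longrightarrow> vnorm W (P x \<ominus>\<^bsub>W\<^esub> P a) < e"
    proof (intro exI[of _ "min 1 (e / (L + 1))"] conjI ballI impI)
      show "0 < min 1 (e / (L + 1))"
        using L e by simp
      fix x assume x: "x \<in> carrier V" "vnorm V (x \<ominus>\<^bsub>V\<^esub> a) < min 1 (e / (L + 1))"
      have "vnorm W (P x \<ominus>\<^bsub>W\<^esub> P a) \<le> L * vnorm V (x \<ominus>\<^bsub>V\<^esub> a)"
        unfolding L_def using x a by (intro lip) auto
      also have "\<dots> \<le> (L + 1) * vnorm V (x \<ominus>\<^bsub>V\<^esub> a)"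
        using V.vnorm_nonneg[of "x \<ominus>\<^bsub>V\<^esub> a"] x a by (intro mult_right_mono) auto
      also have "\<dots> < e"
        using x L by (simp add: field_simps)
      finally show "vnorm W (P x \<ominus>\<^bsub>W\<^esub> P a) < e" .
    qed
  qed (use PW in auto)
  then show ?thesis
    unfolding hom_polys_def using assms(3) P by blast
qed

text \<open>For the bound on the ball: continuity at 0 bounds \<open>P\<close> on a small ball, and
  homogeneity rescales that bound.\<close>

lemma hom_poly_props:
  assumes "complex_normed_space V" "complex_normed_space W" "P \<in> hom_polys m V W"
  shows hom_poly_in: "\<And>x. x \<in> carrier V \<Longrightarrow> P x \<in> carrier W"
    and hom_poly_smult: "\<And>c x. x \<in> carrier V \<Longrightarrow> P (c \<odot>\<^bsub>V\<^esub> x) = c ^ m \<odot>\<^bsub>W\<^esub> P x"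
    and hom_poly_bdd_above: "bdd_above ((\<lambda>x. vnorm W (P x)) ` uball V)"
proof -
  interpret V: complex_normed_space V by (rule assms)
  interpret W: complex_normed_space W by (rule assms)
  obtain A where A: "multilinear m V W A" "\<And>x. x \<in> carrier V \<Longrightarrow> P x = A (replicate m x)"
    and cont: "continuous_map (ntop V) (ntop W) P"
    using assms(3) by (auto simp: hom_polys_def)
  show PW: "P x \<in> carrier W" if "x \<in> carrier V" for x
    using A that unfolding multilinear_def by (auto simp: set_replicate_conv_if)
  show hom: "P (c \<odot>\<^bsub>V\<^esub> x) = c ^ m \<odot>\<^bsub>W\<^esub> P x" if "x \<in> carrier V" for c x
    using multilinear_replicate_smult[OF assms(1,2) A(1) that, of "[]" m c] that A(2) by simp
  have "\<exists>d>0. \<forall>x\<in>carrier V. vnorm V (x \<ominus>\<^bsub>V\<^esub> \<zero>\<^bsub>V\<^esub>) < d \<longrightarrow> vnorm W (P x \<ominus>\<^bsub>W\<^esub> P \<zero>\<^bsub>V\<^esub>) < 1"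
    using cont V.M.zero_closed zero_less_one unfolding continuous_map_ntop_iff[OF assms(1,2)] by blast
  then obtain d where d0: "0 < d"
      "\<forall>x\<in>carrier V. vnorm V (x \<ominus>\<^bsub>V\<^esub> \<zero>\<^bsub>V\<^esub>) < d \<longrightarrow> vnorm W (P x \<ominus>\<^bsub>W\<^esub> P \<zero>\<^bsub>V\<^esub>) < 1"
    by blast
  have d: "vnorm W (P x \<ominus>\<^bsub>W\<^esub> P \<zero>\<^bsub>V\<^esub>) < 1" if "x \<in> carrier V" "vnorm V x < d" for x
    using d0 that V.minus_zero[OF that(1)] by auto
  show "bdd_above ((\<lambda>x. vnorm W (P x)) ` uball V)"
  proof (rule bdd_aboveI2)
    fix x assume x: "x \<in> uball V"
    then have xV: "x \<in> carrier V" "vnorm V x \<le> 1"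
      by (auto simp: V.uball_iff)
    let ?z = "complex_of_real (d / 2) \<odot>\<^bsub>V\<^esub> x"
    have "vnorm V ?z = d / 2 * vnorm V x"
      using V.vnorm_smult[OF xV(1), of "complex_of_real (d / 2)"] d0(1) by (simp only: norm_of_real)
    also have "\<dots> < d"
      using xV d0(1) mult_left_le[of "vnorm V x" "d / 2"] by linarith
    finally have "vnorm W (P ?z \<ominus>\<^bsub>W\<^esub> P \<zero>\<^bsub>V\<^esub>) < 1"
      using d[of ?z] xV by blast
    \<comment> \<open>The value of \<open>P\<close> at 0 is kept, since for \<open>m = 0\<close> it
      need not vanish.\<close>
    moreover have "vnorm W (P ?z) \<le> vnorm W (P \<zero>\<^bsub>V\<^esub>) + vnorm W (P ?z \<ominus>\<^bsub>W\<^esub> P \<zero>\<^bsub>V\<^esub>)"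
      using W.vnorm_triangle[of "P \<zero>\<^bsub>V\<^esub>" "P ?z \<ominus>\<^bsub>W\<^esub> P \<zero>\<^bsub>V\<^esub>"] PW[of ?z] PW[of "\<zero>\<^bsub>V\<^esub>"] xV by simp
    moreover have "vnorm W (P ?z) = (d / 2) ^ m * vnorm W (P x)"
      unfolding hom[OF xV(1)] W.vnorm_smult[OF PW[OF xV(1)]] norm_power norm_of_real using d0(1) by simp
    ultimately have "(d / 2) ^ m * vnorm W (P x) \<le> vnorm W (P \<zero>\<^bsub>V\<^esub>) + 1"
      by simp
    then show "vnorm W (P x) \<le> (vnorm W (P \<zero>\<^bsub>V\<^esub>) + 1) / (d / 2) ^ m"
      using d0(1) by (simp add: pos_le_divide_eq mult.commute)
  qed
qed

section \<open>\<open>p\<close>-compact maps\<close>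

lemma eq_cInfI:
  fixes k :: real
  assumes "\<And>x. x \<in> S \<Longrightarrow> k \<le> x" "\<And>e. 0 < e \<Longrightarrow> \<exists>x\<in>S. x \<le> k + e"
  shows "k = Inf S"
proof (rule antisym)
  have "S \<noteq> {}"
    using assms(2)[of 1] by auto
  then show "k \<le> Inf S"
    using assms(1) by (rule cInf_greatest)
  show "Inf S \<le> k"
  proof (rule field_le_epsilon)
    fix e :: real assume "0 < e"
    then obtain x where "x \<in> S" "x \<le> k + e"
      using assms(2) by blast
    then show "Inf S \<le> k + e"
      using assms(1) by (intro cInf_lower2[of x]) (auto intro: bdd_belowI[of S k])
  qed
qed

context conjugate_sequences
begin

lemma rel_p_compact_iff:
  assumes "p \<noteq> \<infinity>"
  shows "rel_p_compact p q V K \<longleftrightarrow> (\<exists>y\<in>carrier (ell p V). K \<subseteq> pco q V y)"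
proof -
  have "ntop V closure_of pco q V y = pco q V y" if "y \<in> carrier (ell p V)" for y
    using closure_pco[OF that tail_tendsto_0[OF that assms]] .
  then show ?thesis
    using pco_subset unfolding rel_p_compact_def by blast
qed

lemma p_measure_le:
  assumes "y \<in> carrier (ell p V)" "K \<subseteq> pco q V y"
  shows "p_measure p q V K \<le> vnorm (ell p V) y"
  unfolding p_measure_def
  using assms by (intro cInf_lower) (auto intro!: bdd_belowI[of _ 0] simp: Lp.vnorm_nonneg)

text \<open>A covering sequence is assumed because the infimum of the empty set is an unspecified
  real.\<close>

lemma p_measure_nonneg:
  assumes "y \<in> carrier (ell p V)" "K \<subseteq> pco q V y"
  shows "0 \<le> p_measure p q V K"
  unfolding p_measure_def
  using assms by (intro cInf_greatest) (auto simp: Lp.vnorm_nonneg)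

lemma p_measure_witness:
  assumes "y \<in> carrier (ell p V)" "K \<subseteq> pco q V y" "0 < e"
  obtains z where "z \<in> carrier (ell p V)" "K \<subseteq> pco q V z" "vnorm (ell p V) z < p_measure p q V K + e"
proof -
  have "Inf {vnorm (ell p V) y |y. y \<in> carrier (ell p V) \<and> K \<subseteq> pco q V y} < p_measure p q V K + e"
    using assms(3) by (simp add: p_measure_def)
  then show ?thesis
    using that assms(1,2) cInf_lessD[of "{vnorm (ell p V) y |y. y \<in> carrier (ell p V) \<and> K \<subseteq> pco q V y}"] by blast
qed

text \<open>\<open>T\<close> maps a sequence covering \<open>K\<close> to one covering the image of
  \<open>K\<close>, with norm at most \<open>C\<close> times as large. The slack
  \<open>e / (C + 1)\<close> accounts for an infimum that is not attained and for
  \<open>C = 0\<close>.\<close>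

lemma p_measure_image:
  fixes W :: "'b cnspace"
  assumes "p \<noteq> \<infinity>" "bounded_op V W T" "conjugate_sequences W p q"
    and C: "0 \<le> C" "\<And>x. x \<in> carrier V \<Longrightarrow> vnorm W (T x) \<le> C * vnorm V x"
    and K: "rel_p_compact p q V K" and L: "L \<subseteq> T ` K"
  shows "rel_p_compact p q W L" "p_measure p q W L \<le> C * p_measure p q V K"
proof -
  interpret W: conjugate_sequences W p q
    by (rule assms)
  interpret T: bounded_op V W T
    by (rule assms)
  have img: "(\<lambda>n. T (y n)) \<in> carrier (ell p W)" "vnorm (ell p W) (\<lambda>n. T (y n)) \<le> C * vnorm (ell p V) y"
      "L \<subseteq> pco q W (\<lambda>n. T (y n))"
    if "y \<in> carrier (ell p V)" "K \<subseteq> pco q V y" for y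
    using T.ell_map[OF p_ge_1 that(1) C] pco_image[OF assms(2) W.abs_complete that(1)] L that(2) by blast+
  obtain y where y: "y \<in> carrier (ell p V)" "K \<subseteq> pco q V y"
    using K rel_p_compact_iff[OF assms(1)] by blast
  show "rel_p_compact p q W L"
    using img(1,3)[OF y] W.rel_p_compact_iff[OF assms(1)] by blast
  show "p_measure p q W L \<le> C * p_measure p q V K"
  proof (rule field_le_epsilon)
    fix e :: real assume "0 < e"
    then have "0 < e / (C + 1)"
      using C(1) by (simp add: add_nonneg_pos)
    then obtain z where z: "z \<in> carrier (ell p V)" "K \<subseteq> pco q V z" "vnorm (ell p V) z < p_measure p q V K + e / (C + 1)"
      using p_measure_witness[OF y] by blast
    have "p_measure p q W L \<le> vnorm (ell p W) (\<lambda>n. T (z n))"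
      using W.p_measure_le img[OF z(1,2)] by blast
    also have "\<dots> \<le> C * (p_measure p q V K + e / (C + 1))"
      using img(2)[OF z(1,2)] z(3) C(1) by (meson less_imp_le mult_left_mono order_trans)
    also have "\<dots> \<le> C * p_measure p q V K + e"
      using \<open>0 < e\<close> C(1) by (simp add: distrib_left divide_le_eq add_nonneg_pos mult.commute)
    finally show "p_measure p q W L \<le> C * p_measure p q V K + e" .
  qed
qed

lemma bounded_op_smult: "bounded_op V V (\<lambda>x. c \<odot>\<^bsub>V\<^esub> x)"
  unfolding bounded_op_def bounded_op_axioms_def bounded_ops_def
  by (auto simp: complex_normed_space_axioms smult_add_right vnorm_smult mult.commute intro!: exI[of _ "cmod c"])

text \<open>\<open>Q\<close> maps the unit ball into \<open>N\<close> times the unit ball of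
  \<open>U\<close>, so \<open>P\<close> maps it into \<open>N\<close> times the image of that ball
  under \<open>T\<close>. This is the half of the infimum formula that holds for every
  factorization.\<close>

lemma kappa_comp_hom_poly:
  fixes E :: "'b cnspace" and U :: "'c cnspace"
  assumes "p \<noteq> \<infinity>" "complex_normed_space E" "complex_normed_space U"
    and Q: "Q \<in> hom_polys m E U" and T: "T \<in> p_compact_ops p q U V"
    and P: "\<And>x. x \<in> carrier E \<Longrightarrow> P x = T (Q x)"
  shows "rel_p_compact p q V (P ` uball E)" "kappa p q E V P \<le> sup_norm E U Q * kappa p q U V T"
proof -
  interpret E: complex_normed_space E by (rule assms)
  interpret U: complex_normed_space U by (rule assms)
  interpret T: bounded_op U V T
    using T assms(3) complex_normed_space_axioms
    by (simp add: bounded_op_def bounded_op_axioms_def p_compact_ops_def)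
  define N where "N = sup_norm E U Q"
  have le: "vnorm U (Q x) \<le> N" if "x \<in> uball E" for x
    unfolding N_def sup_norm_def
    using hom_poly_bdd_above[OF assms(2,3) Q] that by (intro cSUP_upper)
  have N: "0 \<le> N"
    using le[of "\<zero>\<^bsub>E\<^esub>"] U.vnorm_nonneg[OF hom_poly_in[OF assms(2,3) Q, of "\<zero>\<^bsub>E\<^esub>"]] by simp
  have sub: "P ` uball E \<subseteq> (\<lambda>x. complex_of_real N \<odot>\<^bsub>V\<^esub> x) ` T ` uball U"
  proof (rule image_subsetI)
    fix x assume x: "x \<in> uball E"
    then have "x \<in> carrier E" "Q x \<in> carrier U"
      using hom_poly_in[OF assms(2,3) Q] by (auto simp: E.uball_iff)
    then obtain u where u: "u \<in> uball U" "Q x = complex_of_real N \<odot>\<^bsub>U\<^esub> u"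
      using U.scaled_uball[of "Q x" N] le[OF x] by blast
    then have "P x = complex_of_real N \<odot>\<^bsub>V\<^esub> T u"
      using P \<open>x \<in> carrier E\<close> by (simp add: T.op_smult U.uball_iff)
    then show "P x \<in> (\<lambda>x. complex_of_real N \<odot>\<^bsub>V\<^esub> x) ` T ` uball U"
      using u by blast
  qed
  note im = p_measure_image[OF assms(1) bounded_op_smult conjugate_sequences_axioms N _ _ sub]
  have bd: "vnorm V (complex_of_real N \<odot>\<^bsub>V\<^esub> x) \<le> N * vnorm V x" if "x \<in> carrier V" for x
    using that N by (simp add: vnorm_smult)
  have K: "rel_p_compact p q V (T ` uball U)"
    using T by (simp add: p_compact_ops_def)
  show "rel_p_compact p q V (P ` uball E)" "kappa p q E V P \<le> sup_norm E U Q * kappa p q U V T"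
    using im[OF bd K] by (simp_all add: kappa_def N_def)
qed

text \<open>Merges \<open>R\<close> and \<open>S\<close> into one operator of the kind required in
  (ii), at a cost of at most the norm of \<open>S\<close>.\<close>

lemma p_compact_ops_comp:
  fixes W :: "'b cnspace" and U :: "'c cnspace"
  assumes "p \<noteq> \<infinity>" "complex_normed_space U" "bounded_op V W S" "conjugate_sequences W p q"
    and R: "R \<in> p_compact_ops p q U V"
  shows "(\<lambda>x. S (R x)) \<in> p_compact_ops p q U W"
    and "kappa p q U W (\<lambda>x. S (R x)) \<le> sup_norm V W S * kappa p q U V R"
proof -
  interpret S: bounded_op V W S by (rule assms)
  interpret R: bounded_op U V R
    using R assms(2) complex_normed_space_axioms
    by (simp add: bounded_op_def bounded_op_axioms_def p_compact_ops_def)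
  obtain C where C: "0 \<le> C" "\<And>x. x \<in> carrier U \<Longrightarrow> vnorm V (R x) \<le> C * vnorm U x"
    using R.op_bound by metis
  have "vnorm W (S (R x)) \<le> (sup_norm V W S * C) * vnorm U x" if "x \<in> carrier U" for x
    using order_trans[OF S.vnorm_op_le_sup_norm[OF R.op_in[OF that]] mult_left_mono[OF C(2)[OF that] S.sup_norm_nonneg]]
    by (simp add: mult.assoc)
  then have op: "(\<lambda>x. S (R x)) \<in> bounded_ops U W"
    unfolding bounded_ops_def by (auto simp: R.op_add S.op_add R.op_smult S.op_smult)
  have K: "rel_p_compact p q V (R ` uball U)"
    using R by (simp add: p_compact_ops_def)
  have sub: "(\<lambda>x. S (R x)) ` uball U \<subseteq> S ` R ` uball U"
    by auto
  note im = p_measure_image[OF assms(1,3,4) S.sup_norm_nonneg S.vnorm_op_le_sup_norm K sub]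
  show "(\<lambda>x. S (R x)) \<in> p_compact_ops p q U W"
    "kappa p q U W (\<lambda>x. S (R x)) \<le> sup_norm V W S * kappa p q U V R"
    using op im by (simp_all add: p_compact_ops_def kappa_def)
qed

lemma quotient_ker_theta:
  assumes "y \<in> carrier (ell p V)"
  shows "quotient_normed_space Lq (ker_theta q V y)"
proof -
  interpret th: bounded_op Lq V "theta V y"
    by (rule bounded_op_theta[OF assms])
  show ?thesis
    using th.closed_subspace_kernel Lq.complex_normed_space_axioms
    by (simp add: quotient_normed_space_def quotient_normed_space_axioms_def ker_theta_def)
qed

text \<open>\<open>M\<close> and \<open>z\<close> are independent because two maps on the quotient
  by the kernel of \<open>theta V y\<close> are treated: \<open>T\<close>, induced by
  \<open>y\<close> itself, and \<open>R\<close>, induced by another sequence in another space.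
  Nothing is lost in passing to the quotient, as p-co of \<open>z\<close> is already closed.\<close>

lemma theta_lift_p_compact:
  assumes "p \<noteq> \<infinity>" "quotient_normed_space Lq M" "z \<in> carrier (ell p V)"
    and "bounded_op (quotient_space Lq M) V T"
    and T: "\<And>\<alpha>. \<alpha> \<in> carrier Lq \<Longrightarrow> T (M +>\<^bsub>Lq\<^esub> \<alpha>) = theta V z \<alpha>"
  shows "T \<in> p_compact_ops p q (quotient_space Lq M) V"
    "kappa p q (quotient_space Lq M) V T \<le> vnorm (ell p V) z"
proof -
  interpret X: quotient_normed_space Lq M by (rule assms)
  interpret T: bounded_op "quotient_space Lq M" V T by (rule assms)
  have "(\<lambda>\<alpha>. T (M +>\<^bsub>Lq\<^esub> \<alpha>)) ` uball Lq = pco q V z"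
    unfolding pco_eq[OF assms(3)] by (intro image_cong) (auto simp: T uball_def)
  then have "T ` uball (quotient_space Lq M) \<subseteq> pco q V z"
    using X.lift_uball_subset_closure[OF assms(4)] closure_pco[OF assms(3) tail_tendsto_0[OF assms(3,1)]] by simp
  then show "T \<in> p_compact_ops p q (quotient_space Lq M) V"
    "kappa p q (quotient_space Lq M) V T \<le> vnorm (ell p V) z"
    using rel_p_compact_iff[OF assms(1)] p_measure_le[OF assms(3)] assms(3) T.in_bounded_ops
    by (auto simp: p_compact_ops_def kappa_def)
qed

lemma hom_poly_lift:
  fixes E :: "'b cnspace"
  assumes "complex_normed_space E" "P \<in> hom_polys m E V" "y \<in> carrier (ell p V)"
    and "P ` uball E \<subseteq> pco q V y"
  obtains Q T where "Q \<in> hom_polys m E (lq_mod_ker q V y)" "sup_norm E (lq_mod_ker q V y) Q \<le> 1"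
    "bounded_op (lq_mod_ker q V y) V T"
    "\<And>\<alpha>. \<alpha> \<in> carrier Lq \<Longrightarrow> T (ker_theta q V y +>\<^bsub>Lq\<^esub> \<alpha>) = theta V y \<alpha>"
    "\<And>x. x \<in> carrier E \<Longrightarrow> P x = T (Q x)"
proof -
  interpret E: complex_normed_space E by (rule assms)
  interpret X: quotient_normed_space Lq "ker_theta q V y"
    by (rule quotient_ker_theta[OF assms(3)])
  let ?X = "lq_mod_ker q V y" and ?\<pi> = "\<lambda>\<alpha>. ker_theta q V y +>\<^bsub>Lq\<^esub> \<alpha>"
  have X: "?X = quotient_space Lq (ker_theta q V y)"
    by (simp add: lq_mod_ker_def)
  obtain T where T: "bounded_op ?X V T" "\<And>\<alpha>. \<alpha> \<in> carrier Lq \<Longrightarrow> T (?\<pi> \<alpha>) = theta V y \<alpha>"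
    using X.quotient_lift[OF bounded_op_theta[OF assms(3)]] unfolding X by (auto simp: ker_theta_def)
  interpret T: bounded_op ?X V T by (rule T)
  have inj: "A = \<zero>\<^bsub>?X\<^esub>" if A: "A \<in> carrier ?X" "T A = \<zero>\<^bsub>V\<^esub>" for A
  proof -
    obtain \<alpha> where \<alpha>: "\<alpha> \<in> carrier Lq" "A = ?\<pi> \<alpha>"
      using A(1) by (auto simp: X X.carrier_quotient)
    then have "\<alpha> \<in> ker_theta q V y"
      using A(2) T(2) by (simp add: ker_theta_def)
    then show ?thesis
      using \<alpha> X.coset_eq_iff[of \<alpha> "\<zero>\<^bsub>Lq\<^esub>"] by (simp add: X X.quotient_zero del: ell_ops)
  qed
  obtain g where g: "\<And>w. w \<in> carrier V \<Longrightarrow> g w \<in> carrier ?X"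
    "\<And>w z. \<lbrakk>w \<in> carrier V; z \<in> carrier V\<rbrakk> \<Longrightarrow> g (w \<oplus>\<^bsub>V\<^esub> z) = g w \<oplus>\<^bsub>?X\<^esub> g z"
    "\<And>c w. w \<in> carrier V \<Longrightarrow> g (c \<odot>\<^bsub>V\<^esub> w) = c \<odot>\<^bsub>?X\<^esub> g w"
    "\<And>A. A \<in> carrier ?X \<Longrightarrow> g (T A) = A"
    using T.linear_left_inverse[OF inj] by metis
  obtain A where A: "multilinear m E V A" "\<And>x. x \<in> carrier E \<Longrightarrow> P x = A (replicate m x)"
    using assms(2) by (auto simp: hom_polys_def)
  have rep: "\<exists>\<alpha>\<in>uball Lq. P x = T (?\<pi> \<alpha>)" if "x \<in> uball E" for x
  proof -
    have "P x \<in> theta V y ` uball Lq"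
      using assms(4) that unfolding pco_eq[OF assms(3)] by blast
    then obtain \<alpha> where "\<alpha> \<in> uball Lq" "P x = theta V y \<alpha>"
      by blast
    then show ?thesis
      using T(2)[of \<alpha>] by (auto simp: uball_def)
  qed
  \<comment> \<open>\<open>P x\<close> is the image under \<open>T\<close> of a coset of norm at
    most 1, and \<open>g\<close> recovers exactly that coset.\<close>
  have ball: "g (P x) \<in> uball ?X" "T (g (P x)) = P x" if x: "x \<in> uball E" for x
  proof -
    obtain \<alpha> where \<alpha>: "\<alpha> \<in> uball Lq" "P x = T (?\<pi> \<alpha>)"
      using rep[OF x] by blast
    then have "?\<pi> \<alpha> \<in> uball ?X"
      using X.vnorm_coset_le[of \<alpha>] by (auto simp: uball_def X X.carrier_quotient)
    then show "g (P x) \<in> uball ?X" "T (g (P x)) = P x"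
      using \<alpha> g(4) by (auto simp: uball_def)
  qed
  \<comment> \<open>\<open>A\<close> may leave the range of \<open>T\<close>, so the globally
    defined \<open>g\<close> takes the place of the inverse of \<open>T\<close>.\<close>
  have "multilinear m E ?X (\<lambda>xs. g (A xs))"
    unfolding multilinear_def
  proof (intro allI impI conjI ballI)
    fix xs assume xs: "length xs = m \<and> set xs \<subseteq> carrier E"
    have AV: "A (xs[i := u]) \<in> carrier V" if "u \<in> carrier E" for i u
      using A(1) xs that set_update_subsetI[of xs "carrier E" u i] unfolding multilinear_def by auto
    show "g (A xs) \<in> carrier ?X"
      using A(1) xs g(1) unfolding multilinear_def by auto
    fix i assume i: "i < m"
    show "g (A (xs[i := u \<oplus>\<^bsub>E\<^esub> v])) = g (A (xs[i := u])) \<oplus>\<^bsub>?X\<^esub> g (A (xs[i := v]))"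
      if uv: "u \<in> carrier E" "v \<in> carrier E" for u v
    proof -
      have "A (xs[i := u \<oplus>\<^bsub>E\<^esub> v]) = A (xs[i := u]) \<oplus>\<^bsub>V\<^esub> A (xs[i := v])"
        using A(1) xs i uv unfolding multilinear_def by blast
      then show ?thesis
        using g(2) AV uv by simp
    qed
    show "g (A (xs[i := c \<odot>\<^bsub>E\<^esub> u])) = c \<odot>\<^bsub>?X\<^esub> g (A (xs[i := u]))"
      if u: "u \<in> carrier E" for u c
    proof -
      have "A (xs[i := c \<odot>\<^bsub>E\<^esub> u]) = c \<odot>\<^bsub>V\<^esub> A (xs[i := u])"
        using A(1) xs i u unfolding multilinear_def by blast
      then show ?thesis
        using g(3) AV u by simp
    qed
  qed
  then have Q: "(\<lambda>x. g (P x)) \<in> hom_polys m E ?X"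
    using A(2) ball(1)
    by (intro multilinear_imp_hom_poly[OF assms(1) T.V.complex_normed_space_axioms]) (auto simp: uball_def)
  \<comment> \<open>The covering by p-co is known only for points of the ball; homogeneity of
    \<open>P\<close> and linearity of \<open>g\<close> and \<open>T\<close> carry the identity to
    the whole space.\<close>
  have fac: "P x = T (g (P x))" if x: "x \<in> carrier E" for x
  proof -
    obtain u where u: "u \<in> uball E" "x = complex_of_real (vnorm E x) \<odot>\<^bsub>E\<^esub> u"
      using E.scaled_uball[OF x order_refl] by blast
    define c where "c = complex_of_real (vnorm E x) ^ m"
    have uE: "u \<in> carrier E"
      using u by (simp add: uball_def)
    have PV: "P u \<in> carrier V"
      using hom_poly_in[OF assms(1) complex_normed_space_axioms assms(2) uE] .
    have "P x = c \<odot>\<^bsub>V\<^esub> P u"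
      using hom_poly_smult[OF assms(1) complex_normed_space_axioms assms(2) uE, of "complex_of_real (vnorm E x)"]
      by (simp add: c_def flip: u(2))
    then show ?thesis
      using g(1,3) ball(2)[OF u(1)] PV by (simp add: T.op_smult)
  qed
  have "sup_norm E ?X (\<lambda>x. g (P x)) \<le> 1"
    unfolding sup_norm_def using ball(1) E.zero_in_uball by (intro cSUP_least) (auto simp: uball_def)
  then show ?thesis
    using that[of "\<lambda>x. g (P x)" T] Q T fac by blast
qed

end

section \<open>Factorization through \<open>\<ell>\<^sub>1\<close>\<close>

text \<open>The weights are multiples of the square roots of the tails \<open>t\<^sub>n = \<Sum>k\<ge>n. b\<^sub>k\<close>, because
  \<open>b\<^sub>n / \<surd>t\<^sub>n \<le> 2 (\<surd>t\<^sub>n - \<surd>t\<^sub>n\<^sub>+\<^sub>1)\<close> telescopes.\<close>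

lemma summable_divide_null_sequence:
  fixes b :: "nat \<Rightarrow> real"
  assumes b: "\<And>n. 0 \<le> b n" and sm: "summable b" and e: "0 < e"
  obtains \<gamma> where "\<And>n. 0 \<le> \<gamma> n" "\<And>n. \<gamma> n \<le> 1" "\<gamma> \<longlonglongrightarrow> 0" "\<And>n. \<gamma> n = 0 \<Longrightarrow> b n = 0"
    "summable (\<lambda>n. b n / \<gamma> n)" "(\<Sum>n. b n / \<gamma> n) \<le> (\<Sum>n. b n) + e"
proof -
  define t where "t n = (\<Sum>k. b (k + n))" for n
  have smt: "summable (\<lambda>k. b (k + n))" for n
    using sm by (simp add: summable_iff_shift)
  have t0: "0 \<le> t n" for n
    unfolding t_def using smt b by (intro suminf_nonneg)
  have tS: "t n = b n + t (Suc n)" for n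
    using suminf_split_head[OF smt[of n]] by (simp add: t_def)
  have "t = (\<lambda>n. (\<Sum>k. b k) - (\<Sum>k<n. b k))"
    unfolding t_def using sm by (intro ext suminf_minus_initial_segment)
  then have tlim: "t \<longlonglongrightarrow> 0"
    using tendsto_diff[OF tendsto_const[of "\<Sum>k. b k"] summable_LIMSEQ[OF sm]] by simp
  \<comment> \<open>\<open>K\<close> is chosen so that the telescoped bound
    \<open>2 / K * (sqrt (t 0) + 1)\<close> is exactly \<open>e\<close>; the added 1 keeps
    \<open>K\<close> positive when all \<open>b n\<close> vanish.\<close>
  define K where "K = 2 * (sqrt (t 0) + 1) / e"
  have K: "0 < K"
    using e t0[of 0] by (simp add: K_def add_nonneg_pos)
  \<comment> \<open>Because of the cap at 1, \<open>b n / \<gamma> n\<close> is either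
    \<open>b n\<close> or \<open>b n / (K * sqrt (t n))\<close>, so the sum of the two is an upper
    bound.\<close>
  define \<gamma> where "\<gamma> n = min 1 (K * sqrt (t n))" for n
  have g0: "0 \<le> \<gamma> n" for n
    using K t0 by (simp add: \<gamma>_def)
  have gz: "b n = 0" if "\<gamma> n = 0" for n
  proof -
    have "t n = 0"
      using that K t0[of n] by (simp add: \<gamma>_def min_def split: if_splits)
    then show ?thesis
      using tS[of n] b[of n] t0[of "Suc n"] by linarith
  qed
  have "(\<lambda>n. K * sqrt (t n)) \<longlonglongrightarrow> K * sqrt 0"
    by (intro tendsto_intros tlim)
  then have glim: "\<gamma> \<longlonglongrightarrow> 0"
    using K t0 by (intro tendsto_sandwich[of "\<lambda>_. 0" \<gamma> _ "\<lambda>n. K * sqrt (t n)"]) (auto simp: \<gamma>_def)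
  have step: "b n / \<gamma> n \<le> b n + 2 / K * (sqrt (t n) - sqrt (t (Suc n)))" for n
  proof (cases "t n = 0")
    \<comment> \<open>A vanishing tail makes both \<open>b n\<close> and \<open>\<gamma> n\<close>
      zero, and \<open>0 / 0 = 0\<close>.\<close>
    case True
    then have "b n = 0" "t (Suc n) = 0"
      using tS[of n] b[of n] t0[of "Suc n"] by linarith+
    then show ?thesis
      using True by simp
  next
    case False
    then have tp: "0 < t n"
      using t0[of n] by simp
    have dn: "sqrt (t (Suc n)) \<le> sqrt (t n)"
      using tS[of n] b[of n] by simp
    have "b n = (sqrt (t n) - sqrt (t (Suc n))) * (sqrt (t n) + sqrt (t (Suc n)))"
      using tS[of n] t0[of "Suc n"] b[of n] by (simp add: algebra_simps)
    also have "\<dots> \<le> (sqrt (t n) - sqrt (t (Suc n))) * (2 * sqrt (t n))"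
      using dn by (intro mult_left_mono) auto
    finally have "b n / (K * sqrt (t n)) \<le> (sqrt (t n) - sqrt (t (Suc n))) * (2 * sqrt (t n)) / (K * sqrt (t n))"
      using K t0[of n] by (intro divide_right_mono) auto
    also have "\<dots> = 2 / K * (sqrt (t n) - sqrt (t (Suc n)))"
      using tp by simp
    finally have "b n / (K * sqrt (t n)) \<le> 2 / K * (sqrt (t n) - sqrt (t (Suc n)))" .
    moreover have "b n / \<gamma> n \<le> b n + b n / (K * sqrt (t n))"
      using tp K b[of n] by (auto simp: \<gamma>_def min_def)
    ultimately show ?thesis
      by linarith
  qed
  have bound: "(\<Sum>n<N. b n / \<gamma> n) \<le> (\<Sum>n. b n) + e" for N
  proof -
    have "(\<Sum>n<N. b n / \<gamma> n) \<le> (\<Sum>n<N. b n + 2 / K * (sqrt (t n) - sqrt (t (Suc n))))"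
      by (intro sum_mono step)
    also have "\<dots> = (\<Sum>n<N. b n) + 2 / K * (sqrt (t 0) - sqrt (t N))"
      using sum_lessThan_telescope'[of "\<lambda>n. sqrt (t n)" N]
      by (simp only: sum.distrib flip: sum_distrib_left)
    also have "\<dots> \<le> (\<Sum>n. b n) + 2 / K * (sqrt (t 0) + 1)"
      using sum_le_suminf[OF sm, of "{..<N}"] b K t0[of N]
      by (intro add_mono mult_left_mono) (auto intro: order_trans[of _ 0])
    also have "2 / K * (sqrt (t 0) + 1) = e"
      using e t0[of 0] by (simp add: K_def field_simps add_nonneg_eq_0_iff)
    finally show ?thesis .
  qed
  have "summable (\<lambda>n. b n / \<gamma> n)"
    using bound b g0 by (intro summableI_nonneg_bounded) auto
  moreover from this have "(\<Sum>n. b n / \<gamma> n) \<le> (\<Sum>n. b n) + e"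
    using bound by (intro suminf_le_const)
  ultimately show ?thesis
    using that[of \<gamma>] g0 gz glim by (auto simp: \<gamma>_def)
qed

text \<open>The previous lemma is applied to the powers \<open>a n powr s\<close>, and its weights
  are raised to the power \<open>1 / s\<close>. Where \<beta> vanishes so does \<open>a\<close>, so
  the convention \<open>x / 0 = 0\<close> loses no term.\<close>

lemma lr_divide_null_sequence:
  assumes "1 \<le> r" "r \<noteq> \<infinity>" and a: "\<And>n. 0 \<le> a n" "lr_mem r a" and e: "0 < e"
  obtains \<beta> where "\<And>n. 0 \<le> \<beta> n" "\<And>n. \<beta> n \<le> 1" "\<beta> \<longlonglongrightarrow> 0" "\<And>n. \<beta> n = 0 \<Longrightarrow> a n = 0"
    "lr_mem r (\<lambda>n. a n / \<beta> n)" "lr_norm r (\<lambda>n. a n / \<beta> n) \<le> lr_norm r a + e"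
proof -
  define s where "s = enn2real r"
  have s: "1 \<le> s"
    using enn2real_ge_1[OF assms(1,2)] by (simp add: s_def)
  have sm: "summable (\<lambda>n. a n powr s)"
    using a assms(2) by (simp add: lr_mem_def s_def)
  define A where "A = lr_norm r a"
  have A0: "0 \<le> A"
    using lr_norm_nonneg[OF a] by (simp add: A_def)
  have As: "A powr s = (\<Sum>n. a n powr s)"
    using s assms(2) sm by (simp add: A_def lr_norm_def powr_powr suminf_nonneg flip: s_def)
  \<comment> \<open>The sum of powers may grow by this much, so that the new norm is at most
    \<open>A + e\<close>.\<close>
  have "0 < (A + e) powr s - A powr s"
    using A0 e s powr_less_mono2[of s A "A + e"] by simp
  then obtain \<gamma> where \<gamma>: "\<And>n. 0 \<le> \<gamma> n" "\<And>n. \<gamma> n \<le> 1" "\<gamma> \<longlonglongrightarrow> 0" "\<And>n. \<gamma> n = 0 \<Longrightarrow> a n powr s = 0"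
    "summable (\<lambda>n. a n powr s / \<gamma> n)" "(\<Sum>n. a n powr s / \<gamma> n) \<le> (\<Sum>n. a n powr s) + ((A + e) powr s - A powr s)"
    using summable_divide_null_sequence[of "\<lambda>n. a n powr s", OF _ sm] powr_ge_zero by blast
  define \<beta> where "\<beta> n = \<gamma> n powr (1 / s)" for n
  have eq: "(a n / \<beta> n) powr s = a n powr s / \<gamma> n" for n
    using a(1) \<gamma>(1) s by (simp add: \<beta>_def powr_divide powr_powr)
  have "lr_norm r (\<lambda>n. a n / \<beta> n) = (\<Sum>n. a n powr s / \<gamma> n) powr (1 / s)"
    using assms(2) by (simp add: lr_norm_def eq flip: s_def)
  also have "\<dots> \<le> ((A + e) powr s) powr (1 / s)"
    using \<gamma> s As by (intro powr_mono2 suminf_nonneg) auto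
  also have "\<dots> = A + e"
    using s A0 e by (simp add: powr_powr)
  finally have "lr_norm r (\<lambda>n. a n / \<beta> n) \<le> A + e" .
  moreover have "lr_mem r (\<lambda>n. a n / \<beta> n)"
    using \<gamma>(5) assms(2) by (simp add: lr_mem_def eq flip: s_def)
  moreover have "\<beta> \<longlonglongrightarrow> 0"
  proof -
    have "(\<lambda>n. \<gamma> n powr (1 / s)) \<longlonglongrightarrow> 0 powr (1 / s)"
      using \<gamma>(1,3) s by (intro tendsto_powr' tendsto_const) auto
    then show ?thesis
      by (simp add: \<beta>_def[abs_def])
  qed
  moreover have "\<beta> n \<le> 1" for n
    using powr_mono2[of "1 / s" "\<gamma> n" 1] \<gamma>(1,2)[of n] s by (simp add: \<beta>_def)
  moreover have "a n = 0" if "\<beta> n = 0" for n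
    using that \<gamma>(4)[of n] by (simp add: \<beta>_def)
  ultimately show ?thesis
    using that[of \<beta>] by (simp add: \<beta>_def A_def)
qed

lemma (in complex_normed_space) nsuminf_single:
  assumes "z \<in> carrier V"
  shows "nsuminf V (\<lambda>k. if k = n then z else \<zero>\<^bsub>V\<^esub>) = z"
proof (rule nsuminf_eqI)
  let ?f = "\<lambda>k. if k = n then z else \<zero>\<^bsub>V\<^esub>"
  have sum: "finsum V ?f {..<N} = (if n < N then z else \<zero>\<^bsub>V\<^esub>)" for N
    using assms by (induction N) (auto simp: finsum_lessThan_Suc less_Suc_eq)
  show "limitin (ntop V) (\<lambda>N. finsum V ?f {..<N}) z sequentially"
    unfolding sum using assms
    by (auto simp: limitin_ntop_iff eventually_sequentially minus_eq_zero_iff[THEN iffD2]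
        intro!: tendsto_eventually exI[of _ "Suc n"])
qed

lemma ell1_single:
  assumes "0 \<le> c"
  shows "(\<lambda>k. if k = n then complex_of_real c else 0) \<in> carrier (ell 1 complex_space)"
    "vnorm (ell 1 complex_space) (\<lambda>k. if k = n then complex_of_real c else 0) \<le> c"
proof -
  have "(\<Sum>k<N. if k = n then c else 0) \<le> c" for N
    using assms by (simp add: sum.delta)
  moreover have "cmod (if k = n then complex_of_real c else 0) = (if k = n then c else 0)" for k
    using assms by simp
  ultimately have "lr_mem 1 (\<lambda>k. cmod (if k = n then complex_of_real c else 0)) \<and>
      lr_norm 1 (\<lambda>k. cmod (if k = n then complex_of_real c else 0)) \<le> c"
    using assms by (subst lr_ball_iff) (auto simp: if_distrib[of "\<lambda>x. x powr _"] cong: if_cong)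
  then show "(\<lambda>k. if k = n then complex_of_real c else 0) \<in> carrier (ell 1 complex_space)"
    "vnorm (ell 1 complex_space) (\<lambda>k. if k = n then complex_of_real c else 0) \<le> c"
    by (simp_all add: carrier_ell vnorm_ell)
qed

context conjugate_sequences
begin

text \<open>\<open>\<theta>\<^sub>y\<close> factors through \<open>\<ell>\<^sub>1\<close> as the diagonal operator with entries \<open>\<parallel>y\<^sub>n\<parallel> / \<beta>\<^sub>n\<close> followed by
  \<open>e\<^sub>n \<mapsto> (\<beta>\<^sub>n / \<parallel>y\<^sub>n\<parallel>) y\<^sub>n\<close>. The latter is compact because \<open>\<beta>\<^sub>n \<rightarrow> 0\<close>, and dividing \<open>\<ell>\<^sub>1\<close> by its kernel
  makes the former well defined on \<open>\<ell>\<^sub>q / ker \<theta>\<^sub>y\<close>.\<close>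

lemma theta_factors_through_l1_mod:
  assumes "p \<noteq> \<infinity>" and y: "y \<in> carrier (ell p V)" and e: "0 < e"
  obtains M R S where "closed_subspace M (ell 1 complex_space)"
    "R \<in> p_compact_ops p q (lq_mod_ker q V y) (l1_mod M)"
    "kappa p q (lq_mod_ker q V y) (l1_mod M) R \<le> vnorm (ell p V) y + e"
    "S \<in> compact_ops (l1_mod M) V" "sup_norm (l1_mod M) V S \<le> 1"
    "\<And>\<alpha>. \<alpha> \<in> carrier Lq \<Longrightarrow> S (R (ker_theta q V y +>\<^bsub>Lq\<^esub> \<alpha>)) = theta V y \<alpha>"
proof -
  have yn: "y n \<in> carrier V" "0 \<le> vnorm V (y n)" for n
    using y_in[OF y] by (auto simp: vnorm_nonneg)
  obtain \<beta> where \<beta>: "\<And>n. 0 \<le> \<beta> n" "\<And>n. \<beta> n \<le> 1" "\<beta> \<longlonglongrightarrow> 0" "\<And>n. \<beta> n = 0 \<Longrightarrow> vnorm V (y n) = 0"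
    "lr_mem p (\<lambda>n. vnorm V (y n) / \<beta> n)" "lr_norm p (\<lambda>n. vnorm V (y n) / \<beta> n) \<le> vnorm (ell p V) y + e"
    using lr_divide_null_sequence[OF p_ge_1 assms(1), of "\<lambda>n. vnorm V (y n)", OF yn(2) _ e] y
    by (auto simp: carrier_ell vnorm_ell)
  define \<zeta> where "\<zeta> n = vnorm V (y n) / \<beta> n" for n
  \<comment> \<open>If \<open>y n\<close> is zero, division by zero makes the coefficient of
    \<open>v n\<close> vanish and \<open>\<zeta> n\<close> is 0 as well, so \<open>\<zeta> n\<close>
    times \<open>v n\<close> is still \<open>y n\<close>.\<close>
  define v where "v n = complex_of_real (\<beta> n / vnorm V (y n)) \<odot>\<^bsub>V\<^esub> y n" for n
  have \<zeta>0: "0 \<le> \<zeta> n" for n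
    using \<beta>(1) yn(2) by (simp add: \<zeta>_def)
  have v_in: "v n \<in> carrier V" for n
    using yn by (simp add: v_def)
  have \<zeta>v: "complex_of_real (\<zeta> n) \<odot>\<^bsub>V\<^esub> v n = y n" for n
  proof (cases "vnorm V (y n) = 0")
    case True
    then show ?thesis
      using yn[of n] vnorm_eq_0_iff[of "y n"] by (simp add: v_def)
  next
    case False
    then have "\<zeta> n * (\<beta> n / vnorm V (y n)) = 1"
      using \<beta>(4)[of n] by (auto simp: \<zeta>_def)
    then have "complex_of_real (\<zeta> n) * complex_of_real (\<beta> n / vnorm V (y n)) = 1"
      by (simp only: flip: of_real_mult) simp
    then show ?thesis
      using yn(1)[of n] by (simp add: v_def del: of_real_divide)
  qed
  have v_norm: "vnorm V (v n) \<le> \<beta> n" for n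
  proof -
    have "vnorm V (v n) = \<bar>\<beta> n / vnorm V (y n)\<bar> * vnorm V (y n)"
      unfolding v_def vnorm_smult[OF yn(1)] norm_of_real ..
    then show ?thesis
      using \<beta>(1)[of n] yn(2)[of n] by (cases "vnorm V (y n) = 0") auto
  qed
  let ?L = "ell 1 complex_space"
  \<comment> \<open>With exponents \<infinity> and 1, \<open>theta V v\<close> is the operator on
    \<open>\<ell>\<^sub>1\<close> that sends the unit vectors to the \<open>v n\<close>; the results
    on kernels, closures and compactness apply to it.\<close>
  interpret V1: conjugate_sequences V \<infinity> 1
    using abs_complete by unfold_locales (simp_all add: divide_ennreal_def)
  have v_mem: "lr_mem \<infinity> (\<lambda>n. vnorm V (v n)) \<and> lr_norm \<infinity> (\<lambda>n. vnorm V (v n)) \<le> 1"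
    using order_trans[OF v_norm \<beta>(2)] v_in by (subst lr_ball_iff) (auto simp: vnorm_nonneg)
  have v: "v \<in> carrier (ell \<infinity> V)" "vnorm (ell \<infinity> V) v \<le> 1"
    using v_mem v_in by (simp_all add: carrier_ell vnorm_ell)
  \<comment> \<open>Tails need not vanish for the exponent \<infinity>; here they do because \<beta>
    dominates the norms of the \<open>v n\<close> and tends to 0.\<close>
  have v_tail: "(\<lambda>N. lr_norm \<infinity> (\<lambda>n. if n < N then 0 else vnorm V (v n))) \<longlonglongrightarrow> 0"
  proof (rule LIMSEQ_I)
    fix r :: real assume "0 < r"
    then have "\<forall>\<^sub>F n in sequentially. \<beta> n < r / 2"
      using \<beta>(3) by (intro order_tendstoD(2)) auto
    then obtain N0 where N0: "\<And>n. n \<ge> N0 \<Longrightarrow> \<beta> n < r / 2"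
      unfolding eventually_sequentially by blast
    have "norm (lr_norm \<infinity> (\<lambda>n. if n < N then 0 else vnorm V (v n)) - 0) < r" if "N \<ge> N0" for N
    proof -
      have "lr_mem \<infinity> (\<lambda>n. if n < N then 0 else vnorm V (v n)) \<and>
          lr_norm \<infinity> (\<lambda>n. if n < N then 0 else vnorm V (v n)) \<le> r / 2"
        using order_trans[OF v_norm less_imp_le[OF N0]] \<open>0 < r\<close> that v_in
        by (subst lr_ball_iff) (auto simp: vnorm_nonneg)
      moreover from this have "0 \<le> lr_norm \<infinity> (\<lambda>n. if n < N then 0 else vnorm V (v n))"
        using v_in by (intro lr_norm_nonneg) (auto simp: vnorm_nonneg)
      ultimately show ?thesis
        using \<open>0 < r\<close> by simp
    qed
    then show "\<exists>N0. \<forall>N\<ge>N0. norm (lr_norm \<infinity> (\<lambda>n. if n < N then 0 else vnorm V (v n)) - 0) < r"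
      by blast
  qed
  define M where "M = ker_theta 1 V v"
  interpret Y: quotient_normed_space ?L M
    unfolding M_def by (rule V1.quotient_ker_theta[OF v(1)])
  let ?Y = "l1_mod M" and ?\<pi> = "\<lambda>x. M +>\<^bsub>?L\<^esub> x"
  have Y: "?Y = quotient_space ?L M"
    by (simp add: l1_mod_def)
  have Y_complete: "abs_complete ?Y"
    unfolding Y by (rule Y.abs_complete_quotient[OF abs_complete_ell1])
  interpret Yc: conjugate_sequences ?Y p q
    using Y_complete conjugate Y.complex_normed_space_quotient
    by (simp add: conjugate_sequences_def conjugate_sequences_axioms_def Y)
  obtain S where S: "bounded_op ?Y V S" "\<And>x. x \<in> carrier ?L \<Longrightarrow> S (?\<pi> x) = theta V v x"
    using Y.quotient_lift[OF V1.bounded_op_theta[OF v(1)]] unfolding Y by (auto simp: M_def ker_theta_def)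
  interpret S: bounded_op ?Y V S by (rule S)
  have S_inj: "A = \<zero>\<^bsub>?Y\<^esub>" if A: "A \<in> carrier ?Y" "S A = \<zero>\<^bsub>V\<^esub>" for A
  proof -
    obtain x where x: "x \<in> carrier ?L" "A = ?\<pi> x"
      using A(1) by (auto simp: Y Y.carrier_quotient)
    then have "x \<in> M"
      using A(2) S(2) by (simp add: M_def ker_theta_def)
    then show ?thesis
      using x Y.coset_eq_iff[of x "\<zero>\<^bsub>?L\<^esub>"] by (simp add: Y Y.quotient_zero del: ell_ops)
  qed
  have "(\<lambda>x. S (?\<pi> x)) ` uball ?L = pco 1 V v"
    unfolding V1.pco_eq[OF v(1)] by (intro image_cong) (auto simp: S uball_def)
  then have S_ball: "S ` uball ?Y \<subseteq> pco 1 V v"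
    using Y.lift_uball_subset_closure[of V S] S(1) V1.closure_pco[OF v(1) v_tail] by (simp add: Y)
  have compact: "compactin (ntop V) (pco 1 V v)"
    by (rule V1.compactin_pco[OF v(1) v_tail])
  have "ntop V closure_of (S ` uball ?Y) \<subseteq> pco 1 V v"
    using closure_of_mono[OF S_ball, of "ntop V"] V1.closure_pco[OF v(1) v_tail] by simp
  then have S_compact: "S \<in> compact_ops ?Y V"
    using S.in_bounded_ops closed_compactin[OF compact] by (simp add: compact_ops_def)
  have "vnorm V z \<le> 1" if z: "z \<in> pco 1 V v" for z
  proof -
    obtain x where x: "x \<in> uball ?L" "z = theta V v x"
      using z unfolding V1.pco_eq[OF v(1)] by blast
    then have "vnorm V z \<le> vnorm ?L x * vnorm (ell \<infinity> V) v"
      using V1.vnorm_theta_le[OF v(1)] by (simp add: uball_def)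
    also have "\<dots> \<le> 1"
      using x v(2) V1.Lp.vnorm_nonneg[OF v(1)] by (intro mult_le_one) (auto simp: uball_def)
    finally show ?thesis .
  qed
  then have S_norm: "sup_norm ?Y V S \<le> 1"
    unfolding sup_norm_def using S_ball Yc.zero_in_uball by (intro cSUP_least) blast+
  \<comment> \<open>With \<open>u n\<close> the coset of \<open>\<zeta> n\<close> times the unit
    vector, the diagonal operator becomes \<open>theta ?Y u\<close>. Its p-compactness and the
    estimate of \<kappa> are then instances of \<open>theta_lift_p_compact\<close>.\<close>
  define u where "u n = ?\<pi> (\<lambda>k. if k = n then complex_of_real (\<zeta> n) else 0)" for n
  have u_in: "u n \<in> carrier ?Y" for n
    using ell1_single[OF \<zeta>0] by (auto simp: u_def Y Y.carrier_quotient)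
  have u_norm: "vnorm ?Y (u n) \<le> \<zeta> n" for n
    using order_trans[OF Y.vnorm_coset_le[OF ell1_single(1)[OF \<zeta>0]] ell1_single(2)[OF \<zeta>0]]
    by (simp add: u_def Y)
  have "lr_mem p (\<lambda>n. vnorm ?Y (u n)) \<and> lr_norm p (\<lambda>n. vnorm ?Y (u n)) \<le> lr_norm p \<zeta>"
    using \<beta>(5) u_norm u_in by (intro lr_mono[OF p_ge_1]) (auto simp: Yc.vnorm_nonneg \<zeta>_def[abs_def])
  then have u: "u \<in> carrier (ell p ?Y)" "vnorm (ell p ?Y) u \<le> vnorm (ell p V) y + e"
    using u_in \<beta>(6) by (auto simp: carrier_ell vnorm_ell \<zeta>_def[abs_def])
  have Su: "S (u n) = y n" for n
  proof -
    have "(if k = n then complex_of_real (\<zeta> n) else 0) \<odot>\<^bsub>V\<^esub> v k = (if k = n then y n else \<zero>\<^bsub>V\<^esub>)" for k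
      using v_in \<zeta>v by simp
    then show ?thesis
      using S(2)[OF ell1_single(1)[OF \<zeta>0]] nsuminf_single[OF yn(1)] by (simp add: u_def theta_def)
  qed
  have S_theta: "S (theta ?Y u \<alpha>) = theta V y \<alpha>" if \<alpha>: "\<alpha> \<in> carrier Lq" for \<alpha>
    using S.op_nsuminf[OF Y_complete, of "\<lambda>n. \<alpha> n \<odot>\<^bsub>?Y\<^esub> u n"] Yc.holder(1)[OF u(1) \<alpha>] u_in
    by (simp add: theta_def S.op_smult Su)
  interpret U: quotient_normed_space Lq "ker_theta q V y"
    by (rule quotient_ker_theta[OF y])
  \<comment> \<open>\<open>S\<close> maps this element to \<open>theta V y \<alpha>\<close>, which
    is zero, and \<open>S\<close> is injective.\<close>
  have "theta ?Y u \<alpha> = \<zero>\<^bsub>?Y\<^esub>" if \<alpha>: "\<alpha> \<in> ker_theta q V y" for \<alpha>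
    using S_inj[OF Yc.theta_in[OF u(1)]] S_theta \<alpha> by (simp add: ker_theta_def)
  then obtain R where R: "bounded_op (lq_mod_ker q V y) ?Y R"
    "\<And>\<alpha>. \<alpha> \<in> carrier Lq \<Longrightarrow> R (ker_theta q V y +>\<^bsub>Lq\<^esub> \<alpha>) = theta ?Y u \<alpha>"
    using U.quotient_lift[OF Yc.bounded_op_theta[OF u(1)]] unfolding lq_mod_ker_def by blast
  have "R \<in> p_compact_ops p q (lq_mod_ker q V y) ?Y" "kappa p q (lq_mod_ker q V y) ?Y R \<le> vnorm (ell p ?Y) u"
    using Yc.theta_lift_p_compact[OF assms(1) U.quotient_normed_space_axioms u(1)] R
    by (simp_all add: lq_mod_ker_def)
  then show ?thesis
    using that[of M R S] Y.closed_subspace S_compact S_norm u(2) R(2) S_theta by auto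
qed

end

section \<open>Assembly of the equivalences and of the two infimum formulas\<close>

theorem proposition2p3:
  fixes E :: "'a cnspace" and F :: "'b cnspace"
    and p q :: ennreal and m :: nat and P :: "'a \<Rightarrow> 'b"
  assumes "complex_banach_space E" and "complex_banach_space F"
    and "1 \<le> p" and "p < \<infinity>" and "1 / p + 1 / q = 1"
    and "P \<in> hom_polys m E F"
  shows "(P \<in> p_compact_polys p q m E F \<longleftrightarrow> (\<exists>y Q T. factors_via_Q_T p q m E F P y Q T)) \<and>
    (P \<in> p_compact_polys p q m E F \<longleftrightarrow> (\<exists>y M Q R S. factors_via_Q_R_S p q m E F P y M Q R S)) \<and>
    ((\<exists>y Q T. factors_via_Q_T p q m E F P y Q T) \<longrightarrow>
      kappa p q E F P =
        Inf {sup_norm E (lq_mod_ker q F y) Q * kappa p q (lq_mod_ker q F y) F T |y Q T.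
          factors_via_Q_T p q m E F P y Q T}) \<and>
    ((\<exists>y M Q R S. factors_via_Q_R_S p q m E F P y M Q R S) \<longrightarrow>
      kappa p q E F P =
        Inf {sup_norm E (lq_mod_ker q F y) Q * kappa p q (lq_mod_ker q F y) (l1_mod M) R
             * sup_norm (l1_mod M) F S |y M Q R S.
          factors_via_Q_R_S p q m E F P y M Q R S})"
proof -
  interpret E: complex_banach_space E by (rule assms)
  interpret F: complex_banach_space F by (rule assms)
  interpret F: conjugate_sequences F p q
    using F.abs_complete assms(5) by unfold_locales
  have p: "p \<noteq> \<infinity>"
    using assms(4) by simp
  note E = E.complex_normed_space_axioms
  have lq: "complex_normed_space (lq_mod_ker q F y)" if "y \<in> carrier (ell p F)" for y
    using quotient_normed_space.complex_normed_space_quotient[OF F.quotient_ker_theta[OF that]]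
    by (simp add: lq_mod_ker_def)
  have L1: "complex_normed_space (ell 1 complex_space)"
    using complex_normed_space.complex_normed_space_ell[OF complex_normed_space_complex, of 1] by simp
  \<comment> \<open>In (iii) \<open>M\<close> is arbitrary, so \<open>l1_mod M\<close> has to be
    admissible for every closed \<open>M\<close> and not only for the kernel constructed
    above.\<close>
  have l1: "conjugate_sequences (l1_mod M) p q" if "closed_subspace M (ell 1 complex_space)" for M
  proof -
    interpret Y: quotient_normed_space "ell 1 complex_space" M
      using L1 that by (simp add: quotient_normed_space_def quotient_normed_space_axioms_def)
    show ?thesis
      using Y.complex_normed_space_quotient Y.abs_complete_quotient[OF abs_complete_ell1] assms(5)
      by (simp add: conjugate_sequences_def conjugate_sequences_axioms_def l1_mod_def)
  qed
  have QT: "P \<in> p_compact_polys p q m E F"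
      "kappa p q E F P \<le> sup_norm E (lq_mod_ker q F y) Q * kappa p q (lq_mod_ker q F y) F T"
    if "factors_via_Q_T p q m E F P y Q T" for y Q T
    using F.kappa_comp_hom_poly[OF p E lq, of y Q m T P] that assms(6)
    by (auto simp: factors_via_Q_T_def p_compact_polys_def)
  \<comment> \<open>(iii) reduces to (ii), with the composition of \<open>S\<close> and
    \<open>R\<close> in the place of \<open>T\<close>.\<close>
  have QRS: "factors_via_Q_T p q m E F P y Q (\<lambda>x. S (R x))"
      "kappa p q E F P \<le> sup_norm E (lq_mod_ker q F y) Q * kappa p q (lq_mod_ker q F y) (l1_mod M) R
        * sup_norm (l1_mod M) F S"
    if f: "factors_via_Q_R_S p q m E F P y M Q R S" for y M Q R S
  proof -
    have y: "y \<in> carrier (ell p F)" and M: "closed_subspace M (ell 1 complex_space)"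
      and Q: "Q \<in> hom_polys m E (lq_mod_ker q F y)"
      and R: "R \<in> p_compact_ops p q (lq_mod_ker q F y) (l1_mod M)"
      and S: "S \<in> compact_ops (l1_mod M) F" and P: "\<And>x. x \<in> carrier E \<Longrightarrow> P x = S (R (Q x))"
      using f by (auto simp: factors_via_Q_R_S_def)
    interpret Y: conjugate_sequences "l1_mod M" p q
      by (rule l1[OF M])
    have S': "bounded_op (l1_mod M) F S"
      using S Y.complex_normed_space_axioms F.complex_normed_space_axioms
      by (simp add: compact_ops_def bounded_op_def bounded_op_axioms_def)
    note comp = Y.p_compact_ops_comp[OF p lq[OF y] S' F.conjugate_sequences_axioms R]
    show fac: "factors_via_Q_T p q m E F P y Q (\<lambda>x. S (R x))"
      using y Q comp(1) P by (simp add: factors_via_Q_T_def)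
    \<comment> \<open>The sign of the norm of \<open>Q\<close> is needed to multiply the estimate
      for the composition by it.\<close>
    have "vnorm (lq_mod_ker q F y) (Q x) \<le> sup_norm E (lq_mod_ker q F y) Q" if "x \<in> uball E" for x
      unfolding sup_norm_def using hom_poly_bdd_above[OF E lq[OF y] Q] that by (intro cSUP_upper)
    from this[of "\<zero>\<^bsub>E\<^esub>"] have "0 \<le> sup_norm E (lq_mod_ker q F y) Q"
      using complex_normed_space.vnorm_nonneg[OF lq[OF y] hom_poly_in[OF E lq[OF y] Q E.M.zero_closed]] by simp
    then show "kappa p q E F P \<le> sup_norm E (lq_mod_ker q F y) Q * kappa p q (lq_mod_ker q F y) (l1_mod M) R
        * sup_norm (l1_mod M) F S"
      using QT(2)[OF fac] mult_left_mono[OF comp(2)] by (fastforce simp: mult_ac)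
  qed
  \<comment> \<open>One \<open>y\<close> and one \<open>Q\<close> serve both factorizations. Half of
    \<open>e\<close> pays for a near-optimal \<open>y\<close>, the other half for the weights that
    move a null sequence into \<open>S\<close>.\<close>
  have ex: "(\<exists>y Q T. factors_via_Q_T p q m E F P y Q T \<and>
        sup_norm E (lq_mod_ker q F y) Q * kappa p q (lq_mod_ker q F y) F T \<le> kappa p q E F P + e) \<and>
      (\<exists>y M Q R S. factors_via_Q_R_S p q m E F P y M Q R S \<and>
        sup_norm E (lq_mod_ker q F y) Q * kappa p q (lq_mod_ker q F y) (l1_mod M) R
          * sup_norm (l1_mod M) F S \<le> kappa p q E F P + e)"
    if P: "P \<in> p_compact_polys p q m E F" and e: "0 < e" for e
  proof -
    have e2: "0 < e / 2"
      using e by simp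
    obtain z where z: "z \<in> carrier (ell p F)" "P ` uball E \<subseteq> pco q F z"
      using P F.rel_p_compact_iff[OF p] by (auto simp: p_compact_polys_def)
    obtain y where y: "y \<in> carrier (ell p F)" "P ` uball E \<subseteq> pco q F y"
      "vnorm (ell p F) y < kappa p q E F P + e / 2"
      using F.p_measure_witness[OF z e2] unfolding kappa_def by blast
    let ?U = "lq_mod_ker q F y"
    interpret U: complex_normed_space ?U
      by (rule lq[OF y(1)])
    obtain Q T where QT: "Q \<in> hom_polys m E ?U" "sup_norm E ?U Q \<le> 1" "bounded_op ?U F T"
      "\<And>\<alpha>. \<alpha> \<in> carrier (ell q complex_space) \<Longrightarrow> T (ker_theta q F y +>\<^bsub>ell q complex_space\<^esub> \<alpha>) = theta F y \<alpha>"
      "\<And>x. x \<in> carrier E \<Longrightarrow> P x = T (Q x)"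
      using F.hom_poly_lift[OF E assms(6) y(1,2)] by metis
    have "vnorm ?U (Q x) \<le> sup_norm E ?U Q" if "x \<in> uball E" for x
      unfolding sup_norm_def using hom_poly_bdd_above[OF E lq[OF y(1)] QT(1)] that by (intro cSUP_upper)
    from this[of "\<zero>\<^bsub>E\<^esub>"] have Q0: "0 \<le> sup_norm E ?U Q"
      using U.vnorm_nonneg[OF hom_poly_in[OF E lq[OF y(1)] QT(1) E.M.zero_closed]] by simp
    have T: "T \<in> p_compact_ops p q ?U F" "kappa p q ?U F T \<le> vnorm (ell p F) y"
      using F.theta_lift_p_compact[OF p F.quotient_ker_theta[OF y(1)] y(1)] QT(3,4)
      by (simp_all add: lq_mod_ker_def)
    obtain M R S where M: "closed_subspace M (ell 1 complex_space)"
      and R: "R \<in> p_compact_ops p q ?U (l1_mod M)" "kappa p q ?U (l1_mod M) R \<le> vnorm (ell p F) y + e / 2"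
      and S: "S \<in> compact_ops (l1_mod M) F" "sup_norm (l1_mod M) F S \<le> 1"
      and SR: "\<And>\<alpha>. \<alpha> \<in> carrier (ell q complex_space) \<Longrightarrow>
        S (R (ker_theta q F y +>\<^bsub>ell q complex_space\<^esub> \<alpha>)) = theta F y \<alpha>"
      using F.theta_factors_through_l1_mod[OF p y(1) e2] by metis
    have SRT: "S (R A) = T A" if "A \<in> carrier ?U" for A
      using that SR QT(4) quotient_normed_space.carrier_quotient[OF F.quotient_ker_theta[OF y(1)]]
      by (auto simp: lq_mod_ker_def)
    interpret Y: conjugate_sequences "l1_mod M" p q
      by (rule l1[OF M])
    \<comment> \<open>The bound 1 on the norm of \<open>Q\<close> can be used only once \<kappa> of
      \<open>T\<close> is known to be nonnegative, and that presupposes a covering sequence.\<close>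
    obtain w where "w \<in> carrier (ell p F)" "T ` uball ?U \<subseteq> pco q F w"
      using T(1) F.rel_p_compact_iff[OF p] by (auto simp: p_compact_ops_def)
    then have "0 \<le> kappa p q ?U F T"
      unfolding kappa_def by (rule F.p_measure_nonneg)
    then have "sup_norm E ?U Q * kappa p q ?U F T \<le> kappa p q E F P + e"
      using mult_right_mono[OF QT(2)] T(2) y(3) e by fastforce
    moreover have "factors_via_Q_T p q m E F P y Q T"
      using y QT T by (simp add: factors_via_Q_T_def)
    moreover have "factors_via_Q_R_S p q m E F P y M Q R S"
      using y M QT R S SRT hom_poly_in[OF E lq[OF y(1)] QT(1)] by (simp add: factors_via_Q_R_S_def)
    moreover have "sup_norm E ?U Q * kappa p q ?U (l1_mod M) R * sup_norm (l1_mod M) F S \<le> kappa p q E F P + e"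
    proof -
      obtain w where "w \<in> carrier (ell p (l1_mod M))" "R ` uball ?U \<subseteq> pco q (l1_mod M) w"
        using R(1) Y.rel_p_compact_iff[OF p] by (auto simp: p_compact_ops_def)
      then have R0: "0 \<le> kappa p q ?U (l1_mod M) R"
        unfolding kappa_def by (rule Y.p_measure_nonneg)
      have "sup_norm E ?U Q * kappa p q ?U (l1_mod M) R * sup_norm (l1_mod M) F S
          \<le> sup_norm E ?U Q * kappa p q ?U (l1_mod M) R"
        using S(2) Q0 R0 by (intro mult_left_le) auto
      also have "\<dots> \<le> kappa p q ?U (l1_mod M) R"
        using QT(2) Q0 R0 by (intro mult_left_le_one_le)
      finally show ?thesis
        using R(2) y(3) by simp
    qed
    ultimately show ?thesis
      by blast
  qed
  have "P \<in> p_compact_polys p q m E F \<longleftrightarrow> (\<exists>y Q T. factors_via_Q_T p q m E F P y Q T)"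
    using ex[OF _ zero_less_one] QT(1) by blast
  moreover have "P \<in> p_compact_polys p q m E F \<longleftrightarrow> (\<exists>y M Q R S. factors_via_Q_R_S p q m E F P y M Q R S)"
    using ex[OF _ zero_less_one] QT(1) QRS(1) by blast
  moreover have "kappa p q E F P =
      Inf {sup_norm E (lq_mod_ker q F y) Q * kappa p q (lq_mod_ker q F y) F T |y Q T.
        factors_via_Q_T p q m E F P y Q T}" if "P \<in> p_compact_polys p q m E F"
    using QT(2) conjunct1[OF ex[OF that]] by (intro eq_cInfI) blast+
  moreover have "kappa p q E F P =
      Inf {sup_norm E (lq_mod_ker q F y) Q * kappa p q (lq_mod_ker q F y) (l1_mod M) R
           * sup_norm (l1_mod M) F S |y M Q R S.
        factors_via_Q_R_S p q m E F P y M Q R S}" if "P \<in> p_compact_polys p q m E F"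
    using QRS(2) conjunct2[OF ex[OF that]] by (intro eq_cInfI) blast+
  ultimately show ?thesis
    by blast
qed

end
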